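(* Let $\Bbbk$ be a field of characteristic zero, $R=\Bbbk[x_1,\ldots,x_n]$, $\mathfrak p\subset R$ a prime ideal of codimension $c$ such that $\{x_{c+1},\ldots,x_n\}$ is a basis modulo $\mathfrak p$, and $\mathbb F=R_{\mathfrak p}/\mathfrak pR_{\mathfrak p}$. Let $M$ be a finitely generated $R$-module with a short exact sequence $0\to K\to R^r\to M\to0$, and let $m\ge1$ be an integer. Put $$\mathbb V'=\mathbb B\cdot\gamma(K)+\mathfrak n^m\mathbb B^r\subseteq\mathbb B^r,\qquad \mathbb W'=(\mathbb V')^\perp\subseteq\mathbb F[z_1,\ldots,z_c]^r,\qquad \mathcal E'=\Omega(\mathbb W')\subseteq\mathbb F\otimes_R(D_{n,c})^r .$$ Then the following four sets of objects are in bijective correspondence: (a) $\mathfrak p$-primary $R$-submodules $U\subseteq M$ of multiplicity $m$ over $\mathfrak p$; (b) $\mathbb F$-points $\mathbb V\subseteq\mathbb F[[y_1,\ldots,y_c]]^r$ of the punctual Quot scheme $\mathrm{Quot}^m(\mathbb F[[y_1,\ldots,y_c]]^r)$ with $\mathbb V\supseteq\mathbb V'$; (c) $m$-dimensional $\mathbb F$-subspaces $\mathbb W\subseteq\mathbb F[z_1,\ldots,z_c]^r$ that are closed under differentiation, with $\mathbb W\subseteq\mathbb W'$; (d) $m$-dimensional $\mathbb F$-subspaces $\mathcal E\subseteq\mathbb F\otimes_R(D_{n,c})^r$ of the Weyl-Noether module that are $R$-bimodules, with $\mathcal E\subseteq\mathcal E'$. The correspondence sends $U$ to $\mathbb V=\mathbb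 B\cdot\gamma(\widetilde U)+\mathfrak n^m\mathbb B^r$, $\mathbb W=\mathbb V^\perp$ and $\mathcal E=\Omega(\mathbb W)$, where $\widetilde U\subseteq R^r$ is the lift of $U$. Moreover, any $\mathbb F$-basis of the subspace $\mathcal E$ in (d) can be lifted to Noetherian operators $\delta_1,\ldots,\delta_m\in(D_{n,c})^r$ for the lift $\widetilde U\subseteq R^r$ of the submodule $U$ in (a), i.e. $\widetilde U=\{w\in R^r\mid\delta_i(w)\in\mathfrak p\text{ for all }1\le i\le m\}$.
   Context: Basis modulo $\mathfrak p$: a set of variables $\{x_{i_1},\ldots,x_{i_\ell}\}$ is independent modulo $\mathfrak p$ if $\Bbbk[x_{i_1},\ldots,x_{i_\ell}]\cap\mathfrak p=\{0\}$; a basis modulo $\mathfrak p$ is a maximal such set. Primary submodules: $U\subseteq M$ is $\mathfrak p$-primary if $\mathrm{Ass}_R(M/U)=\{\mathfrak p\}$; its multiplicity over $\mathfrak p$ is $\mathrm{length}_{R_{\mathfrak p}}(M_{\mathfrak p}/U_{\mathfrak p})$. The lift of $U\subseteq M$ to $R^r$ is the unique $R$-submodule $\widetilde U\subseteq R^r$ containing $K$ with $\widetilde U/K=U$ (the preimage of $U$ under $R^r\to M$). Power series side: $\mathbb B=\mathbb F[[y_1,\ldots,y_c]]$ with maximal ideal $\mathfrak n=(y_1,\ldots,y_c)$. The $\mathbb F$-points of $\mathrm{Quot}^m(\mathbb B^r)$ are the $\mathbb B$-submodules $\mathbb V\subseteq\mathbb B^r$ with $\dim_{\mathbb F}(\mathbb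 B^r/\mathbb V)=m$. For $f\in R$ let $\overline f$ be its class in $\mathbb F$. The ring map $\eta:R\hookrightarrow\mathbb B$ is the $\Bbbk$-algebra map with $x_i\mapsto y_i+\overline{x_i}$ for $1\le i\le c$ and $x_j\mapsto\overline{x_j}$ for $c+1\le j\le n$; $\gamma:R^r\hookrightarrow\mathbb B^r$ applies $\eta$ to each coordinate. Inverse systems: $\mathbb E=\mathbb F[z_1,\ldots,z_c]$ is a $\mathbb B$-module with $y_i$ acting as $\partial/\partial z_i$. An $\mathbb F$-subspace of $\mathbb E^r$ is closed under differentiation if it is stable under all $\partial/\partial z_i$ (acting coordinatewise). For $v\in\mathbb B^r$, $w\in\mathbb E^r$ put $v\cdot w=\sum_{i=1}^r v_i\cdot w_i\in\mathbb E$. For $\mathbb V\subseteq\mathbb B^r$, $\mathbb V^\perp=\{w\in\mathbb E^r\mid v\cdot w=0\ \forall v\in\mathbb V\}$. Differential operators: $D_n=R\langle\partial_{x_1},\ldots,\partial_{x_n}\rangle$ is the Weyl algebra and $D_{n,c}=R\langle\partial_{x_1},\ldots,\partial_{x_c}\rangle\subseteq D_n$ the relative Weyl algebra. An element $\delta=(\delta^{(1)},\ldots,\delta^{(r)})\in(D_n)^r$ acts as a differential operator $R^r\to R$ by $\delta(w)=\sum_j\delta^{(j)}(w_j)$. The module $\mathbb F\otimes_R D_{n,c}=\bigoplus_{\alpha\in\mathbb N^c}\mathbb F\,\overline{\partial_{\mathbf x}^\alpha}$ (with $\overline{\partial_{\mathbf x}^\alpha}=1\otimes\partial_{x_1}^{\alpha_1}\cdots\partial_{x_c}^{\alpha_c}$)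 is a left $\mathbb F$-vector space and carries a right $R$-action from right multiplication on $D_{n,c}$; a subspace is an $R$-bimodule if it is stable under both $R$-actions. The map $\Omega:\mathbb E^r\to\mathbb F\otimes_R(D_{n,c})^r$ is the $\mathbb F$-linear isomorphism given on each coordinate by $\mathbf z^\alpha\mapsto\overline{\partial_{\mathbf x}^\alpha}$. Lifting: a lift of $\epsilon=\sum_\alpha\epsilon_\alpha\overline{\partial_{\mathbf x}^\alpha}\in\mathbb F\otimes_R(D_{n,c})^r$ (with $\epsilon_\alpha\in\mathbb F^r$) is obtained by multiplying $\epsilon$ by a nonzero element of $R/\mathfrak p$ clearing denominators, so that all coefficients lie in $(R/\mathfrak p)^r$, and then replacing the coefficients by representatives in $R^r$, giving an element of $(D_{n,c})^r$. *)

theory Defs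
  imports
    "HOL-Analysis.Analysis"
    "HOL-Library.Poly_Mapping"
    "HOL-Library.Extended_Nat"
begin

hide_const (open) Poly_Mapping.range Poly_Mapping.map Poly_Mapping.degree

abbreviation lookup :: "('a \<Rightarrow>\<^sub>0 'b::zero) \<Rightarrow> 'a \<Rightarrow> 'b" where
  "lookup \<equiv> Poly_Mapping.lookup"

abbreviation keys :: "('a \<Rightarrow>\<^sub>0 'b::zero) \<Rightarrow> 'a set" where
  "keys \<equiv> Poly_Mapping.keys"

section \<open>Multi-indices\<close>

type_synonym 'n multiindex = "'n \<Rightarrow>\<^sub>0 nat"

definition splits :: "'n multiindex \<Rightarrow> ('n multiindex \<times> 'n multiindex) set" where
  "splits \<alpha> = {(\<beta>, \<gamma>). \<beta> + \<gamma> = \<alpha>}"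

definition mbinom :: "'n::finite multiindex \<Rightarrow> 'n multiindex \<Rightarrow> nat" where
  "mbinom \<alpha> \<beta> = (\<Prod>i\<in>UNIV. lookup \<alpha> i choose lookup \<beta> i)"

text \<open>The multi-index falling factorial \<open>\<alpha>! / (\<alpha> - \<beta>)!\<close>, equal to \<open>0\<close> unless \<open>\<beta> \<le> \<alpha>\<close>.\<close>

definition mff :: "'n::finite multiindex \<Rightarrow> 'n multiindex \<Rightarrow> nat" where
  "mff \<alpha> \<beta> = (\<Prod>i\<in>UNIV. (lookup \<alpha> i choose lookup \<beta> i) * fact (lookup \<beta> i))"

lemma bij_splits:
  "bij_betw (\<lambda>(\<beta>, \<gamma>). lookup \<beta>) (splits (\<alpha> :: 'n::finite multiindex))
     (PiE UNIV (\<lambda>i. {..lookup \<alpha> i}))"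
proof (rule bij_betwI')
  fix x y assume x: "x \<in> splits \<alpha>"
  show "(\<lambda>(\<beta>, \<gamma>). lookup \<beta>) x \<in> PiE UNIV (\<lambda>i. {..lookup \<alpha> i})"
    using x by (auto simp: splits_def lookup_add)
  assume y: "y \<in> splits \<alpha>"
  show "((\<lambda>(\<beta>, \<gamma>). lookup \<beta>) x = (\<lambda>(\<beta>, \<gamma>). lookup \<beta>) y) = (x = y)"
  proof
    assume "(\<lambda>(\<beta>, \<gamma>). lookup \<beta>) x = (\<lambda>(\<beta>, \<gamma>). lookup \<beta>) y"
    then have "fst x = fst y"
      by (simp add: case_prod_unfold poly_mapping.lookup_inject)
    moreover have "fst x + snd x = fst y + snd y"
      using x y by (auto simp: splits_def)
    ultimately show "x = y" by (simp add: prod_eq_iff)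
  qed simp
next
  have L: "lookup (Abs_poly_mapping f) = f" for f :: "'n \<Rightarrow> nat"
    by (rule lookup_Abs_poly_mapping) simp
  fix b assume b: "b \<in> PiE UNIV (\<lambda>i. {..lookup \<alpha> i})"
  let ?x = "(Abs_poly_mapping b, Abs_poly_mapping (\<lambda>i. lookup \<alpha> i - b i))"
  have "Abs_poly_mapping b + Abs_poly_mapping (\<lambda>i. lookup \<alpha> i - b i) = \<alpha>"
    by (rule poly_mapping_eqI) (use b in \<open>auto simp: lookup_add L PiE_iff\<close>)
  then have "?x \<in> splits \<alpha>" by (simp add: splits_def)
  moreover have "b = (\<lambda>(\<beta>, \<gamma>). lookup \<beta>) ?x" by (simp add: L)
  ultimately show "\<exists>x\<in>splits \<alpha>. b = (\<lambda>(\<beta>, \<gamma>). lookup \<beta>) x" by blast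
qed

lemma finite_splits [simp]: "finite (splits (\<alpha> :: 'n::finite multiindex))"
proof -
  have "finite (PiE (UNIV :: 'n set) (\<lambda>i. {..lookup \<alpha> i}))"
    by (rule finite_PiE) auto
  then show ?thesis by (simp only: bij_betw_finite[OF bij_splits])
qed

lemma sum_splits_prod:
  fixes h :: "'n::finite \<Rightarrow> nat \<Rightarrow> nat \<Rightarrow> 'a::comm_semiring_1"
  shows "(\<Sum>(\<beta>, \<gamma>)\<in>splits \<alpha>. \<Prod>i\<in>UNIV. h i (lookup \<beta> i) (lookup \<gamma> i)) =
    (\<Prod>i\<in>UNIV. \<Sum>b\<le>lookup \<alpha> i. h i b (lookup \<alpha> i - b))"
proof -
  have "(\<Prod>i\<in>UNIV. \<Sum>b\<le>lookup \<alpha> i. h i b (lookup \<alpha> i - b)) =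
     (\<Sum>b\<in>PiE UNIV (\<lambda>i. {..lookup \<alpha> i}). \<Prod>i\<in>UNIV. h i (b i) (lookup \<alpha> i - b i))"
    by (rule prod_sum_PiE) auto
  also have "\<dots> = (\<Sum>x\<in>splits \<alpha>. \<Prod>i\<in>UNIV. h i ((\<lambda>(\<beta>, \<gamma>). lookup \<beta>) x i)
       (lookup \<alpha> i - (\<lambda>(\<beta>, \<gamma>). lookup \<beta>) x i))"
    by (rule sum.reindex_bij_betw[OF bij_splits, symmetric])
  also have "\<dots> = (\<Sum>(\<beta>, \<gamma>)\<in>splits \<alpha>. \<Prod>i\<in>UNIV. h i (lookup \<beta> i) (lookup \<gamma> i))"
    by (rule sum.cong) (auto simp: splits_def lookup_add)
  finally show ?thesis ..
qed


section \<open>Polynomials and their derivatives\<close>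

text \<open>Variables are indexed by a finite type rather than by \<open>1, \<dots>, n\<close>; a designated set \<open>C\<close> of
  indices plays the role of \<open>{1, \<dots>, c}\<close>.\<close>

type_synonym ('n, 'a) mpol = "'n multiindex \<Rightarrow>\<^sub>0 'a"

definition mpol_const :: "'a::zero \<Rightarrow> ('n, 'a) mpol" where
  "mpol_const a = Poly_Mapping.single 0 a"

definition mpol_var :: "'n \<Rightarrow> ('n, 'a::zero_neq_one) mpol" where
  "mpol_var i = Poly_Mapping.single (Poly_Mapping.single i 1) 1"

definition mpol_in :: "'n set \<Rightarrow> ('n, 'a::zero) mpol set" where
  "mpol_in S = {f. \<forall>\<alpha>\<in>keys f. keys \<alpha> \<subseteq> S}"

text \<open>The operator \<open>\<partial>\<^sup>\<alpha>\<close>, sending \<open>x\<^sup>\<beta>\<close> to \<open>\<beta>! / (\<beta> - \<alpha>)! x\<^sup>\<beta>\<^sup>-\<^sup>\<alpha>\<close>.\<close>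

definition mderiv :: "'n::finite multiindex \<Rightarrow> ('n, 'a::comm_semiring_1) mpol \<Rightarrow> ('n, 'a) mpol"
  where "mderiv \<alpha> f =
    (\<Sum>\<beta>\<in>keys f. Poly_Mapping.single (\<beta> - \<alpha>) (of_nat (mff \<beta> \<alpha>) * lookup f \<beta>))"

lemma single_sum:
  "Poly_Mapping.single \<alpha> (sum f A) = (\<Sum>x\<in>A. Poly_Mapping.single \<alpha> (f x))"
  by (induction A rule: infinite_finite_induct) (simp_all add: single_add)

lemma mderiv_superset:
  assumes "finite A" "keys f \<subseteq> A"
  shows "mderiv \<alpha> f =
    (\<Sum>\<beta>\<in>A. Poly_Mapping.single (\<beta> - \<alpha>) (of_nat (mff \<beta> \<alpha>) * lookup f \<beta>))"
  unfolding mderiv_def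
  by (rule sum.mono_neutral_left) (use assms in \<open>auto simp: in_keys_iff\<close>)

lemma mderiv_add: "mderiv \<alpha> (f + g) = mderiv \<alpha> f + mderiv \<alpha> g"
proof -
  let ?A = "keys f \<union> keys g"
  have "keys (f + g) \<subseteq> ?A" by (rule Poly_Mapping.keys_add)
  then show ?thesis
    by (simp add: mderiv_superset[of ?A] lookup_add distrib_left single_add sum.distrib)
qed

lemma mderiv_zero [simp]: "mderiv \<alpha> 0 = 0"
  by (simp add: mderiv_def)

lemma mderiv_sum: "mderiv \<alpha> (sum f A) = (\<Sum>x\<in>A. mderiv \<alpha> (f x))"
  by (induction A rule: infinite_finite_induct) (auto simp: mderiv_add)

lemma mderiv_single:
  "mderiv \<alpha> (Poly_Mapping.single \<beta> a) = Poly_Mapping.single (\<beta> - \<alpha>) (of_nat (mff \<beta> \<alpha>) * a)"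
  by (subst mderiv_superset[of "{\<beta>}"]) auto

lemma mpol_sum_monomials: "f = (\<Sum>\<beta>\<in>keys f. Poly_Mapping.single \<beta> (lookup f \<beta>))"
proof (rule poly_mapping_eqI)
  fix \<alpha>
  show "lookup f \<alpha> = lookup (\<Sum>\<beta>\<in>keys f. Poly_Mapping.single \<beta> (lookup f \<beta>)) \<alpha>"
    by (cases "\<alpha> \<in> keys f")
      (auto simp: lookup_sum lookup_single when_def in_keys_iff)
qed

lemma mff_le: "mff \<beta> \<alpha> \<noteq> 0 \<Longrightarrow> lookup \<alpha> i \<le> lookup \<beta> i"
  by (auto simp: mff_def not_less[symmetric] binomial_eq_0)

lemma mderiv_0 [simp]: "mderiv 0 f = f"
proof -
  have "mderiv 0 f = (\<Sum>\<beta>\<in>keys f. Poly_Mapping.single \<beta> (lookup f \<beta>))"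
    by (simp add: mderiv_def mff_def)
  then show ?thesis using mpol_sum_monomials[of f] by simp
qed

lemma ff_add:
  "(t choose (a + b)) * fact (a + b) = (t choose b) * fact b * (((t - b) choose a) * fact a :: nat)"
proof (cases "a + b \<le> t")
  case True
  have 1: "(fact a * fact (t - b - a)) * ((t - b) choose a) = (fact (t - b) :: nat)"
    by (rule binomial_fact_lemma) (use True in auto)
  have 2: "(fact b * fact (t - b)) * (t choose b) = (fact t :: nat)"
    by (rule binomial_fact_lemma) (use True in auto)
  have 3: "(fact (a + b) * fact (t - (a + b))) * (t choose (a + b)) = (fact t :: nat)"
    by (rule binomial_fact_lemma) (use True in auto)
  have e: "t - (a + b) = t - b - a" by simp
  have "fact (t - b - a) * ((t choose (a + b)) * fact (a + b)) =
      fact (t - b - a) * ((t choose b) * fact b * (((t - b) choose a) * fact a) :: nat)"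
    using 1 2 3 unfolding e by (metis (no_types, lifting) mult.assoc mult.commute)
  then show ?thesis by simp
next
  case False
  then show ?thesis by (cases "b \<le> t") (auto simp: binomial_eq_0)
qed

lemma mff_add: "mff \<beta> (\<alpha> + \<alpha>') = mff \<beta> \<alpha>' * mff (\<beta> - \<alpha>') \<alpha>"
  unfolding mff_def prod.distrib[symmetric]
  by (rule prod.cong) (auto simp: lookup_add lookup_minus ff_add)

text \<open>These two facts confirm that \<open>mderiv \<alpha>\<close> is the composite of the coordinate derivations.\<close>

lemma mderiv_mderiv: "mderiv (\<alpha> + \<alpha>') f = mderiv \<alpha> (mderiv \<alpha>' f)"
proof -
  have "mderiv \<alpha> (mderiv \<alpha>' f) = (\<Sum>\<beta>\<in>keys f. Poly_Mapping.single (\<beta> - \<alpha>' - \<alpha>)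
      (of_nat (mff (\<beta> - \<alpha>') \<alpha>) * (of_nat (mff \<beta> \<alpha>') * lookup f \<beta>)))"
    by (simp add: mderiv_def[of \<alpha>' f] mderiv_sum mderiv_single)
  also have "\<dots> = mderiv (\<alpha> + \<alpha>') f"
    unfolding mderiv_def
  proof (rule sum.cong)
    fix \<beta> assume "\<beta> \<in> keys f"
    have "\<beta> - \<alpha>' - \<alpha> = \<beta> - (\<alpha> + \<alpha>')"
      by (rule poly_mapping_eqI) (simp add: lookup_minus lookup_add)
    then show "Poly_Mapping.single (\<beta> - \<alpha>' - \<alpha>)
        (of_nat (mff (\<beta> - \<alpha>') \<alpha>) * (of_nat (mff \<beta> \<alpha>') * lookup f \<beta>)) =
      Poly_Mapping.single (\<beta> - (\<alpha> + \<alpha>')) (of_nat (mff \<beta> (\<alpha> + \<alpha>')) * lookup f \<beta>)"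
      by (simp add: mff_add ac_simps)
  qed simp
  finally show ?thesis ..
qed

lemma mderiv_var_single:
  "mderiv (Poly_Mapping.single i 1) (Poly_Mapping.single \<beta> a) =
    Poly_Mapping.single (\<beta> - Poly_Mapping.single i 1) (of_nat (lookup \<beta> i) * a)"
proof -
  have "mff \<beta> (Poly_Mapping.single i 1) = (\<Prod>j\<in>UNIV. if j = i then lookup \<beta> i else 1)"
    unfolding mff_def by (rule prod.cong) (auto simp: lookup_single when_def)
  then show ?thesis by (simp add: mderiv_single)
qed

lemma finite_mderiv_nonzero [simp]: "finite {\<alpha>. mderiv \<alpha> f \<noteq> 0}"
proof (rule finite_subset)
  show "{\<alpha>. mderiv \<alpha> f \<noteq> 0} \<subseteq> (\<Union>\<beta>\<in>keys f. fst ` splits \<beta>)"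
  proof
    fix \<alpha> assume "\<alpha> \<in> {\<alpha>. mderiv \<alpha> f \<noteq> 0}"
    then obtain \<beta> where b: "\<beta> \<in> keys f"
      "Poly_Mapping.single (\<beta> - \<alpha>) (of_nat (mff \<beta> \<alpha>) * lookup f \<beta>) \<noteq> 0"
      unfolding mderiv_def by (auto elim: sum.not_neutral_contains_not_neutral)
    then have "mff \<beta> \<alpha> \<noteq> 0" by (cases "mff \<beta> \<alpha> = 0") auto
    then have "\<alpha> + (\<beta> - \<alpha>) = \<beta>"
      by (intro poly_mapping_eqI) (simp add: lookup_add lookup_minus mff_le)
    then have "(\<alpha>, \<beta> - \<alpha>) \<in> splits \<beta>" by (simp add: splits_def)
    then show "\<alpha> \<in> (\<Union>\<beta>\<in>keys f. fst ` splits \<beta>)" using b by force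
  qed
qed simp

lemma ff_vandermonde:
  "(\<Sum>b\<le>a. (a choose b) * (((s choose b) * fact b) * ((t choose (a - b)) * fact (a - b)))) =
    (((s + t) choose a) * fact a :: nat)"
proof -
  have "(\<Sum>b\<le>a. (a choose b) * (((s choose b) * fact b) * ((t choose (a - b)) * fact (a - b)))) =
      (\<Sum>b\<le>a. (s choose b) * (t choose (a - b)) * fact a)"
  proof (rule sum.cong)
    fix b assume "b \<in> {..a}"
    then have *: "fact b * fact (a - b) * (a choose b) = (fact a :: nat)"
      by (intro binomial_fact_lemma) auto
    show "(a choose b) * (((s choose b) * fact b) * ((t choose (a - b)) * fact (a - b))) =
      (s choose b) * (t choose (a - b)) * (fact a :: nat)"
      unfolding *[symmetric] by (simp only: ac_simps)
  qed simp
  also have "\<dots> = ((s + t) choose a) * fact a"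
    by (simp add: vandermonde[symmetric] sum_distrib_right)
  finally show ?thesis .
qed

lemma mff_vandermonde:
  "(\<Sum>(\<beta>, \<gamma>)\<in>splits \<alpha>. mbinom \<alpha> \<beta> * (mff s \<beta> * mff t \<gamma>)) = mff (s + t) \<alpha>"
proof -
  have "(\<Sum>(\<beta>, \<gamma>)\<in>splits \<alpha>. mbinom \<alpha> \<beta> * (mff s \<beta> * mff t \<gamma>)) =
     (\<Sum>(\<beta>, \<gamma>)\<in>splits \<alpha>. \<Prod>i\<in>UNIV. (lookup \<alpha> i choose lookup \<beta> i) *
        (((lookup s i choose lookup \<beta> i) * fact (lookup \<beta> i)) *
         ((lookup t i choose lookup \<gamma> i) * fact (lookup \<gamma> i))))"
    by (simp add: mbinom_def mff_def prod.distrib)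
  also have "\<dots> = mff (s + t) \<alpha>"
    unfolding sum_splits_prod[where h = "\<lambda>i b c. (lookup \<alpha> i choose b) *
        (((lookup s i choose b) * fact b) * ((lookup t i choose c) * fact c))"]
      ff_vandermonde mff_def lookup_add ..
  finally show ?thesis .
qed

lemma mderiv_mult:
  fixes f g :: "('n::finite, 'a::comm_semiring_1) mpol"
  shows "mderiv \<alpha> (f * g) =
    (\<Sum>(\<beta>, \<gamma>)\<in>splits \<alpha>. of_nat (mbinom \<alpha> \<beta>) * (mderiv \<beta> f * mderiv \<gamma> g))"
proof -
  have mono: "mderiv \<alpha> (Poly_Mapping.single s a * Poly_Mapping.single t b) =
    (\<Sum>(\<beta>, \<gamma>)\<in>splits \<alpha>. of_nat (mbinom \<alpha> \<beta>) *
      (mderiv \<beta> (Poly_Mapping.single s a) * mderiv \<gamma> (Poly_Mapping.single t b)))"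
    for s t :: "'n multiindex" and a b :: 'a
  proof -
    have "(\<Sum>(\<beta>, \<gamma>)\<in>splits \<alpha>. of_nat (mbinom \<alpha> \<beta>) *
        (mderiv \<beta> (Poly_Mapping.single s a) * mderiv \<gamma> (Poly_Mapping.single t b))) =
      (\<Sum>(\<beta>, \<gamma>)\<in>splits \<alpha>. Poly_Mapping.single (s + t - \<alpha>)
        (of_nat (mbinom \<alpha> \<beta> * (mff s \<beta> * mff t \<gamma>)) * (a * b)))"
    proof (rule sum.cong, simp, clarify)
      fix \<beta> \<gamma> assume "(\<beta>, \<gamma>) \<in> splits \<alpha>"
      then have al: "\<alpha> = \<beta> + \<gamma>" by (simp add: splits_def)
      have n: "of_nat k * Poly_Mapping.single u c = Poly_Mapping.single u (of_nat k * c)"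
        for k u and c :: 'a
        by (simp flip: single_of_nat add: mult_single)
      show "of_nat (mbinom \<alpha> \<beta>) *
        (mderiv \<beta> (Poly_Mapping.single s a) * mderiv \<gamma> (Poly_Mapping.single t b)) =
        Poly_Mapping.single (s + t - \<alpha>)
          (of_nat (mbinom \<alpha> \<beta> * (mff s \<beta> * mff t \<gamma>)) * (a * b))"
      proof (cases "mff s \<beta> = 0 \<or> mff t \<gamma> = 0")
        case True
        then show ?thesis by (auto simp: mderiv_single)
      next
        case False
        then have le: "lookup \<beta> i \<le> lookup s i" "lookup \<gamma> i \<le> lookup t i" for i
          by (auto intro: mff_le)
        have "(s - \<beta>) + (t - \<gamma>) = s + t - \<alpha>"
          unfolding al
          by (rule poly_mapping_eqI) (use le in \<open>simp add: lookup_add lookup_minus\<close>)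
        then show ?thesis
          by (simp add: mderiv_single mult_single n ac_simps)
      qed
    qed
    also have "\<dots> = Poly_Mapping.single (s + t - \<alpha>) (of_nat (mff (s + t) \<alpha>) * (a * b))"
      unfolding mff_vandermonde[symmetric] of_nat_sum sum_distrib_right
      by (simp add: case_prod_unfold single_sum)
    also have "\<dots> = mderiv \<alpha> (Poly_Mapping.single s a * Poly_Mapping.single t b)"
      by (simp add: mult_single mderiv_single)
    finally show ?thesis ..
  qed
  let ?m = "\<lambda>f (s :: 'n multiindex). Poly_Mapping.single s (lookup f s :: 'a)"
  have "mderiv \<alpha> (f * g) = mderiv \<alpha> ((\<Sum>s\<in>keys f. ?m f s) * (\<Sum>t\<in>keys g. ?m g t))"
    by (simp flip: mpol_sum_monomials)
  also have "\<dots> = (\<Sum>s\<in>keys f. \<Sum>t\<in>keys g. \<Sum>(\<beta>, \<gamma>)\<in>splits \<alpha>.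
      of_nat (mbinom \<alpha> \<beta>) * (mderiv \<beta> (?m f s) * mderiv \<gamma> (?m g t)))"
    unfolding sum_product mderiv_sum mono ..
  also have "\<dots> = (\<Sum>s\<in>keys f. \<Sum>x\<in>splits \<alpha>. \<Sum>t\<in>keys g.
      of_nat (mbinom \<alpha> (fst x)) * (mderiv (fst x) (?m f s) * mderiv (snd x) (?m g t)))"
    unfolding case_prod_unfold by (intro sum.cong refl sum.swap)
  also have "\<dots> = (\<Sum>x\<in>splits \<alpha>. \<Sum>s\<in>keys f. \<Sum>t\<in>keys g.
      of_nat (mbinom \<alpha> (fst x)) * (mderiv (fst x) (?m f s) * mderiv (snd x) (?m g t)))"
    by (rule sum.swap)
  also have "\<dots> = (\<Sum>x\<in>splits \<alpha>. of_nat (mbinom \<alpha> (fst x)) *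
      (mderiv (fst x) (\<Sum>s\<in>keys f. ?m f s) * mderiv (snd x) (\<Sum>t\<in>keys g. ?m g t)))"
    by (simp only: mderiv_sum sum_product, simp only: sum_distrib_left)
  also have "\<dots> = (\<Sum>(\<beta>, \<gamma>)\<in>splits \<alpha>. of_nat (mbinom \<alpha> \<beta>) * (mderiv \<beta> f * mderiv \<gamma> g))"
    by (simp add: case_prod_unfold flip: mpol_sum_monomials)
  finally show ?thesis .
qed


section \<open>Formal power series in several variables\<close>

typedef ('n, 'a) mps = "UNIV :: ('n multiindex \<Rightarrow> 'a) set"
  morphisms mps_coeff Abs_mps ..

setup_lifting type_definition_mps

lemma mps_eqI: "(\<And>\<alpha>. mps_coeff f \<alpha> = mps_coeff g \<alpha>) \<Longrightarrow> f = g"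
  by transfer auto

instantiation mps :: (finite, comm_ring_1) comm_ring_1
begin

lift_definition zero_mps :: "('a, 'b) mps" is "\<lambda>_. 0" .
lift_definition one_mps :: "('a, 'b) mps" is "\<lambda>\<alpha>. if \<alpha> = 0 then 1 else 0" .
lift_definition plus_mps :: "('a, 'b) mps \<Rightarrow> ('a, 'b) mps \<Rightarrow> ('a, 'b) mps"
  is "\<lambda>f g \<alpha>. f \<alpha> + g \<alpha>" .
lift_definition minus_mps :: "('a, 'b) mps \<Rightarrow> ('a, 'b) mps \<Rightarrow> ('a, 'b) mps"
  is "\<lambda>f g \<alpha>. f \<alpha> - g \<alpha>" .
lift_definition uminus_mps :: "('a, 'b) mps \<Rightarrow> ('a, 'b) mps" is "\<lambda>f \<alpha>. - f \<alpha>" .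
lift_definition times_mps :: "('a, 'b) mps \<Rightarrow> ('a, 'b) mps \<Rightarrow> ('a, 'b) mps"
  is "\<lambda>f g \<alpha>. \<Sum>(\<beta>, \<gamma>)\<in>splits \<alpha>. f \<beta> * g \<gamma>" .

instance
proof
  fix a b c :: "('a, 'b) mps"
  show "a + b + c = a + (b + c)" by transfer (simp add: ac_simps)
  show "a + b = b + a" by transfer (simp add: ac_simps)
  show "0 + a = a" by transfer simp
  show "- a + a = 0" by transfer simp
  show "a - b = a + - b" by transfer simp
  show "0 \<noteq> (1 :: ('a, 'b) mps)"
    by transfer (metis zero_neq_one)
  show "(a + b) * c = a * c + b * c"
    by transfer (simp add: case_prod_unfold distrib_right sum.distrib)
  show "a * b = b * a"
  proof (transfer, rule ext)
    fix f g :: "'a multiindex \<Rightarrow> 'b" and \<alpha>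
    show "(\<Sum>(\<beta>, \<gamma>)\<in>splits \<alpha>. f \<beta> * g \<gamma>) = (\<Sum>(\<beta>, \<gamma>)\<in>splits \<alpha>. g \<beta> * f \<gamma>)"
      by (rule sum.reindex_bij_witness[of _ prod.swap prod.swap])
        (auto simp: splits_def ac_simps)
  qed
  show "1 * a = a"
  proof (transfer, rule ext)
    fix f :: "'a multiindex \<Rightarrow> 'b" and \<alpha>
    have "(\<Sum>(\<beta>, \<gamma>)\<in>splits \<alpha>. (if \<beta> = 0 then 1 else 0) * f \<gamma>) =
       (\<Sum>(\<beta>, \<gamma>)\<in>{(0 :: 'a multiindex, \<alpha>)}. (if \<beta> = 0 then 1 else 0) * f \<gamma>)"
      by (rule sum.mono_neutral_right[OF finite_splits]) (auto simp: splits_def split: if_splits)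
    then show "(\<Sum>(\<beta>, \<gamma>)\<in>splits \<alpha>. (if \<beta> = 0 then 1 else 0) * f \<gamma>) = f \<alpha>" by simp
  qed
  show "a * b * c = a * (b * c)"
  proof (transfer, rule ext)
    fix f g h :: "'a multiindex \<Rightarrow> 'b" and \<alpha>
    have "(\<Sum>x\<in>splits \<alpha>. (\<Sum>y\<in>splits (fst x). f (fst y) * g (snd y)) * h (snd x)) =
      (\<Sum>(x, y)\<in>Sigma (splits \<alpha>) (\<lambda>x. splits (fst x)). f (fst y) * g (snd y) * h (snd x))"
      by (simp add: sum_distrib_right sum.Sigma)
    also have "\<dots> =
      (\<Sum>(x, y)\<in>Sigma (splits \<alpha>) (\<lambda>x. splits (snd x)). f (fst x) * (g (fst y) * h (snd y)))"
      by (rule sum.reindex_bij_witness[of _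
            "\<lambda>((a, _), (b, c)). ((a + b, c), (a, b))" "\<lambda>((_, c), (a, b)). ((a, b + c), (b, c))"])
        (auto simp: splits_def ac_simps)
    also have "\<dots> = (\<Sum>x\<in>splits \<alpha>. f (fst x) * (\<Sum>y\<in>splits (snd x). g (fst y) * h (snd y)))"
      by (simp add: sum_distrib_left sum.Sigma)
    finally show "(\<Sum>(\<delta>, \<gamma>)\<in>splits \<alpha>. (\<Sum>(\<beta>, \<beta>')\<in>splits \<delta>. f \<beta> * g \<beta>') * h \<gamma>) =
       (\<Sum>(\<beta>, \<delta>)\<in>splits \<alpha>. f \<beta> * (\<Sum>(\<beta>', \<gamma>)\<in>splits \<delta>. g \<beta>' * h \<gamma>))"
      by (simp add: case_prod_unfold)
  qed
qed

end

lift_definition mps_const :: "'a::zero \<Rightarrow> ('n, 'a) mps" is "\<lambda>a \<alpha>. if \<alpha> = 0 then a else 0" .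

lift_definition mps_var :: "'n \<Rightarrow> ('n, 'a::zero_neq_one) mps"
  is "\<lambda>i \<alpha>. if \<alpha> = Poly_Mapping.single i 1 then 1 else 0" .

definition mps_in :: "'n set \<Rightarrow> ('n, 'a::zero) mps set" where
  "mps_in S = {b. \<forall>\<alpha>. mps_coeff b \<alpha> \<noteq> 0 \<longrightarrow> keys \<alpha> \<subseteq> S}"

definition vec_in :: "'a set \<Rightarrow> ('a ^ 'r) set" where
  "vec_in S = {v. \<forall>j. v $ j \<in> S}"

text \<open>Stability under the action of a subring \<open>S\<close>, here always \<open>mps_in C\<close>.\<close>

definition submodule_over :: "'a set \<Rightarrow> ('a \<Rightarrow> 'b \<Rightarrow> 'b) \<Rightarrow> 'b::ab_group_add set \<Rightarrow> bool" where
  "submodule_over S smul N \<longleftrightarrow>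
    0 \<in> N \<and> (\<forall>x\<in>N. \<forall>y\<in>N. x + y \<in> N) \<and> (\<forall>a\<in>S. \<forall>x\<in>N. smul a x \<in> N)"

definition max_ideal :: "'n set \<Rightarrow> ('n::finite, 'a::comm_ring_1) mps set" where
  "max_ideal C = submodule_over (mps_in C) (*) hull (mps_var ` C)"

definition max_ideal_power :: "'n set \<Rightarrow> nat \<Rightarrow> ('n::finite, 'a::comm_ring_1) mps set" where
  "max_ideal_power C m =
    submodule_over (mps_in C) (*) hull {\<Prod>j<m. a j | a. \<forall>j<m. a j \<in> max_ideal C}"

definition max_ideal_power_vec ::
  "'n set \<Rightarrow> nat \<Rightarrow> (('n::finite, 'a::comm_ring_1) mps ^ 'r) set" where
  "max_ideal_power_vec C m = submodule_over (mps_in C) (*s) hull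
    {a *s v | a v. a \<in> max_ideal_power C m \<and> v \<in> vec_in (mps_in C)}"

text \<open>The \<open>F\<close>-points of \<open>Quot\<^sup>m\<close>. The last two conditions say that the classes of
  \<open>b 0, \<dots>, b (m - 1)\<close> form an \<open>F\<close>-basis of the quotient by \<open>V\<close>.\<close>

definition quot_point :: "'n set \<Rightarrow> nat \<Rightarrow> (('n::finite, 'f::field) mps ^ 'r) set \<Rightarrow> bool" where
  "quot_point C m V \<longleftrightarrow>
    V \<subseteq> vec_in (mps_in C) \<and> submodule_over (mps_in C) (*s) V \<and>
    (\<exists>b :: nat \<Rightarrow> ('n, 'f) mps ^ 'r. (\<forall>j<m. b j \<in> vec_in (mps_in C)) \<and>
      (\<forall>w\<in>vec_in (mps_in C). \<exists>a. w - (\<Sum>j<m. mps_const (a j) *s b j) \<in> V) \<and>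
      (\<forall>a. (\<Sum>j<m. mps_const (a j) *s b j) \<in> V \<longrightarrow> (\<forall>j<m. a j = 0)))"


section \<open>Commutative algebra\<close>

definition prime_ideal :: "'a::comm_ring_1 set \<Rightarrow> bool" where
  "prime_ideal P \<longleftrightarrow>
    module.subspace (*) P \<and> P \<noteq> UNIV \<and> (\<forall>a b. a * b \<in> P \<longrightarrow> a \<in> P \<or> b \<in> P)"

definition chain_length :: "'b set set \<Rightarrow> enat" where
  "chain_length \<S> =
    Sup {enat k | k N. (\<forall>i\<le>k. N i \<in> \<S>) \<and> (\<forall>i<k. N i \<subset> N (Suc i))}"

definition codimension :: "'a::comm_ring_1 set \<Rightarrow> enat" where
  "codimension P = chain_length {Q. prime_ideal Q \<and> Q \<subseteq> P}"

definition independent_modulo :: "('n, 'k::comm_ring_1) mpol set \<Rightarrow> 'n set \<Rightarrow> bool" where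
  "independent_modulo P S \<longleftrightarrow> mpol_in S \<inter> P = {0}"

definition basis_modulo :: "('n, 'k::comm_ring_1) mpol set \<Rightarrow> 'n set \<Rightarrow> bool" where
  "basis_modulo P S \<longleftrightarrow>
    independent_modulo P S \<and> (\<forall>T. S \<subset> T \<longrightarrow> \<not> independent_modulo P T)"

text \<open>The fraction \<open>x / s\<close>, as an equivalence class, in the localization at \<open>P\<close> of the module
  with scalar multiplication \<open>smul\<close>. For \<open>smul = (*)\<close> this is an element of the local ring.\<close>

definition loc_frac :: "'a::comm_ring_1 set \<Rightarrow> ('a \<Rightarrow> 'm::ab_group_add \<Rightarrow> 'm) \<Rightarrow> 'm \<Rightarrow> 'a \<Rightarrow> ('m \<times> 'a) set"
  where "loc_frac P smul x s =
    {(y, t). t \<notin> P \<and> (\<exists>u. u \<notin> P \<and> smul u (smul t x - smul s y) = 0)}"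

definition localization ::
  "'a::comm_ring_1 set \<Rightarrow> ('a \<Rightarrow> 'm::ab_group_add \<Rightarrow> 'm) \<Rightarrow> 'm set \<Rightarrow> ('m \<times> 'a) set set" where
  "localization P smul U = {loc_frac P smul x s | x s. x \<in> U \<and> s \<notin> P}"

definition local_submodule ::
  "'a::comm_ring_1 set \<Rightarrow> ('a \<Rightarrow> 'm::ab_group_add \<Rightarrow> 'm) \<Rightarrow> ('m \<times> 'a) set set \<Rightarrow> bool" where
  "local_submodule P smul N \<longleftrightarrow>
    N \<subseteq> localization P smul UNIV \<and> loc_frac P smul 0 1 \<in> N \<and>
    (\<forall>x y s t. s \<notin> P \<and> t \<notin> P \<and> loc_frac P smul x s \<in> N \<and> loc_frac P smul y t \<in> N \<longrightarrow>
      loc_frac P smul (smul t x + smul s y) (s * t) \<in> N) \<and>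
    (\<forall>a x s t. s \<notin> P \<and> t \<notin> P \<and> loc_frac P smul x t \<in> N \<longrightarrow> loc_frac P smul (smul a x) (s * t) \<in> N)"

text \<open>The length of \<open>M\<^sub>P / U\<^sub>P\<close>; submodules of this quotient are taken as submodules of \<open>M\<^sub>P\<close>
  containing \<open>U\<^sub>P\<close>.\<close>

definition multiplicity_over ::
  "'a::comm_ring_1 set \<Rightarrow> ('a \<Rightarrow> 'm::ab_group_add \<Rightarrow> 'm) \<Rightarrow> 'm set \<Rightarrow> enat" where
  "multiplicity_over P smul U =
    chain_length {N. local_submodule P smul N \<and> localization P smul U \<subseteq> N}"

text \<open>Associated primes of \<open>M / U\<close>: the annihilator of the class of \<open>x\<close> is \<open>{a. a x \<in> U}\<close>.\<close>

definition ass_quotient :: "('a::comm_ring_1 \<Rightarrow> 'm::ab_group_add \<Rightarrow> 'm) \<Rightarrow> 'm set \<Rightarrow> 'a set set" where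
  "ass_quotient smul U = {Q. prime_ideal Q \<and> (\<exists>x. Q = {a. smul a x \<in> U})}"

definition primary_submodule ::
  "'a::comm_ring_1 set \<Rightarrow> ('a \<Rightarrow> 'm::ab_group_add \<Rightarrow> 'm) \<Rightarrow> 'm set \<Rightarrow> bool" where
  "primary_submodule P smul U \<longleftrightarrow> module.subspace smul U \<and> ass_quotient smul U = {P}"

text \<open>Since the residue field depends on the ideal, it cannot be a type constructed from \<open>P\<close>.
  Instead an arbitrary field is identified with \<open>R\<^sub>P / P R\<^sub>P\<close> by a surjective ring homomorphism
  \<open>\<psi>\<close> on \<open>R\<^sub>P\<close> whose kernel is \<open>P R\<^sub>P\<close>.\<close>

definition is_residue_field :: "'a::comm_ring_1 set \<Rightarrow> (('a \<times> 'a) set \<Rightarrow> 'f::field) \<Rightarrow> bool" where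
  "is_residue_field P \<psi> \<longleftrightarrow>
    \<psi> (loc_frac P (*) 1 1) = 1 \<and>
    (\<forall>a b s t. s \<notin> P \<and> t \<notin> P \<longrightarrow>
      \<psi> (loc_frac P (*) (t * a + s * b) (s * t)) = \<psi> (loc_frac P (*) a s) + \<psi> (loc_frac P (*) b t) \<and>
      \<psi> (loc_frac P (*) (a * b) (s * t)) = \<psi> (loc_frac P (*) a s) * \<psi> (loc_frac P (*) b t)) \<and>
    \<psi> ` localization P (*) UNIV = UNIV \<and>
    {z \<in> localization P (*) UNIV. \<psi> z = 0} = localization P (*) P"

definition residue_class :: "'a::comm_ring_1 set \<Rightarrow> (('a \<times> 'a) set \<Rightarrow> 'f) \<Rightarrow> 'a \<Rightarrow> 'f" where
  "residue_class P \<psi> f = \<psi> (loc_frac P (*) f 1)"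


section \<open>The embedding into power series\<close>

text \<open>Below, \<open>\<rho>\<close> stands for the map \<open>R \<rightarrow> F\<close> taking residue classes.\<close>

definition eta :: "'n set \<Rightarrow> (('n, 'k) mpol \<Rightarrow> 'f) \<Rightarrow>
    ('n::finite, 'k::field) mpol \<Rightarrow> ('n, 'f::field) mps" where
  "eta C \<rho> f = (\<Sum>\<alpha>\<in>keys f. mps_const (\<rho> (mpol_const (lookup f \<alpha>))) *
     (\<Prod>i\<in>UNIV. ((if i \<in> C then mps_var i else 0) + mps_const (\<rho> (mpol_var i))) ^ lookup \<alpha> i))"

definition gamma :: "'n set \<Rightarrow> (('n, 'k) mpol \<Rightarrow> 'f) \<Rightarrow>
    ('n::finite, 'k::field) mpol ^ 'r \<Rightarrow> ('n, 'f::field) mps ^ 'r" where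
  "gamma C \<rho> v = (\<chi> j. eta C \<rho> (v $ j))"

definition extend_mod_power :: "'n set \<Rightarrow> (('n, 'k) mpol \<Rightarrow> 'f) \<Rightarrow> nat \<Rightarrow>
    (('n::finite, 'k::field) mpol ^ 'r) set \<Rightarrow> (('n, 'f::field) mps ^ 'r) set" where
  "extend_mod_power C \<rho> m L = {u + v | u v.
     u \<in> submodule_over (mps_in C) (*s) hull (gamma C \<rho> ` L) \<and> v \<in> max_ideal_power_vec C m}"


section \<open>Inverse systems\<close>

definition mps_act ::
  "('n::finite, 'f::comm_ring_1) mps \<Rightarrow> ('n, 'f) mpol \<Rightarrow> ('n, 'f) mpol" where
  "mps_act b e = (\<Sum>\<alpha> | mderiv \<alpha> e \<noteq> 0. mpol_const (mps_coeff b \<alpha>) * mderiv \<alpha> e)"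

definition perp :: "'n set \<Rightarrow> (('n::finite, 'f::field) mps ^ 'r) set \<Rightarrow> (('n, 'f) mpol ^ 'r) set"
  where "perp C V =
    {w \<in> vec_in (mpol_in C). \<forall>v\<in>V. (\<Sum>j\<in>UNIV. mps_act (v $ j) (w $ j)) = 0}"

definition closed_under_diff :: "'n set \<Rightarrow> (('n::finite, 'f::field) mpol ^ 'r) set \<Rightarrow> bool" where
  "closed_under_diff C W \<longleftrightarrow>
    (\<forall>i\<in>C. \<forall>w\<in>W. (\<chi> j. mderiv (Poly_Mapping.single i 1) (w $ j)) \<in> W)"

definition mpol_vec_scale :: "'f::field \<Rightarrow> ('n, 'f) mpol ^ 'r \<Rightarrow> ('n, 'f) mpol ^ 'r" where
  "mpol_vec_scale a w = mpol_const a *s w"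

lemma mpol_const_add: "mpol_const (a + b) = mpol_const a + mpol_const b"
  and mpol_const_mult: "mpol_const (c * d) = mpol_const c * mpol_const d"
  and mpol_const_1: "mpol_const 1 = 1"
  by (simp_all add: mpol_const_def single_add mult_single)

lemma vector_space_mpol_vec_scale:
  "vector_space (mpol_vec_scale :: 'f::field \<Rightarrow> ('n, 'f) mpol ^ 'r \<Rightarrow> _)"
  by unfold_locales (auto simp: mpol_vec_scale_def vec_eq_iff mpol_const_add mpol_const_mult
      mpol_const_1 algebra_simps)


section \<open>The Weyl algebra and the Weyl-Noether module\<close>

text \<open>A differential operator \<open>\<Sum>\<^sub>\<alpha> f\<^sub>\<alpha> \<partial>\<^sup>\<alpha>\<close> in normal form is stored as its coefficient family
  \<open>\<alpha> \<mapsto> f\<^sub>\<alpha>\<close>. The product \<open>(*)\<close> of the underlying type, in which \<open>\<partial>\<^sup>\<alpha>\<close> is central, is not the product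
  of operators; that one is \<open>weyl_mult\<close>, given by the Leibniz rule (see \<open>weyl_act_mult\<close>).\<close>

type_synonym ('n, 'k) weyl = "'n multiindex \<Rightarrow>\<^sub>0 ('n, 'k) mpol"

definition weyl_act :: "('n::finite, 'k::comm_ring_1) weyl \<Rightarrow> ('n, 'k) mpol \<Rightarrow> ('n, 'k) mpol" where
  "weyl_act d f = (\<Sum>\<alpha>\<in>keys d. lookup d \<alpha> * mderiv \<alpha> f)"

definition weyl_mult ::
  "('n::finite, 'k::comm_ring_1) weyl \<Rightarrow> ('n, 'k) weyl \<Rightarrow> ('n, 'k) weyl" where
  "weyl_mult d e = (\<Sum>\<alpha>\<in>keys d. \<Sum>\<beta>\<in>keys e. \<Sum>(\<gamma>, \<delta>)\<in>splits \<alpha>.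
     Poly_Mapping.single (\<delta> + \<beta>)
       (of_nat (mbinom \<alpha> \<gamma>) * lookup d \<alpha> * mderiv \<gamma> (lookup e \<beta>)))"

lemma weyl_act_superset:
  assumes "finite A" "keys d \<subseteq> A"
  shows "weyl_act d f = (\<Sum>\<alpha>\<in>A. lookup d \<alpha> * mderiv \<alpha> f)"
  unfolding weyl_act_def
  by (rule sum.mono_neutral_left) (use assms in \<open>auto simp: in_keys_iff\<close>)

lemma weyl_act_add: "weyl_act (d + e) f = weyl_act d f + weyl_act e f"
  using Poly_Mapping.keys_add[of d e]
  by (simp add: weyl_act_superset[of "keys d \<union> keys e"] lookup_add distrib_right sum.distrib)

lemma weyl_act_sum: "weyl_act (sum d A) f = (\<Sum>x\<in>A. weyl_act (d x) f)"
proof (induction A rule: infinite_finite_induct)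
  case (insert x A)
  then show ?case by (simp add: weyl_act_add)
qed (simp_all add: weyl_act_def)

lemma weyl_act_single: "weyl_act (Poly_Mapping.single \<alpha> g) f = g * mderiv \<alpha> f"
  by (subst weyl_act_superset[of "{\<alpha>}"]) auto

lemma weyl_act_mult: "weyl_act (weyl_mult d e) f = weyl_act d (weyl_act e f)"
proof -
  have "weyl_act d (weyl_act e f) = (\<Sum>\<alpha>\<in>keys d. \<Sum>\<beta>\<in>keys e.
     lookup d \<alpha> * (\<Sum>(\<gamma>, \<delta>)\<in>splits \<alpha>. of_nat (mbinom \<alpha> \<gamma>) *
       (mderiv \<gamma> (lookup e \<beta>) * mderiv (\<delta> + \<beta>) f)))"
    unfolding weyl_act_def mderiv_sum sum_distrib_left mderiv_mult mderiv_mderiv ..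
  also have "\<dots> = weyl_act (weyl_mult d e) f"
    unfolding weyl_mult_def case_prod_unfold weyl_act_sum weyl_act_single sum_distrib_left
    by (simp only: mult.assoc mult.left_commute)
  finally show ?thesis ..
qed

definition rel_weyl :: "'n set \<Rightarrow> ('n, 'k::comm_ring_1) weyl set" where
  "rel_weyl C = {d. \<forall>\<alpha>\<in>keys d. keys \<alpha> \<subseteq> C}"

definition weyl_vec_act ::
  "('n::finite, 'k::comm_ring_1) weyl ^ 'r \<Rightarrow> ('n, 'k) mpol ^ 'r \<Rightarrow> ('n, 'k) mpol" where
  "weyl_vec_act d w = (\<Sum>j\<in>UNIV. weyl_act (d $ j) (w $ j))"

text \<open>The elements \<open>\<Sum>\<^sub>\<alpha> \<epsilon>\<^sub>\<alpha> \<otimes> \<partial>\<^sup>\<alpha>\<close> of \<open>F \<otimes>\<^sub>R (D\<^sub>n\<^sub>,\<^sub>c)\<^sup>r\<close>, stored as coefficient families with values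
  \<open>\<epsilon>\<^sub>\<alpha>\<close> in \<open>F\<^sup>r\<close>.\<close>

type_synonym ('n, 'f, 'r) weyl_noether = "'n multiindex \<Rightarrow>\<^sub>0 ('f ^ 'r)"

definition weyl_noether :: "'n set \<Rightarrow> ('n, 'f::field, 'r::finite) weyl_noether set" where
  "weyl_noether C = {\<epsilon>. \<forall>\<alpha>\<in>keys \<epsilon>. keys \<alpha> \<subseteq> C}"

definition wn_scale ::
  "'f::field \<Rightarrow> ('n, 'f, 'r::finite) weyl_noether \<Rightarrow> ('n, 'f, 'r) weyl_noether" where
  "wn_scale a \<epsilon> = Poly_Mapping.map ((*s) a) \<epsilon>"

lemma lookup_wn_scale: "lookup (wn_scale a \<epsilon>) \<alpha> = a *s lookup \<epsilon> \<alpha>"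
  by (auto simp: wn_scale_def map.rep_eq when_def)

lemma vector_space_wn_scale:
  "vector_space (wn_scale :: 'f::field \<Rightarrow> ('n, 'f, 'r::finite) weyl_noether \<Rightarrow> _)"
  by unfold_locales (auto intro!: poly_mapping_eqI
      simp: lookup_wn_scale lookup_add vec_eq_iff algebra_simps)

text \<open>The right action of \<open>f\<close>: expand \<open>\<partial>\<^sup>\<alpha> \<cdot> f = \<Sum>\<^sub>\<beta> g\<^sub>\<beta> \<partial>\<^sup>\<beta>\<close> in the Weyl algebra, and move the
  coefficients \<open>g\<^sub>\<beta>\<close> across the tensor sign.\<close>

definition wn_right_mult :: "(('n, 'k::field) mpol \<Rightarrow> 'f) \<Rightarrow> ('n, 'f, 'r) weyl_noether \<Rightarrow>
    ('n, 'k) mpol \<Rightarrow> ('n::finite, 'f::field, 'r::finite) weyl_noether" where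
  "wn_right_mult \<rho> \<epsilon> f = (\<Sum>\<alpha>\<in>keys \<epsilon>.
     let g = weyl_mult (Poly_Mapping.single \<alpha> (1 :: ('n, 'k) mpol)) (Poly_Mapping.single 0 f)
     in \<Sum>\<beta>\<in>keys g. Poly_Mapping.single \<beta> (\<rho> (lookup g \<beta>) *s lookup \<epsilon> \<alpha>))"

definition wn_bimodule :: "(('n, 'k::field) mpol \<Rightarrow> 'f) \<Rightarrow>
    ('n::finite, 'f::field, 'r::finite) weyl_noether set \<Rightarrow> bool" where
  "wn_bimodule \<rho> \<E> \<longleftrightarrow> (\<forall>f :: ('n, 'k) mpol. \<forall>\<epsilon>\<in>\<E>.
     wn_scale (\<rho> f) \<epsilon> \<in> \<E> \<and> wn_right_mult \<rho> \<epsilon> f \<in> \<E>)"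

text \<open>\<open>\<Omega>\<close> sends \<open>a z\<^sup>\<alpha>\<close> in position \<open>j\<close> to \<open>a \<partial>\<^sup>\<alpha>\<close> in position \<open>j\<close>.\<close>

definition Omega :: "('n, 'f::field) mpol ^ 'r \<Rightarrow> ('n, 'f, 'r::finite) weyl_noether" where
  "Omega w = (\<Sum>j\<in>UNIV. \<Sum>\<alpha>\<in>keys (w $ j). Poly_Mapping.single \<alpha> (axis j (lookup (w $ j) \<alpha>)))"

definition is_basis_of :: "('f::field \<Rightarrow> 'v::ab_group_add \<Rightarrow> 'v) \<Rightarrow> nat \<Rightarrow> (nat \<Rightarrow> 'v) \<Rightarrow> 'v set \<Rightarrow> bool"
  where "is_basis_of smul m \<epsilon> V \<longleftrightarrow>
    inj_on \<epsilon> {1..m} \<and> \<not> module.dependent smul (\<epsilon> ` {1..m}) \<and> module.span smul (\<epsilon> ` {1..m}) = V"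

text \<open>Multiply \<open>\<epsilon>\<close> by the class of some \<open>h \<notin> P\<close> and choose representatives of the
  resulting coefficients.\<close>

definition is_lift :: "('n, 'k) mpol set \<Rightarrow> 'n set \<Rightarrow> (('n, 'k) mpol \<Rightarrow> 'f) \<Rightarrow>
    ('n, 'f::field, 'r::finite) weyl_noether \<Rightarrow> ('n::finite, 'k::field) weyl ^ 'r \<Rightarrow> bool" where
  "is_lift P C \<rho> \<epsilon> d \<longleftrightarrow> d \<in> vec_in (rel_weyl C) \<and>
    (\<exists>h. h \<notin> P \<and> (\<forall>\<alpha> j. \<rho> (lookup (d $ j) \<alpha>) = \<rho> h * lookup \<epsilon> \<alpha> $ j))"

end

theory Submission
  imports Defs
begin

text \<open>
  Localizing at \<open>P\<close> turns a \<open>P\<close>-primary submodule \<open>U\<close> of multiplicity \<open>m\<close> into a submodule of \<open>R\<^sub>P\<^sup>r\<close> whose quotient has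
  length \<open>m\<close>; on the other side, a point of the Quot scheme is a submodule of \<open>B\<^sup>r\<close> whose quotient has dimension \<open>m\<close> over
  \<open>F\<close>. The two are matched by the isomorphism \<open>R\<^sub>P / P\<^sup>m R\<^sub>P \<cong> B / n\<^sup>m\<close> induced by \<open>\<eta>\<close>, where \<open>n\<close> is the maximal ideal of
  \<open>B\<close>, and the second is translated into polynomials by Macaulay duality.

  The map \<open>\<eta>\<close> is the Taylor expansion at the generic point of \<open>P\<close>: its coefficient at \<open>y\<^sup>\<alpha>\<close> is the class of
  \<open>\<partial>\<^sup>\<alpha> f / \<alpha>!\<close>. Since \<open>F\<close> is algebraic over the field of the parameters \<open>x\<^sub>j\<close>, \<open>j \<notin> C\<close>, and the characteristic is zero,
  each \<open>x\<^sub>i\<close> with \<open>i \<in> C\<close> satisfies a separable equation; the image of this element of \<open>P\<close> is \<open>y\<^sub>i\<close> times a unit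
  (\<open>uniformizer\<close>). Consequently \<open>\<eta>(P)\<close> generates the maximal ideal, and successive approximation shows that fractions over
  \<open>R\<close> are dense in \<open>B\<close> (\<open>eta_approx\<close>). For the injectivity (\<open>eta_ord_ge_imp_ideal_power\<close>), an element \<open>\<eta>(g)\<close> of order \<open>m\<close> is
  written, up to a factor with nonzero constant term, as a combination of elements of \<open>\<eta>(P\<^sup>m)\<close> with coefficients in the
  \<open>F\<close>-span of \<open>\<eta>(R)\<close>; the scalars from \<open>F\<close> are then removed by \<open>descent\<close>.

  Submodules of \<open>R\<^sub>P\<^sup>r\<close> are represented by saturated submodules of \<open>R\<^sup>r\<close>. The isomorphism makes extension and contraction
  inverse to each other between saturated submodules containing \<open>P\<^sup>m R\<^sup>r\<close> and submodules of \<open>B\<^sup>r\<close> containing \<open>n\<^sup>m B\<^sup>r\<close>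
  (\<open>extend_contraction\<close>, \<open>contraction_extend\<close>), so lengths of chains agree on both sides. A composition series shows that
  \<open>P\<^sup>m\<close> kills a quotient of length \<open>m\<close>, and likewise for \<open>n\<^sup>m\<close>, and that on the power series side length is dimension
  (\<open>finite_length_power\<close>, \<open>quot_point_chain_length\<close>). That primary submodules are saturated depends on the existence of
  associated primes, hence on Hilbert's basis theorem (\<open>noetherian\<close>, \<open>primary_imp_saturated\<close>).

  For the duality, the constant term of \<open>v \<cdot> w\<close> pairs \<open>B\<^sup>r\<close> with \<open>E\<^sup>r\<close>, and a basis of \<open>B\<^sup>r / V\<close> has a dual basis in \<open>E\<^sup>r\<close>
  that spans the inverse system of \<open>V\<close>; conversely every inverse system arises in this way (\<open>dual_basesD\<close>). Under \<open>\<Omega>\<close>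
  the right action of \<open>f \<in> R\<close> becomes the action of \<open>\<eta>(f)\<close> (\<open>right_mult_Omega\<close>), which identifies bimodules with subspaces
  closed under differentiation. Finally, a lift of an element of the bimodule sends \<open>w\<close> into \<open>P\<close> iff \<open>\<gamma>(w)\<close> pairs to zero
  with the corresponding polynomial vector, so a basis tests exactly whether \<open>\<gamma>(w) \<in> V\<close>, that is, whether \<open>w\<close> lies in
  the lift of \<open>U\<close>.\<close>

section \<open>Multi-indices and iterated derivatives\<close>

definition mdeg :: "'n::finite multiindex \<Rightarrow> nat" where
  "mdeg \<alpha> = (\<Sum>i\<in>UNIV. lookup \<alpha> i)"

definition mfact :: "'n::finite multiindex \<Rightarrow> nat" where
  "mfact \<alpha> = (\<Prod>i\<in>UNIV. fact (lookup \<alpha> i))"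

lemma mdeg_add [simp]: "mdeg (\<alpha> + \<beta>) = mdeg \<alpha> + mdeg \<beta>"
  by (simp add: mdeg_def lookup_add sum.distrib)

lemma mdeg_zero [simp]: "mdeg 0 = 0"
  by (simp add: mdeg_def)

lemma mdeg_single [simp]: "mdeg (Poly_Mapping.single i k) = k"
proof -
  have "mdeg (Poly_Mapping.single i k) = (\<Sum>j\<in>UNIV. if j = i then k else 0)"
    unfolding mdeg_def by (rule sum.cong) (auto simp: lookup_single when_def)
  then show ?thesis by simp
qed

lemma mdeg_eq_0_iff [simp]: "mdeg \<alpha> = 0 \<longleftrightarrow> \<alpha> = 0"
  by (auto simp: mdeg_def intro!: poly_mapping_eqI)

lemma lookup_le_mdeg: "lookup \<alpha> i \<le> mdeg \<alpha>"
  unfolding mdeg_def by (rule member_le_sum) auto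

lemma mfact_pos: "mfact \<alpha> > 0"
  by (simp add: mfact_def prod_pos)

lemma mfact_zero [simp]: "mfact 0 = 1"
  by (simp add: mfact_def)

lemma finite_mdeg_less: "finite {\<alpha> :: 'n::finite multiindex. mdeg \<alpha> < m}"
proof (rule finite_subset)
  let ?f = "\<lambda>h :: 'n \<Rightarrow> nat. Abs_poly_mapping h"
  show "{\<alpha> :: 'n multiindex. mdeg \<alpha> < m} \<subseteq> ?f ` (PiE UNIV (\<lambda>_. {..m}))"
  proof
    fix \<alpha> :: "'n multiindex" assume "\<alpha> \<in> {\<alpha>. mdeg \<alpha> < m}"
    then have "lookup \<alpha> i \<le> m" for i
      using lookup_le_mdeg[of \<alpha> i] by simp
    then have "lookup \<alpha> \<in> PiE UNIV (\<lambda>_. {..m})" by auto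
    then show "\<alpha> \<in> ?f ` (PiE UNIV (\<lambda>_. {..m}))"
      by (metis image_eqI lookup_inverse)
  qed
  show "finite (?f ` (PiE UNIV (\<lambda>_. {..m})))"
    by (intro finite_imageI finite_PiE) auto
qed

lemma keys_plus_nat: "keys (\<alpha> + \<beta> :: 'n multiindex) = keys \<alpha> \<union> keys \<beta>"
  by (auto simp: in_keys_iff lookup_add)

lemma multiindex_nonzeroE:
  assumes "\<alpha> \<noteq> (0 :: 'n multiindex)"
  obtains i \<beta> where "i \<in> keys \<alpha>" "\<alpha> = Poly_Mapping.single i 1 + \<beta>"
proof -
  obtain i where i: "i \<in> keys \<alpha>" using assms by (metis all_not_in_conv keys_eq_empty)
  have "\<alpha> = Poly_Mapping.single i 1 + (\<alpha> - Poly_Mapping.single i 1)"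
    by (rule poly_mapping_eqI)
      (use i in \<open>auto simp: lookup_add lookup_minus lookup_single when_def in_keys_iff\<close>)
  then show ?thesis using i that by blast
qed

lemma mff_add_mfact: "mff (\<alpha> + \<beta>) \<alpha> * mfact \<beta> = mfact (\<alpha> + \<beta>)"
proof -
  have "mff (\<alpha> + \<beta>) \<alpha> * mfact \<beta> = (\<Prod>i\<in>UNIV. ((lookup \<alpha> i + lookup \<beta> i) choose lookup \<alpha> i) *
      fact (lookup \<alpha> i) * fact (lookup \<beta> i))"
    by (simp add: mff_def mfact_def prod.distrib lookup_add)
  also have "\<dots> = (\<Prod>i\<in>UNIV. fact (lookup \<alpha> i + lookup \<beta> i))"
  proof (rule prod.cong)
    fix i
    have "fact (lookup \<alpha> i) * fact (lookup \<alpha> i + lookup \<beta> i - lookup \<alpha> i) *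
        ((lookup \<alpha> i + lookup \<beta> i) choose lookup \<alpha> i) = (fact (lookup \<alpha> i + lookup \<beta> i) :: nat)"
      by (rule binomial_fact_lemma) simp
    then show "((lookup \<alpha> i + lookup \<beta> i) choose lookup \<alpha> i) *
      fact (lookup \<alpha> i) * fact (lookup \<beta> i) = (fact (lookup \<alpha> i + lookup \<beta> i) :: nat)"
      by (simp add: ac_simps)
  qed simp
  finally show ?thesis by (simp add: mfact_def lookup_add)
qed

lemma mbinom_mfact: "mbinom (\<beta> + \<gamma>) \<beta> * (mfact \<beta> * mfact \<gamma>) = mfact (\<beta> + \<gamma>)"
proof -
  have "mbinom (\<beta> + \<gamma>) \<beta> * mfact \<beta> = mff (\<beta> + \<gamma>) \<beta>"
    by (simp add: mbinom_def mfact_def mff_def prod.distrib)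
  then show ?thesis using mff_add_mfact[of \<beta> \<gamma>] by (simp add: mult.assoc[symmetric])
qed

lemma lookup_mderiv:
  "lookup (mderiv \<alpha> f) \<beta> = of_nat (mff (\<alpha> + \<beta>) \<alpha>) * lookup f (\<alpha> + \<beta>)"
proof -
  have "lookup (mderiv \<alpha> f) \<beta> =
    (\<Sum>\<gamma>\<in>keys f. if \<gamma> - \<alpha> = \<beta> then of_nat (mff \<gamma> \<alpha>) * lookup f \<gamma> else 0)"
    by (simp add: mderiv_def lookup_sum lookup_single when_def)
  also have "\<dots> = (\<Sum>\<gamma>\<in>keys f. if \<gamma> = \<alpha> + \<beta> then of_nat (mff \<gamma> \<alpha>) * lookup f \<gamma> else 0)"
  proof (rule sum.cong, simp)
    fix \<gamma>
    have "mff \<gamma> \<alpha> \<noteq> 0 \<Longrightarrow> (\<gamma> - \<alpha> = \<beta>) = (\<gamma> = \<alpha> + \<beta>)"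
    proof
      assume "mff \<gamma> \<alpha> \<noteq> 0" "\<gamma> - \<alpha> = \<beta>"
      then show "\<gamma> = \<alpha> + \<beta>"
        by (intro poly_mapping_eqI) (auto simp: lookup_add lookup_minus mff_le)
    qed simp
    then show "(if \<gamma> - \<alpha> = \<beta> then of_nat (mff \<gamma> \<alpha>) * lookup f \<gamma> else 0) =
      (if \<gamma> = \<alpha> + \<beta> then of_nat (mff \<gamma> \<alpha>) * lookup f \<gamma> else 0)"
      by (cases "mff \<gamma> \<alpha> = 0") auto
  qed
  also have "\<dots> = of_nat (mff (\<alpha> + \<beta>) \<alpha>) * lookup f (\<alpha> + \<beta>)"
    by (simp add: in_keys_iff)
  finally show ?thesis .
qed

lemma mpol_in_mderiv: "f \<in> mpol_in S \<Longrightarrow> mderiv \<alpha> f \<in> mpol_in S"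
  unfolding mpol_in_def
proof clarify
  fix \<beta> i assume f: "\<forall>\<alpha>\<in>keys f. keys \<alpha> \<subseteq> S" and b: "\<beta> \<in> keys (mderiv \<alpha> f)" "i \<in> keys \<beta>"
  then have "\<alpha> + \<beta> \<in> keys f" by (auto simp: in_keys_iff lookup_mderiv)
  then have "keys (\<alpha> + \<beta>) \<subseteq> S" using f by blast
  then show "i \<in> S" using b by (auto simp: keys_plus_nat)
qed

lemma mderiv_const [simp]:
  "mderiv \<alpha> (mpol_const a :: ('n::finite, 'a::comm_semiring_1) mpol) = (if \<alpha> = 0 then mpol_const a else 0)"
  by (rule poly_mapping_eqI)
    (auto simp: lookup_mderiv mpol_const_def lookup_single when_def mff_def
      dest: arg_cong[of _ _ mdeg])

lemma single_eq_const_times_vars: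
  "Poly_Mapping.single \<alpha> (a :: 'a::comm_ring_1) =
    mpol_const a * (\<Prod>i\<in>UNIV. mpol_var i ^ lookup \<alpha> (i :: 'n::finite))"
proof -
  have pw: "mpol_var i ^ k = (Poly_Mapping.single (Poly_Mapping.single i k) 1 :: ('n, 'a) mpol)"
    for i :: 'n and k
    by (induction k) (simp_all add: mpol_var_def mult_single single_add[symmetric])
  have "(\<Prod>i\<in>A. mpol_var i ^ lookup \<alpha> i) =
      (Poly_Mapping.single (\<Sum>i\<in>A. Poly_Mapping.single i (lookup \<alpha> i)) 1 :: ('n, 'a) mpol)" for A
    by (induction A rule: infinite_finite_induct) (simp_all add: pw mult_single)
  moreover have "(\<Sum>i\<in>UNIV. Poly_Mapping.single i (lookup \<alpha> i)) = \<alpha>"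
    by (rule poly_mapping_eqI) (simp add: lookup_sum lookup_single when_def)
  ultimately show ?thesis by (simp add: mpol_const_def mult_single)
qed

text \<open>The rule by which identities between ring homomorphisms on polynomials, and the shape of their values, are
  established below; \<open>S\<close> restricts the variables that have to be treated.\<close>

lemma mpol_in_induct [consumes 1, case_names const var add mult]:
  fixes f :: "('n::finite, 'a::comm_ring_1) mpol"
  assumes "f \<in> mpol_in S"
    and c: "\<And>a. Q (mpol_const a)"
    and v: "\<And>i. i \<in> S \<Longrightarrow> Q (mpol_var i)"
    and p: "\<And>f g. Q f \<Longrightarrow> Q g \<Longrightarrow> Q (f + g)"
    and t: "\<And>f g. Q f \<Longrightarrow> Q g \<Longrightarrow> Q (f * g)"
  shows "Q f"
proof -
  have Q0: "Q 0" using c[of 0] by (simp add: mpol_const_def)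
  have Q1: "Q 1" using c[of 1] by (simp add: mpol_const_1)
  have pw: "Q g \<Longrightarrow> Q (g ^ k)" for g k
    by (induction k) (auto simp: Q1 t)
  have pr: "Q (\<Prod>i\<in>A. h i)" if "\<And>i. i \<in> A \<Longrightarrow> Q (h i)" for A and h :: "'n \<Rightarrow> _"
    using that by (induction A rule: infinite_finite_induct) (auto simp: Q1 t)
  have sm: "Q (\<Sum>i\<in>A. h i)" if "\<And>i. i \<in> A \<Longrightarrow> Q (h i)" for A and h :: "'n multiindex \<Rightarrow> _"
    using that by (induction A rule: infinite_finite_induct) (auto simp: Q0 p)
  have "Q (\<Sum>\<beta>\<in>keys f. Poly_Mapping.single \<beta> (lookup f \<beta>))"
  proof (rule sm)
    fix \<beta> assume b: "\<beta> \<in> keys f"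
    have "Q (mpol_var i ^ lookup \<beta> i)" for i
    proof (cases "lookup \<beta> i = 0")
      case False
      then have "i \<in> keys \<beta>" by (simp add: in_keys_iff)
      then have "i \<in> S" using b assms(1) unfolding mpol_in_def by blast
      then show ?thesis by (intro pw v)
    qed (simp add: Q1)
    then show "Q (Poly_Mapping.single \<beta> (lookup f \<beta>))"
      unfolding single_eq_const_times_vars by (intro t c pr)
  qed
  then show ?thesis by (simp flip: mpol_sum_monomials)
qed

lemma mpol_in_UNIV [simp]: "mpol_in UNIV = UNIV"
  by (auto simp: mpol_in_def)

section \<open>Power series\<close>

lemma mps_coeff_zero [simp]: "mps_coeff 0 \<alpha> = 0"
  and mps_coeff_one: "mps_coeff 1 \<alpha> = (if \<alpha> = 0 then 1 else 0)"
  and mps_coeff_add [simp]: "mps_coeff (f + g) \<alpha> = mps_coeff f \<alpha> + mps_coeff g \<alpha>"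
  and mps_coeff_diff [simp]: "mps_coeff (f - g) \<alpha> = mps_coeff f \<alpha> - mps_coeff g \<alpha>"
  and mps_coeff_uminus [simp]: "mps_coeff (- f) \<alpha> = - mps_coeff f \<alpha>"
  and mps_coeff_mult: "mps_coeff (f * g) \<alpha> = (\<Sum>(\<beta>, \<gamma>)\<in>splits \<alpha>. mps_coeff f \<beta> * mps_coeff g \<gamma>)"
  by (simp_all add: zero_mps.rep_eq one_mps.rep_eq plus_mps.rep_eq minus_mps.rep_eq
      uminus_mps.rep_eq times_mps.rep_eq)

lemma mps_coeff_const: "mps_coeff (mps_const a) \<alpha> = (if \<alpha> = 0 then a else 0)"
  and mps_coeff_var: "mps_coeff (mps_var i) \<alpha> =
    (if \<alpha> = Poly_Mapping.single i 1 then 1 else 0)"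
  and mps_coeff_Abs [simp]: "mps_coeff (Abs_mps h) \<alpha> = h \<alpha>"
  by (simp_all add: mps_const.rep_eq mps_var.rep_eq Abs_mps_inverse)

lemma mps_coeff_sum [simp]: "mps_coeff (sum f A) \<alpha> = (\<Sum>x\<in>A. mps_coeff (f x) \<alpha>)"
  by (induction A rule: infinite_finite_induct) auto

lemma splits_zero [simp]: "splits (0 :: 'n multiindex) = {(0, 0)}"
proof -
  have "\<beta> + \<gamma> = (0 :: 'n multiindex) \<longleftrightarrow> \<beta> = 0 \<and> \<gamma> = 0" for \<beta> \<gamma>
    by (metis Un_empty keys_eq_empty keys_plus_nat)
  then show ?thesis unfolding splits_def by blast
qed

lemma mps_coeff_mult_0 [simp]: "mps_coeff (f * g) 0 = mps_coeff f 0 * mps_coeff g 0"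
  by (simp add: mps_coeff_mult)

lemma mps_coeff_one_0 [simp]: "mps_coeff 1 0 = 1"
  by (simp add: mps_coeff_one)

lemma mps_coeff_prod_0 [simp]: "mps_coeff (prod f A) 0 = (\<Prod>x\<in>A. mps_coeff (f x) 0)"
  by (induction A rule: infinite_finite_induct) auto

lemma mps_coeff_power_0 [simp]: "mps_coeff (f ^ k) 0 = mps_coeff f 0 ^ k"
  by (induction k) auto

lemma mps_coeff_const_0 [simp]: "mps_coeff (mps_const a) 0 = a"
  by (simp add: mps_coeff_const)

lemma mps_coeff_var_0 [simp]: "mps_coeff (mps_var (i :: 'n::finite)) 0 = 0"
  using mdeg_single[of i 1] by (auto simp: mps_coeff_var simp del: mdeg_single)

lemma mps_coeff_const_mult [simp]:
  fixes f :: "('n::finite, 'a::comm_ring_1) mps"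
  shows "mps_coeff (mps_const a * f) \<alpha> = a * mps_coeff f \<alpha>"
proof -
  have "mps_coeff (mps_const a * f) \<alpha> = (\<Sum>(\<beta>, \<gamma>)\<in>{(0 :: 'n multiindex, \<alpha>)}. mps_coeff (mps_const a) \<beta> * mps_coeff f \<gamma>)"
    unfolding mps_coeff_mult
    by (intro sum.mono_neutral_right finite_splits)
      (auto simp: splits_def mps_coeff_const split: if_splits)
  then show ?thesis by simp
qed

definition mps_monom :: "'n multiindex \<Rightarrow> ('n, 'a::zero_neq_one) mps" where
  "mps_monom \<beta> = Abs_mps (\<lambda>\<alpha>. if \<alpha> = \<beta> then 1 else 0)"

lemma mps_var_monom: "mps_var i = mps_monom (Poly_Mapping.single i 1)"
  by (rule mps_eqI) (simp add: mps_coeff_var mps_monom_def)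

lemma mps_coeff_monom_mult_add [simp]:
  "mps_coeff (mps_monom \<beta> * f) (\<beta> + \<gamma>) = mps_coeff f \<gamma>"
proof -
  have "mps_coeff (mps_monom \<beta> * f) (\<beta> + \<gamma>) =
      (\<Sum>(\<beta>', \<gamma>)\<in>{(\<beta>, \<gamma>)}. mps_coeff (mps_monom \<beta>) \<beta>' * mps_coeff f \<gamma>)"
    unfolding mps_coeff_mult
    by (rule sum.mono_neutral_right[OF finite_splits])
      (auto simp: splits_def mps_monom_def split: if_splits)
  then show ?thesis by (simp add: mps_monom_def)
qed

lemma mps_coeff_monom_mult_0:
  assumes "\<And>\<gamma>. \<alpha> \<noteq> \<beta> + \<gamma>"
  shows "mps_coeff (mps_monom \<beta> * f) \<alpha> = 0"
  unfolding mps_coeff_mult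
  by (rule sum.neutral) (use assms in \<open>auto simp: splits_def mps_monom_def\<close>)

lemma mps_const_zero [simp]: "mps_const 0 = 0"
  and mps_const_one [simp]: "mps_const 1 = 1"
  and mps_const_add: "mps_const (a + b) = mps_const a + mps_const b"
  and mps_const_diff: "mps_const (a - b) = mps_const a - mps_const b"
  and mps_const_mult: "mps_const (a * b) = mps_const a * mps_const b"
  by (auto intro!: mps_eqI simp: mps_coeff_const mps_coeff_one)

lemma mps_const_sum: "mps_const (sum f A) = (\<Sum>x\<in>A. mps_const (f x))"
  by (induction A rule: infinite_finite_induct) (auto simp: mps_const_add)

lemma mps_in_zero [simp]: "0 \<in> mps_in C"
  and mps_in_one [simp]: "1 \<in> mps_in C"
  and mps_in_const [simp]: "mps_const a \<in> mps_in C"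
  by (auto simp: mps_in_def mps_coeff_one mps_coeff_const)

lemma mps_in_coeff: "f \<in> mps_in C \<longleftrightarrow> (\<forall>\<alpha>. \<not> keys \<alpha> \<subseteq> C \<longrightarrow> mps_coeff f \<alpha> = 0)"
  unfolding mps_in_def by blast

lemma mps_in_add [intro]: "f \<in> mps_in C \<Longrightarrow> g \<in> mps_in C \<Longrightarrow> f + g \<in> mps_in C"
  by (simp add: mps_in_coeff)

lemma mps_in_uminus [intro]: "f \<in> mps_in C \<Longrightarrow> - f \<in> mps_in C"
  by (auto simp: mps_in_def)

lemma mps_in_diff [intro]: "f \<in> mps_in C \<Longrightarrow> g \<in> mps_in C \<Longrightarrow> f - g \<in> mps_in C"
  using mps_in_add[of f C "- g"] by auto

lemma mps_in_mult [intro]: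
  assumes "f \<in> mps_in C" "g \<in> mps_in C"
  shows "f * g \<in> mps_in C"
  unfolding mps_in_def
proof clarify
  fix \<alpha> i assume a: "mps_coeff (f * g) \<alpha> \<noteq> 0" and i: "i \<in> keys \<alpha>"
  from a obtain x where x: "x \<in> splits \<alpha>" "mps_coeff f (fst x) * mps_coeff g (snd x) \<noteq> 0"
    unfolding mps_coeff_mult case_prod_unfold by (rule sum.not_neutral_contains_not_neutral)
  then have "mps_coeff f (fst x) \<noteq> 0" "mps_coeff g (snd x) \<noteq> 0" by auto
  then have "keys (fst x) \<subseteq> C" "keys (snd x) \<subseteq> C" using assms unfolding mps_in_def by blast+
  moreover have "\<alpha> = fst x + snd x" using x(1) by (auto simp: splits_def)
  ultimately have "keys (fst x) \<subseteq> C" "keys (snd x) \<subseteq> C" "\<alpha> = fst x + snd x" by auto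
  then show "i \<in> C" using i by (auto simp: keys_plus_nat)
qed

lemma mps_in_sum [intro]: "(\<And>x. x \<in> A \<Longrightarrow> f x \<in> mps_in C) \<Longrightarrow> sum f A \<in> mps_in C"
  by (induction A rule: infinite_finite_induct) auto

lemma mps_in_power [intro]: "f \<in> mps_in C \<Longrightarrow> f ^ k \<in> mps_in C"
  by (induction k) auto

lemma mps_in_monom: "keys \<beta> \<subseteq> C \<Longrightarrow> mps_monom \<beta> \<in> mps_in C"
  by (auto simp: mps_in_def mps_monom_def)

lemma mps_in_var: "i \<in> C \<Longrightarrow> mps_var i \<in> mps_in C"
  unfolding mps_var_monom by (rule mps_in_monom) auto

text \<open>Inside the series in the variables of \<open>C\<close> this is the \<open>k\<close>-th power of the maximal ideal (see
  \<open>max_ideal_power_eq\<close>), in a form that can be tested on coefficients.\<close>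

definition mps_ord_ge :: "nat \<Rightarrow> ('n::finite, 'a::zero) mps set" where
  "mps_ord_ge k = {f. \<forall>\<alpha>. mdeg \<alpha> < k \<longrightarrow> mps_coeff f \<alpha> = 0}"

lemma mps_ord_ge_0 [simp]: "mps_ord_ge 0 = UNIV"
  by (auto simp: mps_ord_ge_def)

lemma mps_ord_ge_1: "f \<in> mps_ord_ge (Suc 0) \<longleftrightarrow> mps_coeff f 0 = 0"
  by (auto simp: mps_ord_ge_def)

lemma mps_ord_ge_zero [simp]: "0 \<in> mps_ord_ge k"
  by (auto simp: mps_ord_ge_def)

lemma mps_ord_ge_add: "f \<in> mps_ord_ge k \<Longrightarrow> g \<in> mps_ord_ge k \<Longrightarrow> f + g \<in> mps_ord_ge k"
  by (auto simp: mps_ord_ge_def)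

lemma mps_ord_ge_mult:
  assumes "f \<in> mps_ord_ge k" "g \<in> mps_ord_ge l"
  shows "f * g \<in> mps_ord_ge (k + l)"
  unfolding mps_ord_ge_def
proof (clarify, rule ccontr)
  fix \<alpha> assume a: "mdeg \<alpha> < k + l" "mps_coeff (f * g) \<alpha> \<noteq> 0"
  from a(2) obtain x where x: "x \<in> splits \<alpha>" "mps_coeff f (fst x) * mps_coeff g (snd x) \<noteq> 0"
    unfolding mps_coeff_mult case_prod_unfold by (rule sum.not_neutral_contains_not_neutral)
  then have "mps_coeff f (fst x) \<noteq> 0" "mps_coeff g (snd x) \<noteq> 0" by auto
  moreover have "\<alpha> = fst x + snd x" using x(1) by (auto simp: splits_def)
  ultimately have "mps_coeff f (fst x) \<noteq> 0" "mps_coeff g (snd x) \<noteq> 0" "\<alpha> = fst x + snd x"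
    by auto
  with assms have "k \<le> mdeg (fst x)" "l \<le> mdeg (snd x)"
    by (auto simp: mps_ord_ge_def not_less[symmetric])
  with a(1) \<open>\<alpha> = _\<close> show False by simp
qed

lemma mps_ord_ge_mult_left: "f \<in> mps_ord_ge k \<Longrightarrow> g * f \<in> mps_ord_ge k"
  using mps_ord_ge_mult[of g 0 f k] by simp

lemma mps_ord_ge_mult_right: "f \<in> mps_ord_ge k \<Longrightarrow> f * g \<in> mps_ord_ge k"
  using mps_ord_ge_mult_left[of f k g] by (simp add: mult.commute)

lemma mps_ord_ge_power: "f \<in> mps_ord_ge (Suc 0) \<Longrightarrow> f ^ k \<in> mps_ord_ge k"
proof (induction k)
  case (Suc k)
  then show ?case using mps_ord_ge_mult[of f "Suc 0" "f ^ k" k] by simp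
qed simp

lemma mps_ord_ge_var: "mps_var i \<in> mps_ord_ge (Suc 0)"
  by (simp add: mps_ord_ge_1)

text \<open>Each monomial of positive degree is divided by one variable that occurs in it, chosen once and for all; the
  terms assigned to \<open>i\<close> make up \<open>y\<^sub>i g\<^sub>i\<close>.\<close>

lemma mps_ord_ge_decomp:
  fixes f :: "('n::finite, 'a::comm_ring_1) mps"
  assumes "f \<in> mps_in C" "f \<in> mps_ord_ge (Suc k)"
  obtains g where "\<And>i. i \<in> C \<Longrightarrow> g i \<in> mps_in C \<inter> mps_ord_ge k" "f = (\<Sum>i\<in>C. mps_var i * g i)"
proof -
  define p :: "'n multiindex \<Rightarrow> 'n" where "p \<alpha> = (SOME i. i \<in> keys \<alpha>)" for \<alpha>
  have p: "p \<alpha> \<in> keys \<alpha>" if "\<alpha> \<noteq> 0" for \<alpha>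
    unfolding p_def using that by (metis all_not_in_conv keys_eq_empty someI_ex)
  define g where "g i = Abs_mps (\<lambda>\<beta>. if p (Poly_Mapping.single i 1 + \<beta>) = i
    then mps_coeff f (Poly_Mapping.single i 1 + \<beta>) else 0)" for i
  show ?thesis
  proof
    fix i assume "i \<in> C"
    show "g i \<in> mps_in C \<inter> mps_ord_ge k"
      using assms by (simp add: g_def mps_in_coeff mps_ord_ge_def keys_plus_nat)
  next
    show "f = (\<Sum>i\<in>C. mps_var i * g i)"
    proof (rule mps_eqI)
      fix \<alpha>
      have t: "mps_coeff (mps_var i * g i) \<alpha> =
          (if i \<in> keys \<alpha> \<and> p \<alpha> = i then mps_coeff f \<alpha> else 0)" for i
      proof (cases "i \<in> keys \<alpha>")
        case True
        then have "\<alpha> = Poly_Mapping.single i 1 + (\<alpha> - Poly_Mapping.single i 1)"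
          by (intro poly_mapping_eqI)
            (auto simp: lookup_add lookup_minus lookup_single when_def in_keys_iff)
        then obtain \<gamma> where "\<alpha> = Poly_Mapping.single i 1 + \<gamma>" by blast
        then show ?thesis using True
          by (simp only: mps_var_monom mps_coeff_monom_mult_add) (simp add: g_def)
      next
        case False
        then have "mps_coeff (mps_monom (Poly_Mapping.single i 1) * g i) \<alpha> = 0"
          by (intro mps_coeff_monom_mult_0) (auto simp: keys_plus_nat)
        then show ?thesis using False by (simp add: mps_var_monom)
      qed
      show "mps_coeff f \<alpha> = mps_coeff (\<Sum>i\<in>C. mps_var i * g i) \<alpha>"
      proof (cases "\<alpha> = 0 \<or> \<not> keys \<alpha> \<subseteq> C")
        case True
        then have "mps_coeff f \<alpha> = 0"
          using assms by (auto simp: mps_ord_ge_def mps_in_def)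
        then show ?thesis by (auto simp: t intro!: sum.neutral)
      next
        case False
        then have "p \<alpha> \<in> keys \<alpha>" "p \<alpha> \<in> C" using p by auto
        then have "(\<Sum>i\<in>C. if i \<in> keys \<alpha> \<and> p \<alpha> = i then mps_coeff f \<alpha> else 0) =
          (\<Sum>i\<in>C. if p \<alpha> = i then mps_coeff f \<alpha> else 0)" by (intro sum.cong) auto
        then show ?thesis using \<open>p \<alpha> \<in> C\<close> by (simp add: t)
      qed
    qed
  qed
qed

text \<open>A series with invertible constant term \<open>c (1 - t)\<close> has the inverse
  \<open>c\<^sup>-\<^sup>1 (1 + t + t\<^sup>2 + \<dots>)\<close>; the coefficient at \<open>\<alpha>\<close> only involves the powers up to \<open>t\<^bsup>|\<alpha>|\<^esup>\<close>.\<close>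

lemma mps_inverse:
  fixes f :: "('n::finite, 'a::field) mps"
  assumes "f \<in> mps_in C" "mps_coeff f 0 \<noteq> 0"
  obtains g where "g \<in> mps_in C" "f * g = 1"
proof -
  define c where "c = mps_coeff f 0"
  define t where "t = 1 - mps_const (1 / c) * f"
  have c: "c \<noteq> 0" using assms by (simp add: c_def)
  have f: "mps_const (1 / c) * f = 1 - t" by (simp add: t_def)
  have t: "t \<in> mps_in C" "t \<in> mps_ord_ge (Suc 0)"
    using assms by (auto simp: t_def mps_ord_ge_1 c_def intro!: mps_in_diff mps_in_mult)
  define S where "S N = (\<Sum>k<N. t ^ k)" for N
  define h where "h = Abs_mps (\<lambda>\<alpha>. mps_coeff (S (Suc (mdeg \<alpha>))) \<alpha>)"
  have hS: "mps_coeff h \<alpha> = mps_coeff (S N) \<alpha>" if "N > mdeg \<alpha>" for \<alpha> N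
  proof -
    have "mps_coeff (S N) \<alpha> = (\<Sum>k<N. mps_coeff (t ^ k) \<alpha>)" by (simp add: S_def)
    also have "\<dots> = (\<Sum>k<Suc (mdeg \<alpha>). mps_coeff (t ^ k) \<alpha>)"
    proof (rule sum.mono_neutral_right)
      show "\<forall>k\<in>{..<N} - {..<Suc (mdeg \<alpha>)}. mps_coeff (t ^ k) \<alpha> = 0"
        using mps_ord_ge_power[OF t(2)] by (auto simp: mps_ord_ge_def)
    qed (use that in auto)
    finally show ?thesis by (simp add: h_def S_def)
  qed
  have "(1 - t) * h = 1"
  proof (rule mps_eqI)
    fix \<alpha> :: "'n multiindex"
    define N where "N = Suc (mdeg \<alpha>)"
    have "mps_coeff ((1 - t) * h) \<alpha> = mps_coeff ((1 - t) * S N) \<alpha>"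
      unfolding mps_coeff_mult
    proof (rule sum.cong, simp, clarify)
      fix \<beta> \<gamma> assume "(\<beta>, \<gamma>) \<in> splits \<alpha>"
      then have "mdeg \<gamma> < N" by (auto simp: N_def splits_def)
      then show "mps_coeff (1 - t) \<beta> * mps_coeff h \<gamma> = mps_coeff (1 - t) \<beta> * mps_coeff (S N) \<gamma>"
        by (simp add: hS)
    qed
    also have "(1 - t) * S N = 1 - t ^ N"
      unfolding S_def by (simp add: one_diff_power_eq)
    also have "mps_coeff (1 - t ^ N) \<alpha> = mps_coeff 1 \<alpha>"
      using mps_ord_ge_power[OF t(2), of N] by (auto simp: mps_ord_ge_def N_def)
    finally show "mps_coeff ((1 - t) * h) \<alpha> = mps_coeff 1 \<alpha>" .
  qed
  then have "f * (mps_const (1 / c) * h) = 1"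
    by (simp add: f[symmetric] ac_simps)
  moreover have "h \<in> mps_in C"
    unfolding mps_in_def
  proof clarify
    fix \<alpha> i assume "mps_coeff h \<alpha> \<noteq> 0" "i \<in> keys \<alpha>"
    moreover have "S (Suc (mdeg \<alpha>)) \<in> mps_in C" unfolding S_def using t by auto
    ultimately show "i \<in> C" unfolding h_def mps_in_def by auto
  qed
  ultimately show ?thesis using that[OF mps_in_mult[OF mps_in_const]] by blast
qed

section \<open>Submodules and powers of the maximal ideal\<close>

lemma submodule_overD:
  assumes "submodule_over S smul N"
  shows "0 \<in> N" "x \<in> N \<Longrightarrow> y \<in> N \<Longrightarrow> x + y \<in> N" "a \<in> S \<Longrightarrow> x \<in> N \<Longrightarrow> smul a x \<in> N"
  using assms by (auto simp: submodule_over_def)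

lemma submodule_over_hull: "submodule_over S smul (submodule_over S smul hull A)"
  by (rule hull_in) (auto simp: submodule_over_def)

lemma submodule_over_sum:
  assumes "submodule_over S smul N" "\<And>x. x \<in> A \<Longrightarrow> f x \<in> N"
  shows "sum f A \<in> N"
  using assms(2)
  by (induction A rule: infinite_finite_induct) (auto simp: submodule_overD[OF assms(1)])

lemma submodule_over_plus:
  fixes smul :: "'a \<Rightarrow> 'b::ab_group_add \<Rightarrow> 'b"
  assumes M: "submodule_over S smul M" and N: "submodule_over S smul N"
    and add: "\<And>a x y. smul a (x + y) = smul a x + smul a y"
  shows "submodule_over S smul {u + v | u v. u \<in> M \<and> v \<in> N}"
  unfolding submodule_over_def
proof (intro conjI ballI)
  show "0 \<in> {u + v | u v. u \<in> M \<and> v \<in> N}"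
    using submodule_overD(1)[OF M] submodule_overD(1)[OF N]
    by (metis (mono_tags, lifting) add.right_neutral mem_Collect_eq)
next
  fix x y assume "x \<in> {u + v | u v. u \<in> M \<and> v \<in> N}" "y \<in> {u + v | u v. u \<in> M \<and> v \<in> N}"
  then obtain u v u' v' where "x = u + v" "y = u' + v'" "u \<in> M" "u' \<in> M" "v \<in> N" "v' \<in> N" by blast
  then have "x + y = (u + u') + (v + v')" "u + u' \<in> M" "v + v' \<in> N"
    using submodule_overD(2)[OF M] submodule_overD(2)[OF N] by (auto simp: algebra_simps)
  then show "x + y \<in> {u + v | u v. u \<in> M \<and> v \<in> N}" by blast
next
  fix a x assume "a \<in> S" "x \<in> {u + v | u v. u \<in> M \<and> v \<in> N}"
  then show "smul a x \<in> {u + v | u v. u \<in> M \<and> v \<in> N}"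
    using submodule_overD(3)[OF M] submodule_overD(3)[OF N] by (force simp: add)
qed

lemma mps_submodule_uminus:
  assumes "submodule_over (mps_in C) (*s) V" "v \<in> V"
  shows "- v \<in> V"
proof -
  have "(- 1) *s v \<in> V" by (rule submodule_overD(3)[OF assms(1) _ assms(2)]) auto
  then show ?thesis by (simp add: vector_sneg_minus1[symmetric])
qed

lemma mps_submodule_diff:
  assumes "submodule_over (mps_in C) (*s) V" "v \<in> V" "w \<in> V"
  shows "v - w \<in> V"
  using submodule_overD(2)[OF assms(1,2) mps_submodule_uminus[OF assms(1,3)]] by simp

lemma vec_in_submodule: "submodule_over (mps_in C) (*s) (vec_in (mps_in C))"
  by (auto simp: submodule_over_def vec_in_def)

definition vec_ord_ge :: "nat \<Rightarrow> (('n::finite, 'a::zero) mps ^ 'r) set" where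
  "vec_ord_ge m = vec_in (mps_ord_ge m)"

lemma vec_ord_ge_submodule:
  "submodule_over (mps_in C) (*s) (vec_in (mps_in C) \<inter> vec_ord_ge m)"
  by (auto simp: submodule_over_def vec_in_def vec_ord_ge_def mps_ord_ge_add mps_ord_ge_mult_left)

lemma max_ideal_eq:
  "max_ideal C = (mps_in C \<inter> mps_ord_ge (Suc 0) :: ('n::finite, 'a::comm_ring_1) mps set)"
proof
  show "max_ideal C \<subseteq> (mps_in C \<inter> mps_ord_ge (Suc 0) :: ('n, 'a) mps set)"
    unfolding max_ideal_def
    by (rule hull_minimal)
      (auto simp: submodule_over_def mps_in_var mps_ord_ge_var mps_ord_ge_add mps_ord_ge_mult_left)
  have sub: "submodule_over (mps_in C) (*) (max_ideal C :: ('n, 'a) mps set)"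
    unfolding max_ideal_def by (rule submodule_over_hull)
  show "mps_in C \<inter> mps_ord_ge (Suc 0) \<subseteq> (max_ideal C :: ('n, 'a) mps set)"
  proof
    fix f :: "('n, 'a) mps" assume "f \<in> mps_in C \<inter> mps_ord_ge (Suc 0)"
    then obtain g where g: "\<And>i. i \<in> C \<Longrightarrow> g i \<in> mps_in C \<inter> mps_ord_ge 0"
      "f = (\<Sum>i\<in>C. mps_var i * g i)" using mps_ord_ge_decomp by blast
    have "mps_var i * g i \<in> max_ideal C" if "i \<in> C" for i
    proof -
      have "mps_var i \<in> (max_ideal C :: ('n, 'a) mps set)"
        unfolding max_ideal_def by (rule hull_inc) (use that in auto)
      then show ?thesis using submodule_overD(3)[OF sub, of "g i" "mps_var i"] g(1)[OF that]
        by (simp add: mult.commute)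
    qed
    then show "f \<in> max_ideal C" unfolding g(2) by (rule submodule_over_sum[OF sub])
  qed
qed

text \<open>For \<open>\<supseteq>\<close>, one variable is split off at a time, and the remaining factor lies in the previous power.\<close>

lemma max_ideal_power_eq:
  "max_ideal_power C m = (mps_in C \<inter> mps_ord_ge m :: ('n::finite, 'a::comm_ring_1) mps set)"
proof
  have "(\<Prod>j<k. a j) \<in> mps_in C \<inter> mps_ord_ge k"
    if "\<forall>j<k. a j \<in> max_ideal C" for k and a :: "nat \<Rightarrow> ('n, 'a) mps"
    using that
  proof (induction k)
    case (Suc k)
    then have "(\<Prod>j<k. a j) \<in> mps_in C \<inter> mps_ord_ge k" "a k \<in> mps_in C \<inter> mps_ord_ge (Suc 0)"
      by (auto simp: max_ideal_eq)
    then show ?case using mps_ord_ge_mult[of "\<Prod>j<k. a j" k "a k" "Suc 0"] by auto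
  qed simp
  then show "max_ideal_power C m \<subseteq> (mps_in C \<inter> mps_ord_ge m :: ('n, 'a) mps set)"
    unfolding max_ideal_power_def
    by (intro hull_minimal) (auto simp: submodule_over_def mps_ord_ge_add mps_ord_ge_mult_left)
next
  have sub: "submodule_over (mps_in C) (*) (max_ideal_power C k :: ('n, 'a) mps set)" for k
    unfolding max_ideal_power_def by (rule submodule_over_hull)
  have step: "mps_var i * b \<in> max_ideal_power C (Suc k)"
    if i: "i \<in> C" and b: "b \<in> max_ideal_power C k" for i k and b :: "('n, 'a) mps"
  proof -
    have "max_ideal_power C k \<subseteq> {b :: ('n, 'a) mps. mps_var i * b \<in> max_ideal_power C (Suc k)}"
      unfolding max_ideal_power_def[of C k]
    proof (rule hull_minimal, clarify)
      fix a :: "nat \<Rightarrow> ('n, 'a) mps" assume a: "\<forall>j<k. a j \<in> max_ideal C"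
      have "mps_var i \<in> (max_ideal C :: ('n, 'a) mps set)"
        using i by (simp add: max_ideal_eq mps_in_var mps_ord_ge_var)
      with a have "\<forall>j<Suc k. (a(k := mps_var i)) j \<in> max_ideal C" by (auto simp: less_Suc_eq)
      then have "(\<Prod>j<Suc k. (a(k := mps_var i)) j) \<in> max_ideal_power C (Suc k)"
        unfolding max_ideal_power_def by (intro hull_inc) blast
      moreover have "(\<Prod>j<k. (a(k := mps_var i)) j) = (\<Prod>j<k. a j)" by (rule prod.cong) auto
      ultimately show "mps_var i * (\<Prod>j<k. a j) \<in> max_ideal_power C (Suc k)"
        by (simp add: mult.commute)
    next
      show "submodule_over (mps_in C) (*) {b :: ('n, 'a) mps. mps_var i * b \<in> max_ideal_power C (Suc k)}"
        using submodule_overD[OF sub[of "Suc k"]]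
        by (auto simp: submodule_over_def distrib_left mult.left_commute)
    qed
    then show ?thesis using b by blast
  qed
  have "f \<in> max_ideal_power C m" if "f \<in> mps_in C \<inter> mps_ord_ge m" for f :: "('n, 'a) mps"
    using that
  proof (induction m arbitrary: f)
    case 0
    have "(\<Prod>j<0. (undefined :: nat \<Rightarrow> ('n, 'a) mps) j) \<in> max_ideal_power C 0"
      unfolding max_ideal_power_def by (rule hull_inc) auto
    then have "1 \<in> (max_ideal_power C 0 :: ('n, 'a) mps set)" by simp
    then show ?case using submodule_overD(3)[OF sub[of 0], of f 1] 0 by simp
  next
    case (Suc m)
    then obtain g where g: "\<And>i. i \<in> C \<Longrightarrow> g i \<in> mps_in C \<inter> mps_ord_ge m"
      "f = (\<Sum>i\<in>C. mps_var i * g i)" using mps_ord_ge_decomp by blast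
    show ?case unfolding g(2) using g(1) Suc.IH step by (intro submodule_over_sum[OF sub]) blast
  qed
  then show "mps_in C \<inter> mps_ord_ge m \<subseteq> (max_ideal_power C m :: ('n, 'a) mps set)" by blast
qed

lemma vec_eq_sum_axis: "v = (\<Sum>j\<in>UNIV. (v $ j) *s axis j (1 :: 'a::comm_ring_1))"
  by (simp add: vec_eq_iff axis_def if_distrib cong: if_cong)

lemma max_ideal_power_vec_eq:
  "max_ideal_power_vec C m =
    (vec_in (mps_in C) \<inter> vec_ord_ge m :: (('n::finite, 'a::comm_ring_1) mps ^ 'r::finite) set)"
proof
  show "max_ideal_power_vec C m \<subseteq>
      (vec_in (mps_in C) \<inter> vec_ord_ge m :: (('n, 'a) mps ^ 'r) set)"
    unfolding max_ideal_power_vec_def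
  proof (rule hull_minimal)
    show "{a *s v |a v. a \<in> max_ideal_power C m \<and> v \<in> vec_in (mps_in C)} \<subseteq>
        (vec_in (mps_in C) \<inter> vec_ord_ge m :: (('n, 'a) mps ^ 'r) set)"
      by (auto simp: max_ideal_power_eq vec_in_def vec_ord_ge_def mps_ord_ge_mult_right
          intro!: mps_in_mult)
  qed (rule vec_ord_ge_submodule)
  show "(vec_in (mps_in C) \<inter> vec_ord_ge m :: (('n, 'a) mps ^ 'r) set) \<subseteq> max_ideal_power_vec C m"
  proof
    fix v :: "('n, 'a) mps ^ 'r" assume v: "v \<in> vec_in (mps_in C) \<inter> vec_ord_ge m"
    have "(v $ j) *s axis j 1 \<in> max_ideal_power_vec C m" for j
      unfolding max_ideal_power_vec_def max_ideal_power_eq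
    proof (rule hull_inc, rule CollectI, intro exI conjI)
      show "v $ j \<in> mps_in C \<inter> mps_ord_ge m"
        using v by (auto simp: vec_in_def vec_ord_ge_def)
      show "axis j 1 \<in> vec_in (mps_in C)" by (auto simp: vec_in_def axis_def)
    qed (rule refl)
    then show "v \<in> max_ideal_power_vec C m"
      by (subst vec_eq_sum_axis[of v], unfold max_ideal_power_vec_def)
        (rule submodule_over_sum[OF submodule_over_hull])
  qed
qed

section \<open>The residue map and Taylor expansion\<close>

text \<open>The passage to the residue field only enters through the ring homomorphism
  \<open>\<rho> : R \<rightarrow> F\<close> with kernel \<open>P\<close> whose values generate \<open>F\<close> as a field.\<close>

locale residue_map =
  fixes P :: "('n::finite, 'k::field_char_0) mpol set"
    and C :: "'n set"
    and \<rho> :: "('n, 'k) mpol \<Rightarrow> 'f::field"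
  assumes prime: "prime_ideal P"
    and rho_one [simp]: "\<rho> 1 = 1"
    and rho_add: "\<rho> (f + g) = \<rho> f + \<rho> g"
    and rho_mult: "\<rho> (f * g) = \<rho> f * \<rho> g"
    and rho_zero_iff: "\<rho> f = 0 \<longleftrightarrow> f \<in> P"
    and rho_frac: "\<exists>a s. s \<notin> P \<and> x = \<rho> a / \<rho> s"
    and basis: "basis_modulo P (- C)"

lemma module_mult: "module ((*) :: 'a::comm_ring_1 \<Rightarrow> 'a \<Rightarrow> 'a)"
  by unfold_locales (auto simp: algebra_simps)

lemma prime_idealD:
  assumes "prime_ideal P"
  shows "0 \<in> P" "a \<in> P \<Longrightarrow> b \<in> P \<Longrightarrow> a + b \<in> P" "b \<in> P \<Longrightarrow> a * b \<in> P"
    "1 \<notin> P" "a \<notin> P \<Longrightarrow> b \<notin> P \<Longrightarrow> a * b \<notin> P"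
proof -
  show "0 \<in> P" "a \<in> P \<Longrightarrow> b \<in> P \<Longrightarrow> a + b \<in> P" and t: "b \<in> P \<Longrightarrow> a * b \<in> P" for a b
    using assms by (auto simp: prime_ideal_def module.subspace_def[OF module_mult])
  show "1 \<notin> P" using t[of 1] assms by (auto simp: prime_ideal_def)
  show "a \<notin> P \<Longrightarrow> b \<notin> P \<Longrightarrow> a * b \<notin> P"
    using assms by (auto simp: prime_ideal_def)
qed

lemma prime_ideal_power: "prime_ideal P \<Longrightarrow> a \<notin> P \<Longrightarrow> a ^ k \<notin> P"
  by (induction k) (auto simp: prime_idealD)

text \<open>Equality of fractions is an equivalence relation, so the classes agree as sets of representatives as soon as one
  relation between numerators and denominators is known.\<close>

lemma loc_frac_eqI:
  assumes P: "prime_ideal P" and M: "module smul"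
    and "s \<notin> P" "t \<notin> P" "u \<notin> P" "smul u (smul t x - smul s y) = 0"
  shows "loc_frac P smul x s = loc_frac P smul y t"
proof -
  interpret module smul by (rule M)
  have sub: "loc_frac P smul x s \<subseteq> loc_frac P smul y t"
    if st: "s \<notin> P" "t \<notin> P" "u \<notin> P" "smul u (smul t x - smul s y) = 0" for x y s t u
  proof (rule subsetI, clarify)
    fix z v assume "(z, v) \<in> loc_frac P smul x s"
    then obtain w where w: "v \<notin> P" "w \<notin> P" "smul w (smul v x - smul s z) = 0"
      by (auto simp: loc_frac_def)
    \<comment> \<open>\<open>u w s (v y - t z)\<close> is a combination of the two relations\<close>
    have "smul (u * w * s) (smul v y - smul t z) =
        smul (u * t) (smul w (smul v x - smul s z)) - smul (w * v) (smul u (smul t x - smul s y))"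
      by (simp add: scale_right_diff_distrib algebra_simps)
    then have "smul (u * w * s) (smul v y - smul t z) = 0" using w st by simp
    then show "(z, v) \<in> loc_frac P smul y t"
      using w st prime_idealD(5)[OF P] unfolding loc_frac_def by blast
  qed
  have "smul u (smul s y - smul t x) = 0"
    using assms(6) by (simp add: scale_right_diff_distrib)
  then show ?thesis using sub[OF assms(3-6)] sub[OF assms(4,3,5)] by blast
qed

lemma loc_frac_self:
  assumes "prime_ideal P" "module smul" "s \<notin> P"
  shows "(x, s) \<in> loc_frac P smul x s"
proof -
  interpret module smul by (rule assms)
  show ?thesis using prime_idealD(4)[OF assms(1)] assms(3) by (auto simp: loc_frac_def)
qed

lemma loc_frac_eqD:
  assumes "prime_ideal P" "module smul" "loc_frac P smul x s = loc_frac P smul y t" "t \<notin> P"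
  obtains u where "u \<notin> P" "smul u (smul t x - smul s y) = 0"
proof -
  have "(y, t) \<in> loc_frac P smul x s"
    unfolding assms(3) by (rule loc_frac_self) (use assms in auto)
  then show ?thesis using that by (auto simp: loc_frac_def)
qed

text \<open>The kernel of \<open>R \<rightarrow> R\<^sub>P / P R\<^sub>P\<close> is \<open>P\<close> because \<open>P\<close> is prime, and \<open>\<psi> (a / s) = \<rho> a / \<rho> s\<close> shows that all of \<open>F\<close> is
  reached by fractions.\<close>

lemma residue_map_residue_class:
  fixes P :: "('n::finite, 'k::field_char_0) mpol set"
  assumes P: "prime_ideal P" and B: "basis_modulo P (- C)" and F: "is_residue_field P \<psi>"
  shows "residue_map P C (residue_class P \<psi>)"
proof -
  let ?q = "loc_frac P ((*) :: ('n, 'k) mpol \<Rightarrow> _)"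
  note [simp] = prime_idealD(4)[OF P]
  note F' = F[unfolded is_residue_field_def]
  note h = F'[THEN conjunct2, THEN conjunct1, THEN spec, THEN spec, THEN spec, THEN spec,
      THEN mp, OF conjI]
  note hom = F'[THEN conjunct1] h[THEN conjunct1] h[THEN conjunct2]
  note surj = F'[THEN conjunct2, THEN conjunct2, THEN conjunct1]
  note ker = F'[THEN conjunct2, THEN conjunct2, THEN conjunct2]
  have zero: "\<psi> (?q f 1) = 0 \<longleftrightarrow> f \<in> P" for f
  proof
    assume z: "\<psi> (?q f 1) = 0"
    have "?q f 1 \<in> localization P (*) UNIV"
      unfolding localization_def by (intro CollectI exI conjI) (rule refl, simp_all)
    with z have "?q f 1 \<in> {z \<in> localization P (*) UNIV. \<psi> z = 0}" by (intro CollectI conjI)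
    then have "?q f 1 \<in> localization P (*) P" by (simp only: ker)
    then obtain p s where ps: "p \<in> P" "s \<notin> P" "?q f 1 = ?q p s"
      unfolding localization_def by (elim CollectE exE conjE)
    then obtain u where u: "u \<notin> P" "u * (s * f - 1 * p) = 0"
      by (elim loc_frac_eqD[OF P module_mult])
    then have "u * s * f = u * p" by (simp add: algebra_simps)
    then have "(u * s) * f \<in> P" using prime_idealD(3)[OF P ps(1), of u] by simp
    moreover have "u * s \<notin> P" using u ps prime_idealD(5)[OF P] by blast
    ultimately show "f \<in> P" using prime_idealD(5)[OF P] by blast
  next
    assume "f \<in> P"
    then have "?q f 1 \<in> localization P (*) P"
      unfolding localization_def by (intro CollectI exI conjI) (rule refl, simp_all)
    then have "?q f 1 \<in> {z \<in> localization P (*) UNIV. \<psi> z = 0}" by (simp only: ker)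
    then show "\<psi> (?q f 1) = 0" by (elim CollectE conjE)
  qed
  show ?thesis
  proof
    show "residue_class P \<psi> 1 = 1" by (simp add: residue_class_def hom(1))
    show "residue_class P \<psi> (f + g) = residue_class P \<psi> f + residue_class P \<psi> g" for f g
      using hom(2)[of 1 1 f g] by (simp add: residue_class_def)
    show "residue_class P \<psi> (f * g) = residue_class P \<psi> f * residue_class P \<psi> g" for f g
      using hom(3)[of 1 1 f g] by (simp add: residue_class_def)
    show "residue_class P \<psi> f = 0 \<longleftrightarrow> f \<in> P" for f
      by (simp add: residue_class_def zero)
    show "\<exists>a s. s \<notin> P \<and> x = residue_class P \<psi> a / residue_class P \<psi> s" for x
    proof -
      have "x \<in> \<psi> ` localization P (*) UNIV" by (simp add: surj)
      then obtain a s where as: "x = \<psi> (?q a s)" "s \<notin> P"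
        unfolding localization_def by (elim imageE CollectE exE conjE) simp
      have "?q (a * s) (s * 1) = ?q a 1"
        by (rule loc_frac_eqI[OF P module_mult, of _ _ 1]) (use as in \<open>auto simp: algebra_simps\<close>)
      then have "x * \<psi> (?q s 1) = \<psi> (?q a 1)"
        using hom(3)[of s 1 a s] as by simp
      moreover have "\<psi> (?q s 1) \<noteq> 0" using as zero by simp
      ultimately have "x = residue_class P \<psi> a / residue_class P \<psi> s"
        by (simp add: residue_class_def field_simps)
      then show ?thesis using as by blast
    qed
  qed (fact P B)+
qed

text \<open>A closed form of \<open>\<eta>\<close> (see \<open>eta_eq_taylor\<close>). It makes the coefficients of \<open>\<eta> f\<close> accessible: \<open>\<eta> f\<close> has order at least
  \<open>m\<close> iff all derivatives of \<open>f\<close> of order less than \<open>m\<close> in the directions of \<open>C\<close> lie in \<open>P\<close>.\<close>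

definition taylor :: "'n set \<Rightarrow> (('n, 'k) mpol \<Rightarrow> 'f) \<Rightarrow>
    ('n::finite, 'k::field) mpol \<Rightarrow> ('n, 'f::field) mps" where
  "taylor C \<rho> f =
    Abs_mps (\<lambda>\<alpha>. if keys \<alpha> \<subseteq> C then \<rho> (mderiv \<alpha> f) / of_nat (mfact \<alpha>) else 0)"

context residue_map
begin

lemma rho_zero [simp]: "\<rho> 0 = 0"
  by (simp add: rho_zero_iff prime_idealD[OF prime])

lemma rho_uminus: "\<rho> (- f) = - \<rho> f"
proof -
  have "\<rho> f + \<rho> (- f) = 0" by (simp flip: rho_add)
  then show ?thesis by (rule minus_unique[symmetric])
qed

lemma rho_diff: "\<rho> (f - g) = \<rho> f - \<rho> g"
  using rho_add[of f "- g"] by (simp add: rho_uminus)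

lemma rho_sum: "\<rho> (sum f A) = (\<Sum>x\<in>A. \<rho> (f x))"
  by (induction A rule: infinite_finite_induct) (auto simp: rho_add)

lemma rho_of_nat [simp]: "\<rho> (of_nat k) = of_nat k"
  by (induction k) (auto simp: rho_add)

lemma of_nat_neq_0: "k > 0 \<Longrightarrow> (of_nat k :: 'f) \<noteq> 0"
proof
  assume k: "k > 0" "(of_nat k :: 'f) = 0"
  then have "\<rho> (of_nat k) = 0" by simp
  then have "(of_nat k :: ('n, 'k) mpol) \<in> P" unfolding rho_zero_iff .
  then have "mpol_const (1 / of_nat k) * (of_nat k :: ('n, 'k) mpol) \<in> P"
    by (rule prime_idealD(3)[OF prime])
  moreover have "mpol_const (1 / of_nat k) * (of_nat k :: ('n, 'k) mpol) = 1"
    using k by (simp add: mpol_const_def mult_single flip: single_of_nat)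
  ultimately show False using prime_idealD(4)[OF prime] by simp
qed

lemma of_nat_mfact_neq_0 [simp]: "(of_nat (mfact \<alpha>) :: 'f) \<noteq> 0"
  by (rule of_nat_neq_0[OF mfact_pos])

lemma taylor_add: "taylor C \<rho> (f + g) = taylor C \<rho> f + taylor C \<rho> g"
  by (rule mps_eqI) (simp add: taylor_def mderiv_add rho_add add_divide_distrib)

lemma taylor_zero: "taylor C \<rho> 0 = 0"
  by (rule mps_eqI) (simp add: taylor_def)

lemma taylor_sum: "taylor C \<rho> (sum f A) = (\<Sum>x\<in>A. taylor C \<rho> (f x))"
  by (induction A rule: infinite_finite_induct) (auto simp: taylor_add taylor_zero)

text \<open>The Leibniz rule, divided by \<open>\<alpha>!\<close>.\<close>

lemma taylor_mult: "taylor C \<rho> (f * g) = taylor C \<rho> f * taylor C \<rho> g"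
proof (rule mps_eqI)
  fix \<alpha> :: "'n multiindex"
  let ?c = "\<lambda>\<beta> h. \<rho> (mderiv \<beta> h) / of_nat (mfact \<beta>)"
  show "mps_coeff (taylor C \<rho> (f * g)) \<alpha> = mps_coeff (taylor C \<rho> f * taylor C \<rho> g) \<alpha>"
  proof (cases "keys \<alpha> \<subseteq> C")
    case True
    have "\<rho> (mderiv \<alpha> (f * g)) / of_nat (mfact \<alpha>) =
        (\<Sum>x\<in>splits \<alpha>. of_nat (mbinom \<alpha> (fst x)) * (\<rho> (mderiv (fst x) f) * \<rho> (mderiv (snd x) g)) /
          of_nat (mfact \<alpha>))"
      unfolding mderiv_mult case_prod_unfold rho_sum sum_divide_distrib rho_mult rho_of_nat ..
    also have "\<dots> = (\<Sum>x\<in>splits \<alpha>. ?c (fst x) f * ?c (snd x) g)"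
    proof (rule sum.cong)
      fix x assume "x \<in> splits \<alpha>"
      then have x: "\<alpha> = fst x + snd x" by (auto simp: splits_def)
      have "(of_nat (mbinom \<alpha> (fst x)) * (of_nat (mfact (fst x)) * of_nat (mfact (snd x))) :: 'f) =
          of_nat (mfact \<alpha>)"
        unfolding x by (metis mbinom_mfact of_nat_mult)
      then have "(of_nat (mbinom \<alpha> (fst x)) :: 'f) =
          of_nat (mfact \<alpha>) / (of_nat (mfact (fst x)) * of_nat (mfact (snd x)))"
        by (simp add: field_simps)
      then show "of_nat (mbinom \<alpha> (fst x)) * (\<rho> (mderiv (fst x) f) * \<rho> (mderiv (snd x) g)) /
          of_nat (mfact \<alpha>) = ?c (fst x) f * ?c (snd x) g"
        by simp
    qed simp
    also have "\<dots> = (\<Sum>x\<in>splits \<alpha>. mps_coeff (taylor C \<rho> f) (fst x) * mps_coeff (taylor C \<rho> g) (snd x))"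
      by (rule sum.cong) (use True in \<open>auto simp: taylor_def splits_def keys_plus_nat\<close>)
    finally show ?thesis using True by (simp add: taylor_def mps_coeff_mult case_prod_unfold)
  next
    case False
    have "(\<Sum>x\<in>splits \<alpha>. mps_coeff (taylor C \<rho> f) (fst x) * mps_coeff (taylor C \<rho> g) (snd x)) = 0"
      by (rule sum.neutral) (use False in \<open>auto simp: taylor_def splits_def keys_plus_nat\<close>)
    with False show ?thesis by (simp add: taylor_def mps_coeff_mult case_prod_unfold)
  qed
qed

lemma taylor_const: "taylor C \<rho> (mpol_const a) = mps_const (\<rho> (mpol_const a))"
  by (rule mps_eqI) (simp add: taylor_def mps_coeff_const)

lemma taylor_var:
  "taylor C \<rho> (mpol_var i) = (if i \<in> C then mps_var i else 0) + mps_const (\<rho> (mpol_var i))"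
proof (rule mps_eqI)
  fix \<alpha> :: "'n multiindex"
  let ?i = "Poly_Mapping.single i (1 :: nat)"
  have i0: "?i \<noteq> 0" using mdeg_single[of i 1] by (auto simp del: mdeg_single)
  consider "\<alpha> = 0" | "\<alpha> = ?i" | "\<alpha> \<noteq> 0" "\<alpha> \<noteq> ?i" by blast
  then show "mps_coeff (taylor C \<rho> (mpol_var i)) \<alpha> =
      mps_coeff ((if i \<in> C then mps_var i else 0) + mps_const (\<rho> (mpol_var i))) \<alpha>"
  proof cases
    case 1
    then show ?thesis by (simp add: taylor_def)
  next
    case 2
    have "mderiv ?i (mpol_var i :: ('n, 'k) mpol) = 1"
      unfolding mpol_var_def mderiv_var_single by simp
    moreover have "mfact ?i = 1"
      unfolding mfact_def by (rule prod.neutral) (auto simp: lookup_single when_def)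
    ultimately show ?thesis using i0 2
      by (simp add: taylor_def mps_coeff_var mps_coeff_const)
  next
    case 3
    have "mff ?i \<alpha> = 0"
    proof (rule ccontr)
      assume "mff ?i \<alpha> \<noteq> 0"
      then have le: "lookup \<alpha> j \<le> lookup ?i j" for j by (rule mff_le)
      have "\<alpha> = Poly_Mapping.single i (lookup \<alpha> i)"
      proof (rule poly_mapping_eqI)
        show "lookup \<alpha> j = lookup (Poly_Mapping.single i (lookup \<alpha> i)) j" for j
          using le[of j] by (auto simp: lookup_single when_def split: if_splits)
      qed
      moreover have "lookup \<alpha> i = 0 \<or> lookup \<alpha> i = 1" using le[of i] by auto
      ultimately show False using 3 by (metis single_zero)
    qed
    then have "mderiv \<alpha> (mpol_var i :: ('n, 'k) mpol) = 0"
      by (simp add: mpol_var_def mderiv_single)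
    with 3 show ?thesis by (simp add: taylor_def mps_coeff_var mps_coeff_const)
  qed
qed

text \<open>Both sides are ring homomorphisms that agree on constants and variables.\<close>

lemma eta_eq_taylor: "eta C \<rho> f = taylor C \<rho> f"
proof -
  have pw: "taylor C \<rho> (g ^ k) = taylor C \<rho> g ^ k" for g k
    using taylor_const[of 1] by (induction k) (auto simp: taylor_mult mpol_const_1)
  have pr: "taylor C \<rho> (\<Prod>i\<in>A. h i) = (\<Prod>i\<in>A. taylor C \<rho> (h i))" for A :: "'n set" and h
    using taylor_const[of 1]
    by (induction A rule: infinite_finite_induct) (auto simp: taylor_mult mpol_const_1)
  have "taylor C \<rho> f = taylor C \<rho> (\<Sum>\<alpha>\<in>keys f. Poly_Mapping.single \<alpha> (lookup f \<alpha>))"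
    by (simp flip: mpol_sum_monomials)
  also have "\<dots> = eta C \<rho> f"
    unfolding taylor_sum single_eq_const_times_vars taylor_mult pr pw taylor_const taylor_var eta_def ..
  finally show ?thesis ..
qed

lemma eta_coeff: "mps_coeff (eta C \<rho> f) \<alpha> =
    (if keys \<alpha> \<subseteq> C then \<rho> (mderiv \<alpha> f) / of_nat (mfact \<alpha>) else 0)"
  by (simp add: eta_eq_taylor taylor_def)

lemma eta_coeff_0 [simp]: "mps_coeff (eta C \<rho> f) 0 = \<rho> f"
  by (simp add: eta_coeff)

lemma eta_in [simp]: "eta C \<rho> f \<in> mps_in C"
  by (simp add: mps_in_coeff eta_coeff)

lemma eta_add: "eta C \<rho> (f + g) = eta C \<rho> f + eta C \<rho> g"
  and eta_mult: "eta C \<rho> (f * g) = eta C \<rho> f * eta C \<rho> g"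
  and eta_zero [simp]: "eta C \<rho> 0 = 0"
  and eta_sum: "eta C \<rho> (sum h A) = (\<Sum>x\<in>A. eta C \<rho> (h x))"
  and eta_const: "eta C \<rho> (mpol_const a) = mps_const (\<rho> (mpol_const a))"
  and eta_var:
    "eta C \<rho> (mpol_var i) = (if i \<in> C then mps_var i else 0) + mps_const (\<rho> (mpol_var i))"
  by (simp_all add: eta_eq_taylor taylor_add taylor_mult taylor_zero taylor_sum taylor_const taylor_var)

lemma eta_one [simp]: "eta C \<rho> 1 = 1"
  using eta_const[of 1] by (simp add: mpol_const_1)

lemma eta_uminus: "eta C \<rho> (- f) = - eta C \<rho> f"
proof -
  have "eta C \<rho> f + eta C \<rho> (- f) = 0" by (simp flip: eta_add)
  then show ?thesis by (rule minus_unique[symmetric])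
qed

lemma eta_diff: "eta C \<rho> (f - g) = eta C \<rho> f - eta C \<rho> g"
  using eta_add[of f "- g"] by (simp add: eta_uminus)

text \<open>The parameters \<open>x\<^sub>j\<close>, \<open>j \<notin> C\<close>, are sent to constants. Together with the next lemma, which says that they are
  algebraically independent in \<open>F\<close>, this allows polynomials in the parameters to be treated as scalars.\<close>

lemma eta_parameters:
  assumes "f \<in> mpol_in (- C)"
  shows "eta C \<rho> f = mps_const (\<rho> f)"
  using assms
  by (induction f rule: mpol_in_induct)
    (auto simp: eta_const eta_var eta_add eta_mult mps_const_add mps_const_mult rho_add rho_mult)

lemma rho_parameters_eq_0:
  assumes "f \<in> mpol_in (- C)" "\<rho> f = 0"
  shows "f = 0"
  using basis assms
  by (auto simp: basis_modulo_def independent_modulo_def rho_zero_iff)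

end

section \<open>Comparing the local ring with power series\<close>

lemma prime_ideal_prod:
  "prime_ideal P \<Longrightarrow> (\<And>x. x \<in> A \<Longrightarrow> f x \<notin> P) \<Longrightarrow> prod f A \<notin> P"
  by (induction A rule: infinite_finite_induct) (auto simp: prime_idealD)

text \<open>Finitely many fractions are brought to one denominator outside \<open>P\<close>; \<open>Q j a s\<close> is a relation that expresses that
  \<open>a / s\<close> solves the \<open>j\<close>-th problem, and is stable under expanding the fraction.\<close>

lemma common_denominator:
  fixes P :: "'a::comm_ring_1 set"
  assumes "prime_ideal P" "finite J"
    and ex: "\<And>j. j \<in> J \<Longrightarrow> \<exists>a s. s \<notin> P \<and> Q j a s"
    and scale: "\<And>j a s t. j \<in> J \<Longrightarrow> Q j a s \<Longrightarrow> Q j (t * a) (t * s)"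
  obtains a s where "s \<notin> P" "\<And>j. j \<in> J \<Longrightarrow> Q j (a j) s"
proof -
  from ex obtain b t where t: "\<And>j. j \<in> J \<Longrightarrow> t j \<notin> P \<and> Q j (b j) (t j)" by metis
  define s where "s = (\<Prod>j\<in>J. t j)"
  define a where "a j = (\<Prod>i\<in>J - {j}. t i) * b j" for j
  show ?thesis
  proof
    show "s \<notin> P" unfolding s_def by (rule prime_ideal_prod[OF assms(1)]) (use t in blast)
    fix j assume j: "j \<in> J"
    have "s = (\<Prod>i\<in>J - {j}. t i) * t j"
      unfolding s_def using j \<open>finite J\<close> by (simp add: prod.remove mult.commute)
    then show "Q j (a j) s" unfolding a_def using scale[OF j] t[OF j] by simp
  qed
qed

primrec ideal_power :: "'a::comm_ring_1 set \<Rightarrow> nat \<Rightarrow> 'a set" where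
  "ideal_power P 0 = UNIV"
| "ideal_power P (Suc m) =
    submodule_over UNIV (*) hull {p * q | p q. p \<in> P \<and> q \<in> ideal_power P m}"

lemma ideal_power_ideal: "submodule_over UNIV (*) (ideal_power P m)"
  by (cases m) (auto simp: submodule_over_hull, simp add: submodule_over_def)

lemma ideal_power_Suc: "p \<in> P \<Longrightarrow> q \<in> ideal_power P m \<Longrightarrow> p * q \<in> ideal_power P (Suc m)"
  by (auto intro!: hull_inc)

text \<open>In characteristic zero differentiation multiplies coefficients by nonzero numbers, so a term that contains
  \<open>x\<^sub>i\<close> is not killed by \<open>\<partial>\<^sub>i\<close>.\<close>

lemma constant_if_derivatives_vanish:
  fixes f :: "('n::finite, 'k::field_char_0) mpol"
  assumes "\<And>i. i \<in> D \<Longrightarrow> mderiv (Poly_Mapping.single i 1) f = 0"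
  shows "f \<in> mpol_in (- D)"
  unfolding mpol_in_def
proof (clarify)
  fix \<alpha> i assume a: "\<alpha> \<in> keys f" "i \<in> keys \<alpha>" "i \<in> D"
  have "\<alpha> = Poly_Mapping.single i 1 + (\<alpha> - Poly_Mapping.single i 1)"
    by (rule poly_mapping_eqI)
      (use a in \<open>auto simp: lookup_add lookup_minus lookup_single when_def in_keys_iff\<close>)
  then obtain \<beta> where b: "\<alpha> = Poly_Mapping.single i 1 + \<beta>" by blast
  have "mff (Poly_Mapping.single i 1 + \<beta>) (Poly_Mapping.single i 1) \<noteq> 0"
    using mff_add_mfact[of "Poly_Mapping.single i 1" \<beta>] mfact_pos[of "Poly_Mapping.single i 1 + \<beta>"]
    by (metis mult_0 less_irrefl)
  moreover have "lookup (mderiv (Poly_Mapping.single i 1) f) \<beta> = 0"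
    using assms[OF a(3)] by simp
  ultimately show False using a(1) unfolding b by (simp add: lookup_mderiv in_keys_iff)
qed

context residue_map
begin

lemma eta_unit:
  assumes "s \<notin> P"
  obtains u where "u \<in> mps_in C" "eta C \<rho> s * u = 1"
  using mps_inverse[of "eta C \<rho> s" C] assms by (auto simp: rho_zero_iff)

text \<open>The minimal polynomial of \<open>x\<^sub>i\<close> over the field generated by the parameters, with denominators
  cleared. Since the characteristic is zero, its derivative is a nonzero polynomial of smaller
  degree, so it is not in \<open>P\<close>.\<close>

lemma separable_equation:
  assumes i: "i \<in> C"
  obtains f where "f \<in> P" "f \<in> mpol_in (insert i (- C))" "mderiv (Poly_Mapping.single i 1) f \<notin> P"
proof -
  let ?T = "insert i (- C)" and ?i = "Poly_Mapping.single i (1 :: nat)"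
  let ?Q = "\<lambda>k. \<exists>f. f \<noteq> 0 \<and> f \<in> P \<and> f \<in> mpol_in ?T \<and> (\<forall>\<alpha>\<in>keys f. lookup \<alpha> i \<le> k)"
  have "- C \<subset> ?T" using i by auto
  then have "mpol_in ?T \<inter> P \<noteq> {0}"
    using basis by (auto simp: basis_modulo_def independent_modulo_def)
  moreover have "0 \<in> mpol_in ?T \<inter> P" by (simp add: mpol_in_def prime_idealD[OF prime])
  ultimately obtain f0 where f0: "f0 \<noteq> 0" "f0 \<in> P" "f0 \<in> mpol_in ?T" by blast
  have "?Q (\<Sum>\<alpha>\<in>keys f0. lookup \<alpha> i)"
    using f0 by (intro exI[of _ f0]) (auto intro: member_le_sum)
  then have Q: "?Q (LEAST k. ?Q k)" by (rule LeastI)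
  then obtain f where f: "f \<noteq> 0" "f \<in> P" "f \<in> mpol_in ?T"
    "\<forall>\<alpha>\<in>keys f. lookup \<alpha> i \<le> (LEAST k. ?Q k)" by blast
  have "mderiv ?i f \<notin> P"
  proof
    assume d: "mderiv ?i f \<in> P"
    show False
    proof (cases "mderiv ?i f = 0")
      case True
      then have "f \<in> mpol_in (- {i})" by (intro constant_if_derivatives_vanish) simp
      with f(3) have "f \<in> mpol_in (- C)" unfolding mpol_in_def by blast
      with f(1,2) show False using rho_parameters_eq_0 by (simp add: rho_zero_iff)
    next
      case False
      have less: "\<forall>\<beta>\<in>keys (mderiv ?i f). lookup \<beta> i < (LEAST k. ?Q k)"
      proof
        fix \<beta> assume "\<beta> \<in> keys (mderiv ?i f)"
        then have "?i + \<beta> \<in> keys f" by (auto simp: in_keys_iff lookup_mderiv)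
        then have "lookup (?i + \<beta>) i \<le> (LEAST k. ?Q k)" using f(4) by blast
        then show "lookup \<beta> i < (LEAST k. ?Q k)" by (simp add: lookup_add)
      qed
      obtain \<beta> where "\<beta> \<in> keys (mderiv ?i f)" using False by (metis all_not_in_conv keys_eq_empty)
      with less have pos: "0 < (LEAST k. ?Q k)" by fastforce
      have "?Q ((LEAST k. ?Q k) - 1)"
      proof (intro exI conjI)
        show "\<forall>\<alpha>\<in>keys (mderiv ?i f). lookup \<alpha> i \<le> (LEAST k. ?Q k) - 1"
          using less by fastforce
      qed (use False d f(3) in \<open>auto intro: mpol_in_mderiv\<close>)
      then have "(LEAST k. ?Q k) \<le> (LEAST k. ?Q k) - 1" by (rule Least_le)
      with pos show False by linarith
    qed
  qed
  then show ?thesis using f that by blast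
qed

text \<open>The \<open>F\<close>-span of \<open>\<eta>(I)\<close>. For \<open>I = R\<close> this is the subring of \<open>B\<close> in which the computations
  below take place; it contains \<open>F\<close> and the variables \<open>y\<^sub>i\<close>.\<close>

inductive_set eta_span :: "('n, 'k) mpol set \<Rightarrow> ('n, 'f) mps set" for I where
  base: "a \<in> I \<Longrightarrow> mps_const e * eta C \<rho> a \<in> eta_span I"
| add: "x \<in> eta_span I \<Longrightarrow> y \<in> eta_span I \<Longrightarrow> x + y \<in> eta_span I"

lemma eta_span_eta: "a \<in> I \<Longrightarrow> eta C \<rho> a \<in> eta_span I"
  using eta_span.base[of a I 1] by simp

lemma eta_span_zero: "submodule_over UNIV (*) I \<Longrightarrow> 0 \<in> eta_span I"
  using eta_span_eta[of 0 I] by (simp add: submodule_over_def)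

lemma eta_span_const: "mps_const e \<in> eta_span UNIV"
  using eta_span.base[of 1 UNIV e] by simp

lemma eta_span_sum:
  assumes "submodule_over UNIV (*) I" "\<And>x. x \<in> A \<Longrightarrow> f x \<in> eta_span I"
  shows "sum f A \<in> eta_span I"
  using assms(2) by (induction A rule: infinite_finite_induct)
    (auto simp: eta_span_zero[OF assms(1)] intro: eta_span.add)

lemma eta_span_mult_gen:
  assumes ab: "\<And>a b. a \<in> I \<Longrightarrow> b \<in> J \<Longrightarrow> a * b \<in> H"
  assumes "x \<in> eta_span I" "y \<in> eta_span J"
  shows "x * y \<in> eta_span H"
  using assms(2)
proof induction
  case (base a e)
  show ?case using assms(3)
  proof induction
    case b: (base b e')
    have "mps_const e * eta C \<rho> a * (mps_const e' * eta C \<rho> b) = mps_const (e * e') * eta C \<rho> (a * b)"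
      by (simp add: mps_const_mult eta_mult ac_simps)
    then show ?case using eta_span.base[OF ab[OF base b]] by metis
  next
    case (add x y)
    then show ?case by (simp add: distrib_left eta_span.add)
  qed
next
  case (add x y)
  then show ?case by (simp add: distrib_right eta_span.add)
qed

lemma eta_span_mult: "x \<in> eta_span UNIV \<Longrightarrow> y \<in> eta_span UNIV \<Longrightarrow> x * y \<in> eta_span UNIV"
  by (rule eta_span_mult_gen) auto

lemma eta_span_ideal:
  assumes "submodule_over UNIV (*) I" "x \<in> eta_span UNIV" "y \<in> eta_span I"
  shows "x * y \<in> eta_span I"
  by (rule eta_span_mult_gen[OF _ assms(2,3)]) (use submodule_overD(3)[OF assms(1)] in auto)

lemma submodule_over_UNIV: "submodule_over S smul UNIV"
  by (simp add: submodule_over_def)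

lemma eta_span_prod: "(\<And>x. x \<in> A \<Longrightarrow> f x \<in> eta_span UNIV) \<Longrightarrow> prod f A \<in> eta_span UNIV"
  using eta_span_const[of 1]
  by (induction A rule: infinite_finite_induct) (auto intro: eta_span_mult)

lemma eta_span_power: "x \<in> eta_span UNIV \<Longrightarrow> x ^ k \<in> eta_span UNIV"
  using eta_span_const[of 1] by (induction k) (auto intro: eta_span_mult)

lemma eta_span_normal_form:
  assumes "x \<in> eta_span I" "submodule_over UNIV (*) I"
  shows "\<exists>A a. finite A \<and> (\<forall>e. a e \<in> I) \<and> (\<forall>e. e \<notin> A \<longrightarrow> a e = 0) \<and>
    x = (\<Sum>e\<in>A. mps_const e * eta C \<rho> (a e))"
  using assms(1)
proof induction
  case (base a e)
  then show ?case using submodule_overD(1)[OF assms(2)]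
    by (intro exI[of _ "{e}"] exI[of _ "\<lambda>x. if x = e then a else 0"]) auto
next
  case (add x y)
  then obtain A a B b where *: "finite A" "\<forall>e. a e \<in> I" "\<forall>e. e \<notin> A \<longrightarrow> a e = 0"
    "x = (\<Sum>e\<in>A. mps_const e * eta C \<rho> (a e))" "finite B" "\<forall>e. b e \<in> I" "\<forall>e. e \<notin> B \<longrightarrow> b e = 0"
    "y = (\<Sum>e\<in>B. mps_const e * eta C \<rho> (b e))" by blast
  have "x = (\<Sum>e\<in>A \<union> B. mps_const e * eta C \<rho> (a e))"
    unfolding *(4) by (rule sum.mono_neutral_left) (use * in auto)
  moreover have "y = (\<Sum>e\<in>A \<union> B. mps_const e * eta C \<rho> (b e))"
    unfolding *(8) by (rule sum.mono_neutral_left) (use * in auto)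
  ultimately have "x + y = (\<Sum>e\<in>A \<union> B. mps_const e * eta C \<rho> (a e + b e))"
    by (simp add: eta_add distrib_left sum.distrib)
  then show ?case using * submodule_overD(2)[OF assms(2)]
    by (intro exI[of _ "A \<union> B"] exI[of _ "\<lambda>e. a e + b e"]) auto
qed

text \<open>The part of order one of the Taylor expansion, with coefficients that stay in the subring. The set \<open>D\<close> records
  that only those \<open>y\<^sub>i\<close> are needed whose \<open>x\<^sub>i\<close> occur in \<open>a\<close>; a singleton \<open>D\<close> produces the uniformizers below.\<close>

lemma eta_decomp:
  assumes "a \<in> mpol_in (- C \<union> D)" "D \<subseteq> C"
  shows "\<exists>g. (\<forall>i. g i \<in> eta_span UNIV) \<and>
    eta C \<rho> a = mps_const (\<rho> a) + (\<Sum>i\<in>D. mps_var i * g i)"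
  using assms(1)
proof (induction rule: mpol_in_induct)
  case (const a)
  then show ?case
    by (intro exI[of _ "\<lambda>_. 0"]) (simp add: eta_const eta_span_zero submodule_over_UNIV)
next
  case (var j)
  show ?case
  proof (cases "j \<in> D")
    case True
    then have "(\<Sum>i\<in>D. mps_var i * (if i = j then 1 else 0)) = (mps_var j :: ('n, 'f) mps)"
      by (simp add: if_distrib[of "\<lambda>x. _ * x"] cong: if_cong)
    then show ?thesis using True assms(2) eta_span_const[of 1]
      by (intro exI[of _ "\<lambda>i. if i = j then 1 else 0"])
        (auto simp: eta_var eta_span_zero submodule_over_UNIV)
  next
    case False
    then have "j \<notin> C" using var by auto
    then show ?thesis
      by (intro exI[of _ "\<lambda>_. 0"]) (simp add: eta_var eta_span_zero submodule_over_UNIV)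
  qed
next
  case (add a b)
  then obtain g h where *: "\<forall>i. g i \<in> eta_span UNIV" "\<forall>i. h i \<in> eta_span UNIV"
    "eta C \<rho> a = mps_const (\<rho> a) + (\<Sum>i\<in>D. mps_var i * g i)"
    "eta C \<rho> b = mps_const (\<rho> b) + (\<Sum>i\<in>D. mps_var i * h i)" by blast
  show ?case
    by (rule exI[of _ "\<lambda>i. g i + h i"])
      (use * in \<open>auto simp: eta_add rho_add mps_const_add distrib_left sum.distrib intro: eta_span.add\<close>)
next
  case (mult a b)
  then obtain g h where *: "\<forall>i. g i \<in> eta_span UNIV" "\<forall>i. h i \<in> eta_span UNIV"
    "eta C \<rho> a = mps_const (\<rho> a) + (\<Sum>i\<in>D. mps_var i * g i)"
    "eta C \<rho> b = mps_const (\<rho> b) + (\<Sum>i\<in>D. mps_var i * h i)" by blast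
  define k where "k i = eta C \<rho> a * h i + mps_const (\<rho> b) * g i" for i
  have "(\<Sum>i\<in>D. mps_var i * k i) =
      eta C \<rho> a * (\<Sum>i\<in>D. mps_var i * h i) + mps_const (\<rho> b) * (\<Sum>i\<in>D. mps_var i * g i)"
    by (simp add: k_def distrib_left sum.distrib sum_distrib_left ac_simps)
  also have "\<dots> = eta C \<rho> a * (eta C \<rho> b - mps_const (\<rho> b)) +
      mps_const (\<rho> b) * (eta C \<rho> a - mps_const (\<rho> a))"
    using *(3,4) by simp
  also have "\<dots> = eta C \<rho> (a * b) - mps_const (\<rho> (a * b))"
    by (simp add: eta_mult rho_mult mps_const_mult algebra_simps)
  finally have "eta C \<rho> (a * b) = mps_const (\<rho> (a * b)) + (\<Sum>i\<in>D. mps_var i * k i)" by simp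
  moreover have "k i \<in> eta_span UNIV" for i
    unfolding k_def using * by (intro eta_span.add eta_span_mult eta_span_const eta_span_eta) auto
  ultimately show ?case by blast
qed

lemma eta_span_decomp:
  assumes "t \<in> eta_span UNIV"
  shows "\<exists>g. (\<forall>i. g i \<in> eta_span UNIV) \<and>
    t = mps_const (mps_coeff t 0) + (\<Sum>i\<in>C. mps_var i * g i)"
  using assms
proof induction
  case (base a e)
  have "a \<in> mpol_in (- C \<union> C)" by simp
  from eta_decomp[OF this] obtain g where g: "\<forall>i. g i \<in> eta_span UNIV"
    "eta C \<rho> a = mps_const (\<rho> a) + (\<Sum>i\<in>C. mps_var i * g i)" by auto
  have "mps_const e * eta C \<rho> a =
      mps_const (e * \<rho> a) + (\<Sum>i\<in>C. mps_var i * (mps_const e * g i))"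
    unfolding g(2) by (simp add: mps_const_mult distrib_left sum_distrib_left mult.left_commute)
  then show ?case using g(1)
    by (intro exI[of _ "\<lambda>i. mps_const e * g i"]) (auto intro: eta_span_mult eta_span_const)
next
  case (add x y)
  then obtain g h where *: "\<forall>i. g i \<in> eta_span UNIV" "\<forall>i. h i \<in> eta_span UNIV"
    "x = mps_const (mps_coeff x 0) + (\<Sum>i\<in>C. mps_var i * g i)"
    "y = mps_const (mps_coeff y 0) + (\<Sum>i\<in>C. mps_var i * h i)" by blast
  have "x + y = mps_const (mps_coeff (x + y) 0) + (\<Sum>i\<in>C. mps_var i * (g i + h i))"
    by (subst *(3), subst *(4)) (simp add: mps_const_add distrib_left sum.distrib)
  then show ?case using *(1,2)
    by (intro exI[of _ "\<lambda>i. g i + h i"]) (auto intro: eta_span.add)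
qed

text \<open>The separable equation of \<open>x\<^sub>i\<close> is a uniformizer in the direction \<open>i\<close>: its image is \<open>y\<^sub>i\<close>
  times a unit, because the derivative does not vanish at the generic point.\<close>

lemma uniformizer:
  assumes i: "i \<in> C"
  obtains f u where "f \<in> P" "u \<in> eta_span UNIV" "mps_coeff u 0 \<noteq> 0" "eta C \<rho> f = mps_var i * u"
proof -
  let ?i = "Poly_Mapping.single i (1 :: nat)"
  obtain f where f: "f \<in> P" "f \<in> mpol_in (insert i (- C))" "mderiv ?i f \<notin> P"
    using separable_equation[OF i] .
  have "f \<in> mpol_in (- C \<union> {i})" using f(2) by simp
  from eta_decomp[OF this] i obtain g where g: "\<forall>i. g i \<in> eta_span UNIV"
    "eta C \<rho> f = mps_const (\<rho> f) + (\<Sum>i\<in>{i}. mps_var i * g i)" by auto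
  have "\<rho> f = 0" using f(1) by (simp add: rho_zero_iff)
  then have e: "eta C \<rho> f = mps_var i * g i" using g(2) by simp
  have "mps_coeff (mps_monom ?i * g i) (?i + 0) = mps_coeff (g i) 0"
    by (rule mps_coeff_monom_mult_add)
  then have "mps_coeff (g i) 0 = mps_coeff (eta C \<rho> f) ?i" by (simp add: e mps_var_monom)
  also have "\<dots> = \<rho> (mderiv ?i f) / of_nat (mfact ?i)" using i by (simp add: eta_coeff)
  finally have "mps_coeff (g i) 0 \<noteq> 0" using f(3) by (simp add: rho_zero_iff)
  then show ?thesis using that f(1) g(1) e by blast
qed

text \<open>The constant term of \<open>b\<close> is a fraction of classes. After clearing its denominator, the remainder of positive order is
  a combination of uniformizers, and induction applies to the coefficients.\<close>

lemma eta_approx: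
  assumes "b \<in> mps_in C"
  shows "\<exists>a s. s \<notin> P \<and> eta C \<rho> s * b - eta C \<rho> a \<in> mps_ord_ge m"
  using assms
proof (induction m arbitrary: b)
  case 0
  then show ?case using prime_idealD(4)[OF prime] by auto
next
  case (Suc m)
  obtain a0 s0 where s0: "s0 \<notin> P" "mps_coeff b 0 = \<rho> a0 / \<rho> s0" using rho_frac by blast
  then have "\<rho> s0 \<noteq> 0" by (simp add: rho_zero_iff)
  then have "eta C \<rho> s0 * b - eta C \<rho> a0 \<in> mps_ord_ge (Suc 0)" using s0 by (simp add: mps_ord_ge_1)
  moreover have "eta C \<rho> s0 * b - eta C \<rho> a0 \<in> mps_in C"
    using Suc.prems by (intro mps_in_diff mps_in_mult) auto
  ultimately obtain g where g: "\<And>i. i \<in> C \<Longrightarrow> g i \<in> mps_in C \<inter> mps_ord_ge 0"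
    "eta C \<rho> s0 * b - eta C \<rho> a0 = (\<Sum>i\<in>C. mps_var i * g i)"
    using mps_ord_ge_decomp by blast
  have "\<exists>f h. f \<in> P \<and> h \<in> mps_in C \<and> mps_var i * g i = eta C \<rho> f * h" if i: "i \<in> C" for i
  proof -
    obtain f u where f: "f \<in> P" "u \<in> eta_span UNIV" "mps_coeff u 0 \<noteq> 0" "eta C \<rho> f = mps_var i * u"
      using uniformizer[OF i] .
    have "u \<in> mps_in C" using f(2) by induction (auto intro!: mps_in_mult mps_in_add)
    then obtain v where "v \<in> mps_in C" "u * v = 1" using mps_inverse f(3) by blast
    then show ?thesis using f g(1)[OF i]
      by (intro exI[of _ f] exI[of _ "v * g i"]) (auto simp: mult.assoc[symmetric], simp add: mult.assoc)
  qed
  then obtain f h where fh: "\<And>i. i \<in> C \<Longrightarrow> f i \<in> P \<and> h i \<in> mps_in C \<and> mps_var i * g i = eta C \<rho> (f i) * h i"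
    by metis
  obtain a s where as: "s \<notin> P" "\<And>i. i \<in> C \<Longrightarrow> eta C \<rho> s * h i - eta C \<rho> (a i) \<in> mps_ord_ge m"
  proof (rule common_denominator[OF prime,
        of C "\<lambda>i a s. eta C \<rho> s * h i - eta C \<rho> a \<in> mps_ord_ge m"])
    show "\<exists>a s. s \<notin> P \<and> eta C \<rho> s * h i - eta C \<rho> a \<in> mps_ord_ge m" if "i \<in> C" for i
      using Suc.IH fh that by blast
    show "eta C \<rho> (t * s) * h i - eta C \<rho> (t * a) \<in> mps_ord_ge m"
      if "eta C \<rho> s * h i - eta C \<rho> a \<in> mps_ord_ge m" for i a s t
      using mps_ord_ge_mult_left[OF that, of "eta C \<rho> t"] by (simp add: eta_mult algebra_simps)
  qed auto
  have "eta C \<rho> (s * s0) * b - eta C \<rho> (s * a0 + (\<Sum>i\<in>C. f i * a i)) =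
      eta C \<rho> s * (eta C \<rho> s0 * b - eta C \<rho> a0) - (\<Sum>i\<in>C. eta C \<rho> (f i) * eta C \<rho> (a i))"
    by (simp add: eta_mult eta_add eta_sum algebra_simps)
  also have "\<dots> = (\<Sum>i\<in>C. eta C \<rho> (f i) * (eta C \<rho> s * h i - eta C \<rho> (a i)))"
    unfolding g(2) sum_distrib_left sum_subtractf[symmetric] using fh
    by (intro sum.cong) (auto simp: right_diff_distrib mult.left_commute)
  also have "\<dots> \<in> mps_ord_ge (Suc m)"
  proof -
    have "eta C \<rho> (f i) * (eta C \<rho> s * h i - eta C \<rho> (a i)) \<in> mps_ord_ge (Suc m)" if "i \<in> C" for i
      using mps_ord_ge_mult[of "eta C \<rho> (f i)" "Suc 0" _ m] as(2)[OF that] fh[OF that]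
      by (auto simp: mps_ord_ge_1 rho_zero_iff)
    then show ?thesis
      by (intro submodule_over_sum[of UNIV "(*)"])
        (auto simp: submodule_over_def mps_ord_ge_add mps_ord_ge_mult_left)
  qed
  finally show ?case using as(1) s0(1) prime_idealD(5)[OF prime] by blast
qed

text \<open>Filtration of the subring \<open>eta_span UNIV\<close> by powers of the \<open>y\<^sub>i\<close>, with all coefficients kept
  inside the subring.\<close>

primrec span_filtration :: "nat \<Rightarrow> ('n, 'f) mps set" where
  "span_filtration 0 = eta_span UNIV"
| "span_filtration (Suc m) = {\<Sum>i\<in>C. mps_var i * g i | g. \<forall>i. g i \<in> span_filtration m}"

lemma span_filtration_ord: "span_filtration m \<subseteq> mps_ord_ge m"
proof (induction m)
  case (Suc m)
  show ?case
  proof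
    fix x assume "x \<in> span_filtration (Suc m)"
    then obtain g where g: "x = (\<Sum>i\<in>C. mps_var i * g i)" "\<forall>i. g i \<in> span_filtration m" by auto
    have "mps_var i * g i \<in> mps_ord_ge (Suc m)" for i
      using mps_ord_ge_mult[OF mps_ord_ge_var[of i], of "g i" m] g(2) Suc by auto
    then show "x \<in> mps_ord_ge (Suc m)" unfolding g(1)
      by (intro submodule_over_sum[of UNIV "(*)"])
        (auto simp: submodule_over_def mps_ord_ge_add mps_ord_ge_mult_left)
  qed
qed simp

lemma span_filtration_expand:
  assumes "t \<in> eta_span UNIV"
  shows "\<exists>q r. t = q + r \<and> r \<in> span_filtration m \<and> (\<forall>\<alpha>. m \<le> mdeg \<alpha> \<longrightarrow> mps_coeff q \<alpha> = 0)"
  using assms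
proof (induction m arbitrary: t)
  case 0
  then show ?case by (intro exI[of _ 0] exI[of _ t]) auto
next
  case (Suc m)
  obtain g where g: "\<forall>i. g i \<in> eta_span UNIV"
    "t = mps_const (mps_coeff t 0) + (\<Sum>i\<in>C. mps_var i * g i)"
    using eta_span_decomp[OF Suc.prems] by blast
  have "\<forall>i. \<exists>q r. g i = q + r \<and> r \<in> span_filtration m \<and> (\<forall>\<alpha>. m \<le> mdeg \<alpha> \<longrightarrow> mps_coeff q \<alpha> = 0)"
    using Suc.IH g(1) by blast
  then obtain q r where qr: "\<And>i. g i = q i + r i" "\<And>i. r i \<in> span_filtration m"
    "\<And>i \<alpha>. m \<le> mdeg \<alpha> \<Longrightarrow> mps_coeff (q i) \<alpha> = 0" by metis
  define q' where "q' = mps_const (mps_coeff t 0) + (\<Sum>i\<in>C. mps_var i * q i)"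
  have "t = q' + (\<Sum>i\<in>C. mps_var i * r i)"
    by (subst g(2)) (simp add: q'_def qr(1) distrib_left sum.distrib)
  moreover have "(\<Sum>i\<in>C. mps_var i * r i) \<in> span_filtration (Suc m)" using qr(2) by auto
  moreover have "mps_coeff q' \<alpha> = 0" if "Suc m \<le> mdeg \<alpha>" for \<alpha>
  proof -
    have "mps_coeff (mps_monom (Poly_Mapping.single i 1) * q i) \<alpha> = 0" for i
    proof (cases "\<exists>\<gamma>. \<alpha> = Poly_Mapping.single i 1 + \<gamma>")
      case True
      then obtain \<gamma> where "\<alpha> = Poly_Mapping.single i 1 + \<gamma>" by blast
      then show ?thesis using that by (simp only: mps_coeff_monom_mult_add) (simp add: qr(3))
    next
      case False
      then show ?thesis by (intro mps_coeff_monom_mult_0) auto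
    qed
    then show ?thesis using that by (auto simp: q'_def mps_var_monom mps_coeff_const)
  qed
  ultimately show ?case by blast
qed

text \<open>Expanding \<open>t\<close> up to order \<open>m\<close> within the subring leaves a polynomial part of degree less than \<open>m\<close>, which must
  vanish.\<close>

lemma span_filtration_of_ord:
  assumes "t \<in> eta_span UNIV" "t \<in> mps_ord_ge m"
  shows "t \<in> span_filtration m"
proof -
  obtain q r where q: "t = q + r" "r \<in> span_filtration m"
    "\<And>\<alpha>. m \<le> mdeg \<alpha> \<Longrightarrow> mps_coeff q \<alpha> = 0"
    using span_filtration_expand[OF assms(1)] by blast
  have "q = 0"
  proof (rule mps_eqI)
    fix \<alpha>
    have "mdeg \<alpha> < m \<Longrightarrow> mps_coeff t \<alpha> = 0 \<and> mps_coeff r \<alpha> = 0"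
      using assms(2) span_filtration_ord q(2) by (fastforce simp: mps_ord_ge_def)
    then show "mps_coeff q \<alpha> = mps_coeff 0 \<alpha>"
      using q(1) q(3)[of \<alpha>] by (cases "m \<le> mdeg \<alpha>") auto
  qed
  then show ?thesis using q by simp
qed

text \<open>With \<open>f\<^sub>i \<in> P\<close> and \<open>\<eta> f\<^sub>i = y\<^sub>i u\<^sub>i\<close>, the product \<open>w\<close> of all \<open>u\<^sub>i\<close> satisfies \<open>w y\<^sub>i \<in> \<eta>(P) T\<close>, where \<open>T\<close> is the
  subring. Hence \<open>w\<^sup>m\<close> turns the \<open>m\<close>-th step of the filtration into combinations of elements of \<open>P\<^sup>m\<close>.\<close>

lemma span_filtration_ideal_power:
  obtains w where "w \<in> eta_span UNIV" "mps_coeff w 0 \<noteq> 0"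
    "\<And>m t. t \<in> span_filtration m \<Longrightarrow> w ^ m * t \<in> eta_span (ideal_power P m)"
proof -
  have "\<forall>i\<in>C. \<exists>f u. f \<in> P \<and> u \<in> eta_span UNIV \<and> mps_coeff u 0 \<noteq> 0 \<and> eta C \<rho> f = mps_var i * u"
    by (meson uniformizer)
  then obtain f u where fu: "\<And>i. i \<in> C \<Longrightarrow> f i \<in> P" "\<And>i. i \<in> C \<Longrightarrow> u i \<in> eta_span UNIV"
    "\<And>i. i \<in> C \<Longrightarrow> mps_coeff (u i) 0 \<noteq> 0" "\<And>i. i \<in> C \<Longrightarrow> eta C \<rho> (f i) = mps_var i * u i"
    by metis
  define w where "w = (\<Prod>i\<in>C. u i)"
  have w: "w ^ m * t \<in> eta_span (ideal_power P m)" if "t \<in> span_filtration m" for m t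
    using that
  proof (induction m arbitrary: t)
    case (Suc m)
    then obtain g where g: "t = (\<Sum>i\<in>C. mps_var i * g i)" "\<forall>i. g i \<in> span_filtration m" by auto
    have "w ^ Suc m * (mps_var i * g i) \<in> eta_span (ideal_power P (Suc m))" if i: "i \<in> C" for i
    proof -
      have "w = u i * (\<Prod>j\<in>C - {i}. u j)" unfolding w_def using i by (simp add: prod.remove)
      then have "w ^ Suc m * (mps_var i * g i) =
          (\<Prod>j\<in>C - {i}. u j) * (eta C \<rho> (f i) * (w ^ m * g i))"
        using fu(4)[OF i] by (simp add: ac_simps)
      moreover have "eta C \<rho> (f i) * (w ^ m * g i) \<in> eta_span (ideal_power P (Suc m))"
        using fu(1)[OF i] Suc.IH g(2)
        by (intro eta_span_mult_gen[OF ideal_power_Suc]) (auto intro: eta_span_eta)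
      ultimately show ?thesis using fu(2)
        by (auto intro!: eta_span_ideal[OF ideal_power_ideal] eta_span_prod simp del: ideal_power.simps)
    qed
    then show ?case unfolding g(1) sum_distrib_left
      by (rule eta_span_sum[OF ideal_power_ideal])
  qed simp
  have "mps_coeff w 0 \<noteq> 0" using fu(3) by (simp add: w_def)
  moreover have "w \<in> eta_span UNIV" unfolding w_def by (rule eta_span_prod) (rule fu(2))
  ultimately show ?thesis using that w by blast
qed

text \<open>A relation \<open>w \<eta>(g) \<in> \<Sum> e \<eta>(I)\<close> with coefficients \<open>e \<in> F\<close> and \<open>w = \<Sum> e \<eta>(s e)\<close> of nonzero constant term descends to
  a relation \<open>h g \<in> I\<close> over \<open>R\<close>. If the scalars \<open>e\<close> were independent over the field of the parameters, all differences
  \<open>c e\<close> would vanish, and any \<open>s e \<notin> P\<close> would serve as \<open>h\<close>. In general, if some \<open>c e\<close> is nonzero, apply a derivative of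
  maximal order that does not kill all of them: the results are polynomials in the parameters and form a dependency of
  the \<open>e\<close>, by which one scalar is eliminated. The reduction preserves the hypotheses, since it multiplies \<open>w\<close> by a
  nonzero scalar. In effect this is the faithful flatness of \<open>F[y]\<close> over the polynomial ring with inverted
  parameters.\<close>

lemma descent:
  assumes I: "submodule_over UNIV (*) I"
    and "finite A"
    and "\<And>e. e \<in> A \<Longrightarrow> s e * g - c e \<in> I"
    and "(\<Sum>e\<in>A. mps_const e * eta C \<rho> (c e)) = 0"
    and "(\<Sum>e\<in>A. e * \<rho> (s e)) \<noteq> 0"
  shows "\<exists>h. h \<notin> P \<and> h * g \<in> I"
  using assms(2-)
proof (induction "card A" arbitrary: A s c rule: less_induct)
  case less
  note fin = less.prems(1) and I' = less.prems(2) and zero = less.prems(3) and nz = less.prems(4)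
  show ?case
  proof (cases "\<forall>e\<in>A. c e = 0")
    case True
    obtain e where "e \<in> A" "e * \<rho> (s e) \<noteq> 0"
      using nz by (rule sum.not_neutral_contains_not_neutral)
    then show ?thesis using I'[of e] True by (auto simp: rho_zero_iff)
  next
    case False
    define Al where "Al = {\<alpha>. keys \<alpha> \<subseteq> C \<and> (\<exists>e\<in>A. mderiv \<alpha> (c e) \<noteq> 0)}"
    have "finite Al"
    proof (rule finite_subset)
      show "Al \<subseteq> (\<Union>e\<in>A. {\<alpha>. mderiv \<alpha> (c e) \<noteq> 0})" by (auto simp: Al_def)
    qed (use fin in simp)
    moreover have "0 \<in> Al" using False by (auto simp: Al_def)
    ultimately have "Max (mdeg ` Al) \<in> mdeg ` Al" by (intro Max_in) auto
    moreover have "\<And>\<beta>. \<beta> \<in> Al \<Longrightarrow> mdeg \<beta> \<le> Max (mdeg ` Al)"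
      using \<open>finite Al\<close> by simp
    ultimately obtain \<alpha> where al: "\<alpha> \<in> Al" "\<And>\<beta>. \<beta> \<in> Al \<Longrightarrow> mdeg \<beta> \<le> mdeg \<alpha>" by auto
    define d where "d e = mderiv \<alpha> (c e)" for e
    have d_in: "d e \<in> mpol_in (- C)" if "e \<in> A" for e
    proof (rule constant_if_derivatives_vanish)
      fix i assume "i \<in> C"
      then have "Poly_Mapping.single i 1 + \<alpha> \<notin> Al"
        using al(2)[of "Poly_Mapping.single i 1 + \<alpha>"] by auto
      with \<open>i \<in> C\<close> al(1) that show "mderiv (Poly_Mapping.single i 1) (d e) = 0"
        by (auto simp: Al_def d_def mderiv_mderiv[symmetric] keys_plus_nat)
    qed
    have rel: "(\<Sum>e\<in>A. e * \<rho> (d e)) = 0"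
    proof -
      have "(\<Sum>e\<in>A. e * \<rho> (d e)) / of_nat (mfact \<alpha>) =
          mps_coeff (\<Sum>e\<in>A. mps_const e * eta C \<rho> (c e)) \<alpha>"
        using al(1) by (simp add: eta_coeff Al_def d_def sum_divide_distrib)
      then show ?thesis by (simp add: zero)
    qed
    obtain e0 where e0: "e0 \<in> A" "d e0 \<noteq> 0" using al(1) by (auto simp: Al_def d_def)
    then have rho_e0: "\<rho> (d e0) \<noteq> 0" using rho_parameters_eq_0 d_in by blast
    define s' where "s' e = d e0 * s e - d e * s e0" for e
    define c' where "c' e = d e0 * c e - d e * c e0" for e
    have drop: "(\<Sum>e\<in>A - {e0}. F e) = (\<Sum>e\<in>A. F e)" if "F e0 = 0" for F :: "'f \<Rightarrow> 'x::comm_monoid_add"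
      using sum.remove[OF fin e0(1), of F] that by simp
    show ?thesis
    proof (rule less.hyps)
      show "card (A - {e0}) < card A" using fin e0(1) by (rule card_Diff1_less)
      show "finite (A - {e0})" using fin by simp
    next
      fix e assume e: "e \<in> A - {e0}"
      have "s' e * g - c' e = d e0 * (s e * g - c e) + (- d e) * (s e0 * g - c e0)"
        by (simp add: s'_def c'_def algebra_simps)
      moreover have "d e0 * (s e * g - c e) \<in> I" "(- d e) * (s e0 * g - c e0) \<in> I"
        using e e0(1) I' submodule_overD(3)[OF I] by blast+
      ultimately show "s' e * g - c' e \<in> I" using submodule_overD(2)[OF I] by metis
    next
      have "(\<Sum>e\<in>A. mps_const e * eta C \<rho> (c' e)) =
          eta C \<rho> (d e0) * (\<Sum>e\<in>A. mps_const e * eta C \<rho> (c e)) -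
          (\<Sum>e\<in>A. mps_const e * eta C \<rho> (d e)) * eta C \<rho> (c e0)"
        unfolding c'_def eta_diff eta_mult
        by (simp add: right_diff_distrib sum_subtractf sum_distrib_left sum_distrib_right ac_simps)
      also have "(\<Sum>e\<in>A. mps_const e * eta C \<rho> (d e)) = mps_const (\<Sum>e\<in>A. e * \<rho> (d e))"
        unfolding mps_const_sum by (rule sum.cong) (auto simp: eta_parameters[OF d_in] mps_const_mult)
      finally show "(\<Sum>e\<in>A - {e0}. mps_const e * eta C \<rho> (c' e)) = 0"
        by (subst drop) (simp_all add: zero rel c'_def)
    next
      have "(\<Sum>e\<in>A. e * \<rho> (s' e)) =
          \<rho> (d e0) * (\<Sum>e\<in>A. e * \<rho> (s e)) - (\<Sum>e\<in>A. e * \<rho> (d e)) * \<rho> (s e0)"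
        unfolding s'_def rho_diff rho_mult
        by (simp add: right_diff_distrib sum_subtractf sum_distrib_left sum_distrib_right ac_simps)
      then show "(\<Sum>e\<in>A - {e0}. e * \<rho> (s' e)) \<noteq> 0"
        by (subst drop) (simp_all add: rel nz rho_e0 s'_def)
    qed
  qed
qed

text \<open>Injectivity of \<open>R\<^sub>P / P\<^sup>m R\<^sub>P \<rightarrow> B / n\<^sup>m\<close>; together with \<open>eta_approx\<close> this makes the two rings isomorphic.\<close>

lemma eta_ord_ge_imp_ideal_power:
  assumes "eta C \<rho> g \<in> mps_ord_ge m"
  shows "\<exists>h. h \<notin> P \<and> h * g \<in> ideal_power P m"
proof -
  obtain w where w: "w \<in> eta_span UNIV" "mps_coeff w 0 \<noteq> 0"
    "\<And>m t. t \<in> span_filtration m \<Longrightarrow> w ^ m * t \<in> eta_span (ideal_power P m)"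
    by (rule span_filtration_ideal_power) blast
  have "w ^ m * eta C \<rho> g \<in> eta_span (ideal_power P m)"
    by (intro w(3) span_filtration_of_ord eta_span_eta assms) simp
  from eta_span_normal_form[OF this ideal_power_ideal]
  obtain A b where b: "finite A" "\<forall>e. b e \<in> ideal_power P m" "\<forall>e. e \<notin> A \<longrightarrow> b e = 0"
    "w ^ m * eta C \<rho> g = (\<Sum>e\<in>A. mps_const e * eta C \<rho> (b e))" by blast
  obtain A' s where s: "finite A'" "\<forall>e. e \<notin> A' \<longrightarrow> s e = 0"
    "w ^ m = (\<Sum>e\<in>A'. mps_const e * eta C \<rho> (s e))"
    using eta_span_normal_form[OF eta_span_power[OF w(1)] submodule_over_UNIV] by blast
  let ?A = "A \<union> A'"
  have b': "w ^ m * eta C \<rho> g = (\<Sum>e\<in>?A. mps_const e * eta C \<rho> (b e))"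
    unfolding b(4) by (rule sum.mono_neutral_left) (use b s in auto)
  have s': "w ^ m = (\<Sum>e\<in>?A. mps_const e * eta C \<rho> (s e))"
    unfolding s(3) by (rule sum.mono_neutral_left) (use b s in auto)
  show ?thesis
  proof (rule descent[OF ideal_power_ideal])
    show "finite ?A" using b s by simp
    show "s e * g - (s e * g - b e) \<in> ideal_power P m" for e using b(2) by simp
    show "(\<Sum>e\<in>?A. mps_const e * eta C \<rho> (s e * g - b e)) = 0"
      using b' unfolding s' by (simp add: eta_diff eta_mult right_diff_distrib sum_subtractf
          sum_distrib_right mult.assoc)
    have "(\<Sum>e\<in>?A. e * \<rho> (s e)) = mps_coeff (w ^ m) 0" unfolding s' by simp
    then show "(\<Sum>e\<in>?A. e * \<rho> (s e)) \<noteq> 0" using w(2) by simp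
  qed
qed

end

section \<open>Extension to and contraction from power series\<close>

text \<open>Submodules that are determined by their localization at \<open>P\<close>.\<close>

definition saturated :: "'a::comm_ring_1 set \<Rightarrow> ('a \<Rightarrow> 'b \<Rightarrow> 'b) \<Rightarrow> 'b::ab_group_add set \<Rightarrow> bool" where
  "saturated P smul N \<longleftrightarrow>
    submodule_over UNIV smul N \<and> (\<forall>s w. s \<notin> P \<longrightarrow> smul s w \<in> N \<longrightarrow> w \<in> N)"

lemma saturatedD:
  assumes "saturated P smul N"
  shows "0 \<in> N" "x \<in> N \<Longrightarrow> y \<in> N \<Longrightarrow> x + y \<in> N" "x \<in> N \<Longrightarrow> smul a x \<in> N"
    "s \<notin> P \<Longrightarrow> smul s x \<in> N \<Longrightarrow> x \<in> N" "submodule_over UNIV smul N"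
proof -
  have s: "submodule_over UNIV smul N" and t: "\<forall>s w. s \<notin> P \<longrightarrow> smul s w \<in> N \<longrightarrow> w \<in> N"
    using assms by (simp_all add: saturated_def)
  show "0 \<in> N" "x \<in> N \<Longrightarrow> y \<in> N \<Longrightarrow> x + y \<in> N" "submodule_over UNIV smul N"
    by (fact submodule_overD(1,2)[OF s] s)+
  show "x \<in> N \<Longrightarrow> smul a x \<in> N" by (rule submodule_overD(3)[OF s]) simp_all
  show "s \<notin> P \<Longrightarrow> smul s x \<in> N \<Longrightarrow> x \<in> N" by (rule t[rule_format])
qed

lemma module_vec: "module ((*s) :: 'a::comm_ring_1 \<Rightarrow> 'a ^ 'r \<Rightarrow> 'a ^ 'r)"
  by unfold_locales (auto simp: vec_eq_iff algebra_simps)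

context residue_map
begin

lemma gamma_add: "gamma C \<rho> (v + w) = gamma C \<rho> v + gamma C \<rho> w"
  and gamma_diff: "gamma C \<rho> (v - w) = gamma C \<rho> v - gamma C \<rho> w"
  and gamma_scale: "gamma C \<rho> (a *s v) = eta C \<rho> a *s gamma C \<rho> v"
  and gamma_zero [simp]: "gamma C \<rho> 0 = 0"
  by (simp_all add: gamma_def vec_eq_iff eta_add eta_diff eta_mult)

lemma gamma_in [simp]: "gamma C \<rho> v \<in> vec_in (mps_in C)"
  by (simp add: gamma_def vec_in_def)

lemma extend_mod_power_eq: "extend_mod_power C \<rho> m N =
    {u + v | u v. u \<in> submodule_over (mps_in C) (*s) hull (gamma C \<rho> ` N) \<and>
      v \<in> vec_in (mps_in C) \<inter> vec_ord_ge m}"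
  by (simp add: extend_mod_power_def max_ideal_power_vec_eq)

lemma extend_submodule: "submodule_over (mps_in C) (*s) (extend_mod_power C \<rho> m N)"
  unfolding extend_mod_power_eq
  by (rule submodule_over_plus[OF submodule_over_hull vec_ord_ge_submodule])
    (simp add: vec_eq_iff distrib_left)

lemma extend_contains_gamma:
  fixes N :: "(('n, 'k) mpol ^ 'r::finite) set"
  shows "gamma C \<rho> ` N \<subseteq> extend_mod_power C \<rho> m N"
proof
  fix u assume "u \<in> gamma C \<rho> ` N"
  then have "u \<in> submodule_over (mps_in C) (*s) hull (gamma C \<rho> ` N)" by (rule hull_inc)
  moreover have "0 \<in> vec_in (mps_in C) \<inter> (vec_ord_ge m :: (('n, 'f) mps ^ 'r) set)"
    using vec_ord_ge_submodule by (rule submodule_overD(1))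
  ultimately show "u \<in> extend_mod_power C \<rho> m N"
    unfolding extend_mod_power_eq by force
qed

lemma extend_contains_ord:
  fixes N :: "(('n, 'k) mpol ^ 'r::finite) set"
  shows "vec_in (mps_in C) \<inter> vec_ord_ge m \<subseteq> extend_mod_power C \<rho> m N"
proof
  fix v :: "('n, 'f) mps ^ 'r" assume "v \<in> vec_in (mps_in C) \<inter> vec_ord_ge m"
  moreover have "0 \<in> submodule_over (mps_in C) (*s) hull (gamma C \<rho> ` N)"
    using submodule_over_hull by (rule submodule_overD(1))
  ultimately show "v \<in> extend_mod_power C \<rho> m N"
    unfolding extend_mod_power_eq by force
qed

lemma extend_least:
  assumes "submodule_over (mps_in C) (*s) V" "gamma C \<rho> ` N \<subseteq> V"
    "vec_in (mps_in C) \<inter> vec_ord_ge m \<subseteq> V"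
  shows "extend_mod_power C \<rho> m N \<subseteq> V"
proof -
  have "submodule_over (mps_in C) (*s) hull (gamma C \<rho> ` N) \<subseteq> V"
    using assms(2,1) by (rule hull_minimal)
  then show ?thesis unfolding extend_mod_power_eq
    using submodule_overD(2)[OF assms(1)] assms(3) by blast
qed

lemma extend_subset: "extend_mod_power C \<rho> m N \<subseteq> vec_in (mps_in C)"
  by (rule extend_least[OF vec_in_submodule]) auto

lemma extend_mono: "N \<subseteq> N' \<Longrightarrow> extend_mod_power C \<rho> m N \<subseteq> extend_mod_power C \<rho> m N'"
  by (rule extend_least[OF extend_submodule _ extend_contains_ord])
    (use extend_contains_gamma in blast)

text \<open>Elements outside \<open>P\<close> become units of \<open>B\<close>.\<close>

lemma contraction_saturated:
  assumes "submodule_over (mps_in C) (*s) V"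
  shows "saturated P (*s) (gamma C \<rho> -` V)"
proof -
  have "w \<in> gamma C \<rho> -` V" if sw: "s \<notin> P" "s *s w \<in> gamma C \<rho> -` V" for s w
  proof -
    obtain u where u: "u \<in> mps_in C" "eta C \<rho> s * u = 1" using eta_unit[OF sw(1)] .
    have "eta C \<rho> s *s gamma C \<rho> w \<in> V" using sw(2) by (simp add: gamma_scale)
    then have "u *s (eta C \<rho> s *s gamma C \<rho> w) \<in> V" by (rule submodule_overD(3)[OF assms u(1)])
    moreover have "u *s (eta C \<rho> s *s gamma C \<rho> w) = gamma C \<rho> w"
      using u(2) by (simp add: vector_smult_assoc mult.commute)
    ultimately show ?thesis by simp
  qed
  then show ?thesis using submodule_overD[OF assms]
    by (auto simp: saturated_def submodule_over_def gamma_add gamma_scale)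
qed

lemma vec_ord_ge_add: "v \<in> vec_ord_ge m \<Longrightarrow> w \<in> vec_ord_ge m \<Longrightarrow> v + w \<in> vec_ord_ge m"
  and vec_ord_ge_scale: "v \<in> vec_ord_ge m \<Longrightarrow> b *s v \<in> vec_ord_ge m"
  and vec_ord_ge_scale_left: "b \<in> mps_ord_ge m \<Longrightarrow> b *s v \<in> vec_ord_ge m"
  by (auto simp: vec_ord_ge_def vec_in_def mps_ord_ge_add mps_ord_ge_mult_left mps_ord_ge_mult_right)

lemma vec_in_scale: "b \<in> mps_in C \<Longrightarrow> v \<in> vec_in (mps_in C) \<Longrightarrow> b *s v \<in> vec_in (mps_in C)"
  by (rule submodule_overD(3)[OF vec_in_submodule])

lemma gamma_approx:
  fixes v :: "('n, 'f) mps ^ 'r::finite"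
  assumes "v \<in> vec_in (mps_in C)"
  shows "\<exists>w s. s \<notin> P \<and> eta C \<rho> s *s v - gamma C \<rho> w \<in> vec_ord_ge m"
proof -
  obtain a s where as: "s \<notin> P"
    "\<And>j. j \<in> (UNIV :: 'r set) \<Longrightarrow> eta C \<rho> s * v $ j - eta C \<rho> (a j) \<in> mps_ord_ge m"
  proof (rule common_denominator[OF prime,
        of "UNIV :: 'r set" "\<lambda>j a s. eta C \<rho> s * v $ j - eta C \<rho> a \<in> mps_ord_ge m"])
    show "\<exists>a s. s \<notin> P \<and> eta C \<rho> s * v $ j - eta C \<rho> a \<in> mps_ord_ge m" for j
      using assms by (intro eta_approx) (simp add: vec_in_def)
    show "eta C \<rho> (t * s) * v $ j - eta C \<rho> (t * a) \<in> mps_ord_ge m"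
      if "eta C \<rho> s * v $ j - eta C \<rho> a \<in> mps_ord_ge m" for j a s t
      using mps_ord_ge_mult_left[OF that, of "eta C \<rho> t"] by (simp add: eta_mult algebra_simps)
  qed auto
  then show ?thesis
    by (intro exI[of _ "\<chi> j. a j"] exI[of _ s]) (auto simp: vec_ord_ge_def vec_in_def gamma_def)
qed

text \<open>Surjectivity of \<open>R\<^sub>P \<rightarrow> B / n\<^sup>m\<close>: up to order \<open>m\<close> an element of \<open>V\<close> is a fraction, whose numerator then lies in the
  contraction of \<open>V\<close>.\<close>

lemma extend_contraction:
  fixes V :: "(('n, 'f) mps ^ 'r::finite) set"
  assumes V: "submodule_over (mps_in C) (*s) V" "V \<subseteq> vec_in (mps_in C)"
    "vec_in (mps_in C) \<inter> vec_ord_ge m \<subseteq> V"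
  shows "extend_mod_power C \<rho> m (gamma C \<rho> -` V) = V"
proof
  show "extend_mod_power C \<rho> m (gamma C \<rho> -` V) \<subseteq> V"
    by (rule extend_least[OF V(1) _ V(3)]) auto
  show "V \<subseteq> extend_mod_power C \<rho> m (gamma C \<rho> -` V)" (is "_ \<subseteq> ?E")
  proof
    fix v assume v: "v \<in> V"
    then have v_in: "v \<in> vec_in (mps_in C)" using V(2) by blast
    obtain w s where ws: "s \<notin> P" "eta C \<rho> s *s v - gamma C \<rho> w \<in> vec_ord_ge m"
      using gamma_approx[OF v_in] by blast
    let ?d = "eta C \<rho> s *s v - gamma C \<rho> w"
    have "?d \<in> vec_in (mps_in C)"
      by (rule mps_submodule_diff[OF vec_in_submodule]) (simp_all add: vec_in_scale v_in)
    with ws have d: "?d \<in> vec_in (mps_in C) \<inter> vec_ord_ge m" by blast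
    have "eta C \<rho> s *s v - ?d \<in> V"
    proof (rule mps_submodule_diff[OF V(1)])
      show "eta C \<rho> s *s v \<in> V" by (rule submodule_overD(3)[OF V(1) _ v]) simp
      show "?d \<in> V" using d V(3) by blast
    qed
    then have "gamma C \<rho> w \<in> ?E" using extend_contains_gamma[of "gamma C \<rho> -` V" m] by auto
    moreover have "?d \<in> ?E" using d extend_contains_ord by blast
    ultimately have "?d + gamma C \<rho> w \<in> ?E" by (intro submodule_overD(2)[OF extend_submodule])
    then have e: "eta C \<rho> s *s v \<in> ?E" by simp
    obtain u where u: "u \<in> mps_in C" "eta C \<rho> s * u = 1" using eta_unit[OF ws(1)] .
    have "u *s (eta C \<rho> s *s v) \<in> ?E" by (rule submodule_overD(3)[OF extend_submodule u(1) e])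
    then show "v \<in> ?E" using u(2) by (simp add: vector_smult_assoc mult.commute)
  qed
qed

text \<open>Injectivity of \<open>R\<^sub>P / P\<^sup>m R\<^sub>P \<rightarrow> B / n\<^sup>m\<close>, applied coordinatewise to the difference between an element of the
  contraction and an element of \<open>N\<close> that represents it up to order \<open>m\<close>.\<close>

lemma contraction_extend:
  fixes N :: "(('n, 'k) mpol ^ 'r::finite) set"
  assumes N: "saturated P (*s) N"
    and pow: "\<And>g w. g \<in> ideal_power P m \<Longrightarrow> g *s w \<in> N"
  shows "gamma C \<rho> -` extend_mod_power C \<rho> m N = N"
proof
  note N' = saturatedD[OF N]
  show "N \<subseteq> gamma C \<rho> -` extend_mod_power C \<rho> m N" using extend_contains_gamma by blast
  \<comment> \<open>modulo high order, elements of \<open>B \<cdot> \<gamma>(N)\<close> are fractions of elements of \<open>N\<close>\<close>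
  define H where "H = {u \<in> vec_in (mps_in C).
    \<exists>s n. s \<notin> P \<and> n \<in> N \<and> eta C \<rho> s *s u - gamma C \<rho> n \<in> vec_ord_ge m}"
  have "submodule_over (mps_in C) (*s) H"
    unfolding submodule_over_def
  proof (intro conjI ballI)
    have "eta C \<rho> 1 *s 0 - gamma C \<rho> 0 \<in> (vec_ord_ge m :: (('n, 'f) mps ^ 'r) set)"
      by (simp add: vec_ord_ge_def vec_in_def)
    then show "0 \<in> H"
      using prime_idealD(4)[OF prime] N'(1) submodule_overD(1)[OF vec_in_submodule]
      unfolding H_def by blast
  next
    fix u u' assume "u \<in> H" "u' \<in> H"
    then obtain s n s' n' where *: "u \<in> vec_in (mps_in C)" "u' \<in> vec_in (mps_in C)"
      "s \<notin> P" "n \<in> N" "eta C \<rho> s *s u - gamma C \<rho> n \<in> vec_ord_ge m"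
      "s' \<notin> P" "n' \<in> N" "eta C \<rho> s' *s u' - gamma C \<rho> n' \<in> vec_ord_ge m"
      unfolding H_def by blast
    have "eta C \<rho> (s * s') *s (u + u') - gamma C \<rho> (s' *s n + s *s n') =
        eta C \<rho> s' *s (eta C \<rho> s *s u - gamma C \<rho> n) + eta C \<rho> s *s (eta C \<rho> s' *s u' - gamma C \<rho> n')"
      by (simp add: vec_eq_iff gamma_add gamma_scale eta_mult algebra_simps)
    also have "\<dots> \<in> vec_ord_ge m" using * by (intro vec_ord_ge_add vec_ord_ge_scale)
    finally have "eta C \<rho> (s * s') *s (u + u') - gamma C \<rho> (s' *s n + s *s n') \<in> vec_ord_ge m" .
    moreover have "s * s' \<notin> P" by (rule prime_idealD(5)[OF prime *(3,6)])
    moreover have "s' *s n + s *s n' \<in> N" by (intro N'(2) N'(3) *)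
    moreover have "u + u' \<in> vec_in (mps_in C)" by (rule submodule_overD(2)[OF vec_in_submodule *(1,2)])
    ultimately show "u + u' \<in> H" unfolding H_def by blast
  next
    fix b :: "('n, 'f) mps" and u assume b: "b \<in> mps_in C" and "u \<in> H"
    then obtain s n where *: "u \<in> vec_in (mps_in C)" "s \<notin> P" "n \<in> N"
      "eta C \<rho> s *s u - gamma C \<rho> n \<in> vec_ord_ge m" unfolding H_def by blast
    obtain a t where at: "t \<notin> P" "eta C \<rho> t * b - eta C \<rho> a \<in> mps_ord_ge m"
      using eta_approx[OF b] by blast
    have "eta C \<rho> (t * s) *s (b *s u) - gamma C \<rho> (a *s n) =
        (eta C \<rho> t * b) *s (eta C \<rho> s *s u - gamma C \<rho> n) +
        (eta C \<rho> t * b - eta C \<rho> a) *s gamma C \<rho> n"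
      by (simp add: vec_eq_iff gamma_scale eta_mult algebra_simps)
    also have "\<dots> \<in> vec_ord_ge m" using * at
      by (intro vec_ord_ge_add vec_ord_ge_scale vec_ord_ge_scale_left)
    finally have "eta C \<rho> (t * s) *s (b *s u) - gamma C \<rho> (a *s n) \<in> vec_ord_ge m" .
    moreover have "t * s \<notin> P" by (rule prime_idealD(5)[OF prime at(1) *(2)])
    moreover have "a *s n \<in> N" by (rule N'(3)[OF *(3)])
    moreover have "b *s u \<in> vec_in (mps_in C)" by (rule vec_in_scale[OF b *(1)])
    ultimately show "b *s u \<in> H" unfolding H_def by blast
  qed
  moreover have "gamma C \<rho> n \<in> H" if n: "n \<in> N" for n
  proof -
    have "eta C \<rho> 1 *s gamma C \<rho> n - gamma C \<rho> n \<in> vec_ord_ge m"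
      by (simp add: vec_ord_ge_def vec_in_def)
    then show ?thesis using prime_idealD(4)[OF prime] n gamma_in unfolding H_def by blast
  qed
  ultimately have hull: "submodule_over (mps_in C) (*s) hull (gamma C \<rho> ` N) \<subseteq> H"
    by (intro hull_minimal) auto
  show "gamma C \<rho> -` extend_mod_power C \<rho> m N \<subseteq> N"
  proof
    fix w assume "w \<in> gamma C \<rho> -` extend_mod_power C \<rho> m N"
    then obtain u v where uv: "gamma C \<rho> w = u + v" "u \<in> H" "v \<in> vec_ord_ge m"
      unfolding extend_mod_power_eq using hull by blast
    then obtain s n where s: "s \<notin> P" "n \<in> N" "eta C \<rho> s *s u - gamma C \<rho> n \<in> vec_ord_ge m"
      unfolding H_def by blast
    have "gamma C \<rho> (s *s w - n) = (eta C \<rho> s *s u - gamma C \<rho> n) + eta C \<rho> s *s v"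
      by (simp add: vec_eq_iff gamma_diff gamma_scale uv(1) algebra_simps)
    also have "\<dots> \<in> vec_ord_ge m" using s uv by (intro vec_ord_ge_add vec_ord_ge_scale)
    finally have "eta C \<rho> ((s *s w - n) $ j) \<in> mps_ord_ge m" for j
      by (simp add: gamma_def vec_ord_ge_def vec_in_def)
    then have "\<exists>h. h \<notin> P \<and> h * (s *s w - n) $ j \<in> ideal_power P m" for j
      by (rule eta_ord_ge_imp_ideal_power)
    then obtain h where h: "h \<notin> P"
      "\<And>j. j \<in> (UNIV :: 'r set) \<Longrightarrow> h * (s *s w - n) $ j \<in> ideal_power P m"
    proof -
      assume that: "\<And>h. h \<notin> P \<Longrightarrow>
        (\<And>j. j \<in> (UNIV :: 'r set) \<Longrightarrow> h * (s *s w - n) $ j \<in> ideal_power P m) \<Longrightarrow> thesis"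
      assume ex: "\<And>j. \<exists>h. h \<notin> P \<and> h * (s *s w - n) $ j \<in> ideal_power P m"
      show thesis
      proof (rule common_denominator[OF prime,
            of "UNIV :: 'r set" "\<lambda>j (_ :: ('n, 'k) mpol) h. h * (s *s w - n) $ j \<in> ideal_power P m"])
        show "(t * h) * (s *s w - n) $ j \<in> ideal_power P m"
          if "h * (s *s w - n) $ j \<in> ideal_power P m" for j h t
          using submodule_overD(3)[OF ideal_power_ideal _ that, of t] by (simp add: mult.assoc)
      qed (use ex that in auto)
    qed
    have "h *s (s *s w - n) = (\<Sum>j\<in>UNIV. (h *s (s *s w - n)) $ j *s axis j 1)"
      by (rule vec_eq_sum_axis)
    also have "\<dots> \<in> N"
    proof (rule submodule_over_sum[OF N'(5)], rule pow)
      show "(h *s (s *s w - n)) $ j \<in> ideal_power P m" for j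
        using h(2)[of j] by (simp only: vector_smult_component UNIV_I)
    qed
    finally have "h *s (s *s w - n) + h *s n \<in> N" by (rule N'(2)) (rule N'(3)[OF s(2)])
    moreover have "h *s (s *s w - n) + h *s n = (h * s) *s w"
      by (simp add: vec_eq_iff algebra_simps)
    ultimately have "(h * s) *s w \<in> N" by simp
    then show "w \<in> N" using N'(4) h(1) s(1) prime_idealD(5)[OF prime] by blast
  qed
qed

end

section \<open>Chains of submodules\<close>

lemma chain_length_le:
  assumes "\<And>X. X \<in> S \<Longrightarrow> f X \<in> T" "\<And>X Y. X \<in> S \<Longrightarrow> Y \<in> S \<Longrightarrow> X \<subset> Y \<Longrightarrow> f X \<subset> f Y"
  shows "chain_length S \<le> chain_length T"
  unfolding chain_length_def
proof (rule Sup_mono)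
  fix a assume "a \<in> {enat k |k N. (\<forall>i\<le>k. N i \<in> S) \<and> (\<forall>i<k. N i \<subset> N (Suc i))}"
  then obtain k N where *: "a = enat k" "\<forall>i\<le>k. N i \<in> S" "\<forall>i<k. N i \<subset> N (Suc i)" by blast
  have "\<forall>i\<le>k. f (N i) \<in> T" "\<forall>i<k. f (N i) \<subset> f (N (Suc i))" using * assms by auto
  then have "a \<in> {enat k |k N. (\<forall>i\<le>k. N i \<in> T) \<and> (\<forall>i<k. N i \<subset> N (Suc i))}"
    unfolding *(1) by (intro CollectI exI[of _ k] exI[of _ "\<lambda>i. f (N i)"]) simp
  then show "\<exists>b\<in>{enat k |k N. (\<forall>i\<le>k. N i \<in> T) \<and> (\<forall>i<k. N i \<subset> N (Suc i))}. a \<le> b" by blast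
qed

text \<open>A chain that realizes a finite supremum cannot be refined at any place, nor continued at either end.\<close>

lemma maximal_chain:
  assumes len: "chain_length S = enat m" and ne: "X0 \<in> S"
  obtains N where "\<And>i. i \<le> m \<Longrightarrow> N i \<in> S" "\<And>i. i < m \<Longrightarrow> N i \<subset> N (Suc i)"
    "\<And>X. X \<in> S \<Longrightarrow> X \<subseteq> N 0 \<Longrightarrow> X = N 0" "\<And>X. X \<in> S \<Longrightarrow> N m \<subseteq> X \<Longrightarrow> X = N m"
    "\<And>i X. i < m \<Longrightarrow> X \<in> S \<Longrightarrow> N i \<subset> X \<Longrightarrow> X \<subseteq> N (Suc i) \<Longrightarrow> X = N (Suc i)"
proof -
  let ?A = "{enat k |k N. (\<forall>i\<le>k. N i \<in> S) \<and> (\<forall>i<k. N i \<subset> N (Suc i))}"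
  have "enat 0 \<in> ?A" using ne by (intro CollectI exI[of _ 0] exI[of _ "\<lambda>_. X0"]) auto
  then have "?A \<noteq> {}" by blast
  moreover have Sup: "Sup ?A = enat m" using len by (simp add: chain_length_def)
  ultimately have "enat m \<in> ?A"
    unfolding Sup_enat_def by (metis (no_types, lifting) Max_in enat.distinct(1))
  then obtain N where N: "\<And>i. i \<le> m \<Longrightarrow> N i \<in> S" "\<And>i. i < m \<Longrightarrow> N i \<subset> N (Suc i)" by auto
  have insert: False
    if X: "X \<in> S" and i: "i \<le> Suc m" and lo: "0 < i \<Longrightarrow> N (i - 1) \<subset> X" and hi: "i \<le> m \<Longrightarrow> X \<subset> N i"
    for X i
  proof -
    define N' where "N' j = (if j < i then N j else if j = i then X else N (j - 1))" for j
    have "\<forall>j\<le>Suc m. N' j \<in> S" using X i by (auto simp: N'_def intro!: N(1))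
    moreover have "\<forall>j<Suc m. N' j \<subset> N' (Suc j)"
    proof (intro allI impI)
      fix j assume j: "j < Suc m"
      consider "Suc j < i" | "Suc j = i" | "j = i" | "i < j" by linarith
      then show "N' j \<subset> N' (Suc j)"
      proof cases
        case 4
        then show ?thesis using N(2)[of "j - 1"] j by (auto simp: N'_def)
      qed (use N(2)[of j] i j lo hi in \<open>auto simp: N'_def\<close>)
    qed
    ultimately have "enat (Suc m) \<in> ?A" by blast
    then have "enat (Suc m) \<le> Sup ?A" by (rule Sup_upper)
    then show False unfolding Sup by simp
  qed
  show ?thesis
  proof (rule that[of N])
    show "N i \<in> S" if "i \<le> m" for i by (rule N(1)[OF that])
    show "N i \<subset> N (Suc i)" if "i < m" for i by (rule N(2)[OF that])
    show "X = N 0" if "X \<in> S" "X \<subseteq> N 0" for X using insert[of X 0] that by auto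
    show "X = N m" if "X \<in> S" "N m \<subseteq> X" for X using insert[of X "Suc m"] that by auto
    show "X = N (Suc i)" if "i < m" "X \<in> S" "N i \<subset> X" "X \<subseteq> N (Suc i)" for i X
      using insert[of X "Suc i"] that by auto
  qed
qed

text \<open>Otherwise \<open>w\<close> is in the saturation of \<open>N + R p w\<close>, by simplicity of the step. So \<open>(t - a p) w \<in> N\<close> for some
  \<open>t \<notin> P\<close>; as \<open>t - a p \<notin> P\<close>, this puts \<open>w\<close> into \<open>N\<close>.\<close>

lemma simple_step_saturated:
  assumes P: "prime_ideal P" and M: "module smul"
    and N: "saturated P smul N" and N': "saturated P smul N'" and sub: "N \<subseteq> N'"
    and simple: "\<And>L. saturated P smul L \<Longrightarrow> N \<subset> L \<Longrightarrow> L \<subseteq> N' \<Longrightarrow> L = N'"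
    and p: "p \<in> P" and w: "w \<in> N'"
  shows "smul p w \<in> N"
proof (rule ccontr)
  interpret module smul by (rule M)
  note n = saturatedD[OF N] and n' = saturatedD[OF N']
  assume no: "smul p w \<notin> N"
  define L where "L = {x. \<exists>t a. t \<notin> P \<and> smul t x - smul a (smul p w) \<in> N}"
  have L_add: "x + y \<in> L" if xy: "x \<in> L" "y \<in> L" for x y
  proof -
    obtain t a t' a' where *: "t \<notin> P" "smul t x - smul a (smul p w) \<in> N"
      "t' \<notin> P" "smul t' y - smul a' (smul p w) \<in> N" using xy unfolding L_def by blast
    have "smul (t * t') (x + y) - smul (t' * a + t * a') (smul p w) =
        smul t' (smul t x - smul a (smul p w)) + smul t (smul t' y - smul a' (smul p w))"
      by (simp add: algebra_simps)
    also have "\<dots> \<in> N" using * n by blast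
    finally show ?thesis using *(1,3) prime_idealD(5)[OF P] unfolding L_def by blast
  qed
  have L_scale: "smul b x \<in> L" if x: "x \<in> L" for b x
  proof -
    obtain t a where *: "t \<notin> P" "smul t x - smul a (smul p w) \<in> N" using x unfolding L_def by blast
    have "smul t (smul b x) - smul (b * a) (smul p w) = smul b (smul t x - smul a (smul p w))"
      by (simp add: scale_right_diff_distrib ac_simps)
    also have "\<dots> \<in> N" using * n by blast
    finally show ?thesis using *(1) unfolding L_def by blast
  qed
  have L_sat: "x \<in> L" if sx: "s \<notin> P" "smul s x \<in> L" for s x
  proof -
    obtain t a where *: "t \<notin> P" "smul t (smul s x) - smul a (smul p w) \<in> N"
      using sx(2) unfolding L_def by blast
    then have "smul (t * s) x - smul a (smul p w) \<in> N" by simp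
    then show ?thesis using *(1) sx(1) prime_idealD(5)[OF P] unfolding L_def by blast
  qed
  have NL: "N \<subseteq> L"
  proof
    fix x assume "x \<in> N"
    then have "smul 1 x - smul 0 (smul p w) \<in> N" by simp
    then show "x \<in> L" using prime_idealD(4)[OF P] unfolding L_def by blast
  qed
  have "smul 1 (smul p w) - smul 1 (smul p w) \<in> N" using n(1) by simp
  then have "smul p w \<in> L" using prime_idealD(4)[OF P] unfolding L_def by blast
  with no NL have "N \<subset> L" by blast
  moreover have "saturated P smul L"
    unfolding saturated_def submodule_over_def
  proof (intro conjI ballI allI impI)
    show "0 \<in> L" using NL n(1) by blast
    show "x + y \<in> L" if "x \<in> L" "y \<in> L" for x y using that by (rule L_add)
    show "smul a x \<in> L" if "x \<in> L" for a x using that by (rule L_scale)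
    show "x \<in> L" if "s \<notin> P" "smul s x \<in> L" for s x using that by (rule L_sat)
  qed
  moreover have "L \<subseteq> N'"
  proof
    fix x assume "x \<in> L"
    then obtain t a where *: "t \<notin> P" "smul t x - smul a (smul p w) \<in> N" unfolding L_def by blast
    then have "(smul t x - smul a (smul p w)) + smul a (smul p w) \<in> N'"
      using sub n'(3)[OF n'(3)[OF w]] by (intro n'(2)) auto
    then show "x \<in> N'" using n'(4)[OF *(1)] by simp
  qed
  ultimately have "L = N'" by (intro simple)
  then obtain t a where *: "t \<notin> P" "smul t w - smul a (smul p w) \<in> N" using w unfolding L_def by blast
  then have "smul (t - a * p) w \<in> N" by (simp add: scale_left_diff_distrib)
  moreover have "t - a * p \<notin> P"
  proof
    assume "t - a * p \<in> P"
    then have "t - a * p + a * p \<in> P" using prime_idealD(2,3)[OF P] p by blast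
    with * show False by simp
  qed
  ultimately have "w \<in> N" using n(4) by blast
  with no n(3) show False by blast
qed

text \<open>Along a composition series of length \<open>m\<close> each factor from \<open>P\<close> moves one step down, starting with the whole
  module.\<close>

lemma finite_length_power:
  assumes P: "prime_ideal P" and M: "module smul"
    and U: "saturated P smul U"
    and len: "chain_length {N. saturated P smul N \<and> U \<subseteq> N} = enat m"
    and g: "g \<in> ideal_power P m"
  shows "smul g w \<in> U"
proof -
  interpret module smul by (rule M)
  have "U \<in> {N. saturated P smul N \<and> U \<subseteq> N}" using U by simp
  from maximal_chain[OF len this] obtain N where N:
    "\<And>i. i \<le> m \<Longrightarrow> N i \<in> {N. saturated P smul N \<and> U \<subseteq> N}" "\<And>i. i < m \<Longrightarrow> N i \<subset> N (Suc i)"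
    "\<And>X. X \<in> {N. saturated P smul N \<and> U \<subseteq> N} \<Longrightarrow> X \<subseteq> N 0 \<Longrightarrow> X = N 0"
    "\<And>X. X \<in> {N. saturated P smul N \<and> U \<subseteq> N} \<Longrightarrow> N m \<subseteq> X \<Longrightarrow> X = N m"
    "\<And>i X. i < m \<Longrightarrow> X \<in> {N. saturated P smul N \<and> U \<subseteq> N} \<Longrightarrow> N i \<subset> X \<Longrightarrow> X \<subseteq> N (Suc i)
      \<Longrightarrow> X = N (Suc i)"
    by blast
  have sat: "saturated P smul (N i)" and UN: "U \<subseteq> N i" if "i \<le> m" for i
    using N(1)[OF that] by auto
  have "N 0 = U" using N(3)[of U] U UN[of 0] by simp
  have "N m = UNIV" using N(4)[of UNIV] by (auto simp: saturated_def submodule_over_def)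
  have step: "smul p w \<in> N i" if "i < m" "p \<in> P" "w \<in> N (Suc i)" for i p w
  proof (rule simple_step_saturated[OF P M sat sat _ _ that(2,3)])
    show "N i \<subseteq> N (Suc i)" using N(2)[OF that(1)] by blast
    show "L = N (Suc i)" if "saturated P smul L" "N i \<subset> L" "L \<subseteq> N (Suc i)" for L
    proof (rule N(5)[OF \<open>i < m\<close> _ that(2,3)])
      show "L \<in> {N. saturated P smul N \<and> U \<subseteq> N}"
        using that UN[of i] \<open>i < m\<close> by auto
    qed
  qed (use that in auto)
  have "smul g w \<in> N (m - i)" if "g \<in> ideal_power P i" "i \<le> m" for i g w
    using that
  proof (induction i arbitrary: g w)
    case 0
    then show ?case by (simp add: \<open>N m = UNIV\<close>)
  next
    case (Suc i)
    note s = saturatedD[OF sat[of "m - Suc i"]]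
    have "ideal_power P (Suc i) \<subseteq> {g. \<forall>w. smul g w \<in> N (m - Suc i)}"
      unfolding ideal_power.simps
    proof (rule hull_minimal, clarify)
      fix p q w assume "p \<in> P" "q \<in> ideal_power P i"
      moreover from this have "smul q w \<in> N (Suc (m - Suc i))"
        using Suc.IH Suc.prems by (simp add: Suc_diff_Suc)
      moreover have "m - Suc i < m" using Suc.prems(2) by simp
      ultimately have "smul p (smul q w) \<in> N (m - Suc i)" using step by blast
      then show "smul (p * q) w \<in> N (m - Suc i)" by simp
    next
      show "submodule_over UNIV (*) {g. \<forall>w. smul g w \<in> N (m - Suc i)}"
        using s(1-3) by (auto simp: submodule_over_def scale_left_distrib simp flip: scale_scale)
    qed
    then show ?case using Suc.prems by blast
  qed
  from this[of g m w] show ?thesis using g \<open>N 0 = U\<close> by simp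
qed

section \<open>Length and dimension on the power series side\<close>

definition mps_scale :: "'f::field \<Rightarrow> ('n::finite, 'f) mps ^ 'r \<Rightarrow> ('n, 'f) mps ^ 'r" where
  "mps_scale a v = mps_const a *s v"

interpretation mps_vs: vector_space "mps_scale :: 'f::field \<Rightarrow> ('n::finite, 'f) mps ^ 'r \<Rightarrow> _"
  by unfold_locales
    (auto simp: mps_scale_def vec_eq_iff mps_const_add mps_const_mult algebra_simps)

definition mps_submodules :: "'n set \<Rightarrow> (('n::finite, 'f::field) mps ^ 'r) set \<Rightarrow>
    (('n, 'f) mps ^ 'r) set set" where
  "mps_submodules C V =
    {W. submodule_over (mps_in C) (*s) W \<and> V \<subseteq> W \<and> W \<subseteq> vec_in (mps_in C)}"

lemma mps_submodule_subspace:
  "submodule_over (mps_in C) (*s) V \<Longrightarrow> mps_vs.subspace V"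
  by (auto simp: mps_vs.subspace_def mps_scale_def submodule_over_def)

lemma mps_subspace_sum_const:
  "mps_vs.subspace V \<Longrightarrow> (\<And>j. j \<in> A \<Longrightarrow> b j \<in> V) \<Longrightarrow> (\<Sum>j\<in>A. mps_const (a j) *s b j) \<in> V"
  by (rule mps_vs.subspace_sum) (auto simp flip: mps_scale_def intro: mps_vs.subspace_scale)

lemma mps_subspace_diff_cancel:
  "mps_vs.subspace V \<Longrightarrow> v - w \<in> V \<Longrightarrow> v \<in> V \<longleftrightarrow> w \<in> V"
  using mps_vs.subspace_add[of V "v - w" w] mps_vs.subspace_diff[of V v "v - w"] by auto

text \<open>Vectors that witness the strict inclusions are linearly independent, and remain witnesses when they are changed by
  elements of \<open>V\<close>; so they may be taken in the span of \<open>B\<close>.\<close>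

lemma chain_le_generators:
  assumes fin: "finite B" and span: "\<And>w. w \<in> X \<Longrightarrow> \<exists>w'\<in>mps_vs.span B. w - w' \<in> V"
    and sub: "\<And>i. i \<le> l \<Longrightarrow> mps_vs.subspace (N i)" and VN: "\<And>i. i \<le> l \<Longrightarrow> V \<subseteq> N i"
    and u: "\<And>i. i < l \<Longrightarrow> u i \<in> N (Suc i) - N i" and uX: "\<And>i. i < l \<Longrightarrow> u i \<in> X"
    and mono: "\<And>i. i < l \<Longrightarrow> N i \<subseteq> N (Suc i)"
  shows "l \<le> card B"
proof -
  have "\<exists>w. \<forall>i<l. w i \<in> mps_vs.span B \<and> u i - w i \<in> V" using span uX by meson
  then obtain w where w: "\<And>i. i < l \<Longrightarrow> w i \<in> mps_vs.span B" "\<And>i. i < l \<Longrightarrow> u i - w i \<in> V" by blast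
  have wN: "w i \<in> N (Suc i) - N i" if i: "i < l" for i
    using mps_subspace_diff_cancel[OF sub[of i], of "u i" "w i"]
      mps_subspace_diff_cancel[OF sub[of "Suc i"], of "u i" "w i"]
      w(2)[OF i] VN[of i] VN[of "Suc i"] u[OF i] i by auto
  have "k \<le> l \<Longrightarrow> \<not> mps_vs.dependent (w ` {..<k}) \<and> card (w ` {..<k}) = k \<and>
      mps_vs.span (w ` {..<k}) \<subseteq> N k" for k
  proof (induction k)
    case 0
    then show ?case using mps_vs.subspace_0[OF sub[of 0]] by (simp add: mps_vs.independent_empty)
  next
    case (Suc k)
    then have IH: "\<not> mps_vs.dependent (w ` {..<k})" "card (w ` {..<k}) = k"
      "mps_vs.span (w ` {..<k}) \<subseteq> N k" and k: "k < l" by auto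
    have no: "w k \<notin> mps_vs.span (w ` {..<k})" using IH(3) wN[OF k] by blast
    have sup: "w ` {..<k} \<subseteq> mps_vs.span (w ` {..<k})" by (rule mps_vs.span_superset)
    with no have "w k \<notin> w ` {..<k}" by blast
    moreover have "w ` {..<Suc k} = insert (w k) (w ` {..<k})" by (simp add: lessThan_Suc)
    moreover have "mps_vs.span (insert (w k) (w ` {..<k})) \<subseteq> N (Suc k)"
    proof (rule mps_vs.span_minimal)
      show "insert (w k) (w ` {..<k}) \<subseteq> N (Suc k)" using wN[OF k] IH(3) mono[OF k] sup by blast
      show "mps_vs.subspace (N (Suc k))" using sub[of "Suc k"] k by simp
    qed
    ultimately show ?case using mps_vs.independent_insertI[OF no IH(1)] IH(2) by simp
  qed
  from this[of l] have "\<not> mps_vs.dependent (w ` {..<l})" "card (w ` {..<l}) = l" by auto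
  then show ?thesis
    using mps_vs.independent_span_bound[OF fin, of "w ` {..<l}"] w(1) by auto
qed

lemma mps_chain_length_le:
  assumes fin: "finite B"
    and span: "\<And>w. w \<in> vec_in (mps_in C) \<Longrightarrow> \<exists>w'\<in>mps_vs.span B. w - w' \<in> V"
  shows "chain_length (mps_submodules C V) \<le> enat (card B)"
  unfolding chain_length_def
proof (rule Sup_least, clarify)
  fix k N assume N: "\<forall>i\<le>k. N i \<in> mps_submodules C V" "\<forall>i<k. N i \<subset> N (Suc i)"
  then have "\<forall>i<k. \<exists>x. x \<in> N (Suc i) - N i" by blast
  then obtain u where u: "\<And>i. i < k \<Longrightarrow> u i \<in> N (Suc i) - N i" by metis
  have "k \<le> card B"
  proof (rule chain_le_generators[OF fin span, where N = N and u = u])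
    show "mps_vs.subspace (N i)" "V \<subseteq> N i" if "i \<le> k" for i
      using N(1) that mps_submodule_subspace unfolding mps_submodules_def by blast+
    show "u i \<in> vec_in (mps_in C)" if "i < k" for i
    proof -
      have "N (Suc i) \<in> mps_submodules C V" using N(1) that by simp
      then show ?thesis using u[OF that] unfolding mps_submodules_def by blast
    qed
  qed (use N(2) u in auto)
  then show "enat k \<le> enat (card B)" by simp
qed

lemma mps_cyclic_extension:
  fixes V :: "(('n::finite, 'f::field) mps ^ 'r) set"
  assumes V: "submodule_over (mps_in C) (*s) V" "V \<subseteq> vec_in (mps_in C)" and v: "v \<in> vec_in (mps_in C)"
  defines "L \<equiv> {x + b *s v | x b. x \<in> V \<and> b \<in> mps_in C}"
  shows "submodule_over (mps_in C) (*s) L" "V \<subseteq> L" "v \<in> L" "L \<subseteq> vec_in (mps_in C)"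
proof -
  have "submodule_over (mps_in C) (*s) {b *s v | b. b \<in> mps_in C}"
    unfolding submodule_over_def
  proof (intro conjI ballI)
    show "0 \<in> {b *s v | b. b \<in> mps_in C}" by (auto intro!: exI[of _ 0])
    show "x + y \<in> {b *s v | b. b \<in> mps_in C}"
      if "x \<in> {b *s v | b. b \<in> mps_in C}" "y \<in> {b *s v | b. b \<in> mps_in C}" for x y
      using that by (auto simp flip: vector_sadd_rdistrib)
    show "a *s x \<in> {b *s v | b. b \<in> mps_in C}"
      if "a \<in> mps_in C" "x \<in> {b *s v | b. b \<in> mps_in C}" for a x
      using that by (auto simp: vector_smult_assoc)
  qed
  from submodule_over_plus[OF V(1) this]
  have "submodule_over (mps_in C) (*s) {x + y | x y. x \<in> V \<and> y \<in> {b *s v | b. b \<in> mps_in C}}"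
    by (simp add: vec_eq_iff distrib_left)
  moreover have "{x + y | x y. x \<in> V \<and> y \<in> {b *s v | b. b \<in> mps_in C}} = L"
    unfolding L_def by blast
  ultimately show "submodule_over (mps_in C) (*s) L" by simp
  show "V \<subseteq> L"
  proof
    fix x assume "x \<in> V"
    then have "x = x + 0 *s v" "x \<in> V" by auto
    then show "x \<in> L" unfolding L_def using mps_in_zero by blast
  qed
  have "v = 0 + 1 *s v" by simp
  then show "v \<in> L" unfolding L_def using mps_in_one submodule_overD(1)[OF V(1)] by blast
  show "L \<subseteq> vec_in (mps_in C)"
    unfolding L_def using V(2) v submodule_overD(2,3)[OF vec_in_submodule] by blast
qed

text \<open>If \<open>t v \<notin> V\<close> for some \<open>t\<close> of positive order, then \<open>v \<in> V + B t v\<close> by simplicity of the step, so \<open>(1 - b t) v \<in> V\<close> with a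
  unit \<open>1 - b t\<close>. Consequently only the constant terms of scalars matter in \<open>V' = V + B v\<close>, and the step is a line.\<close>

lemma simple_step_mps:
  fixes V :: "(('n::finite, 'f::field) mps ^ 'r) set"
  assumes V: "submodule_over (mps_in C) (*s) V" and V': "submodule_over (mps_in C) (*s) V'"
    and sub: "V \<subset> V'" "V' \<subseteq> vec_in (mps_in C)"
    and simple: "\<And>L. submodule_over (mps_in C) (*s) L \<Longrightarrow> V \<subset> L \<Longrightarrow> L \<subseteq> V' \<Longrightarrow> L = V'"
  shows "t \<in> mps_in C \<Longrightarrow> t \<in> mps_ord_ge (Suc 0) \<Longrightarrow> v \<in> V' \<Longrightarrow> t *s v \<in> V"
    and "v \<in> V' - V \<Longrightarrow> w \<in> V' \<Longrightarrow> \<exists>a. w - mps_const a *s v \<in> V"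
proof -
  have V_in: "V \<subseteq> vec_in (mps_in C)" using sub by blast
  have gen: "\<exists>x b. w = x + b *s v \<and> x \<in> V \<and> b \<in> mps_in C"
    if v: "v \<in> V'" "v \<notin> V" and w: "w \<in> V'" for v w
  proof -
    have v_in: "v \<in> vec_in (mps_in C)" using v sub by blast
    note L = mps_cyclic_extension[OF V V_in v_in]
    let ?L = "{x + b *s v | x b. x \<in> V \<and> b \<in> mps_in C}"
    have "V \<subset> ?L" using L(2,3) v by blast
    moreover have "?L \<subseteq> V'"
      using v(1) sub(1) submodule_overD(2,3)[OF V'] by blast
    ultimately have "?L = V'" using simple[OF L(1)] by blast
    then have "w \<in> ?L" using w by simp
    then show ?thesis by blast
  qed
  show kill: "t *s v \<in> V"
    if t: "t \<in> mps_in C" "t \<in> mps_ord_ge (Suc 0)" and v: "v \<in> V'" for t v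
  proof (rule ccontr)
    assume no: "t *s v \<notin> V"
    have "t *s v \<in> V'" by (rule submodule_overD(3)[OF V' t(1) v])
    from gen[OF this no v] obtain x b where xb: "v = x + b *s (t *s v)" "x \<in> V" "b \<in> mps_in C" by blast
    have "(1 - b * t) *s v = v - b *s (t *s v)"
      by (simp add: vec_eq_iff algebra_simps)
    also have "\<dots> = x" using xb(1) by (metis add_diff_cancel_right')
    finally have x: "(1 - b * t) *s v = x" .
    have "mps_coeff (1 - b * t) 0 \<noteq> 0" using t(2) by (simp add: mps_ord_ge_1)
    moreover have "1 - b * t \<in> mps_in C" using xb(3) t(1) by (intro mps_in_diff mps_in_mult) auto
    ultimately obtain g where g: "g \<in> mps_in C" "(1 - b * t) * g = 1" using mps_inverse by blast
    have "g *s ((1 - b * t) *s v) \<in> V" unfolding x by (rule submodule_overD(3)[OF V g(1) xb(2)])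
    moreover have "g * (1 - b * t) = 1" using g(2) by (metis mult.commute)
    then have "g *s ((1 - b * t) *s v) = v" unfolding vector_smult_assoc by simp
    ultimately have "v \<in> V" by simp
    then have "t *s v \<in> V" by (rule submodule_overD(3)[OF V t(1)])
    with no show False by blast
  qed
  show "\<exists>a. w - mps_const a *s v \<in> V" if v: "v \<in> V' - V" and w: "w \<in> V'" for v w
  proof -
    obtain x b where xb: "w = x + b *s v" "x \<in> V" "b \<in> mps_in C" using gen[of v w] v w by blast
    let ?c = "mps_const (mps_coeff b 0)"
    have "(b - ?c) *s v \<in> V"
      by (rule kill) (use xb v in \<open>auto simp: mps_ord_ge_1 intro!: mps_in_diff\<close>)
    moreover have "w - ?c *s v = x + (b - ?c) *s v"
      by (simp add: xb(1) vec_eq_iff algebra_simps)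
    ultimately have "w - ?c *s v \<in> V" using submodule_overD(2)[OF V xb(2)] by metis
    then show ?thesis by blast
  qed
qed

lemma vec_ord_ge_decomp:
  fixes w :: "('n::finite, 'f::field) mps ^ 'r"
  assumes "w \<in> vec_in (mps_in C) \<inter> vec_ord_ge (Suc k)"
  shows "\<exists>g. (\<forall>i\<in>C. g i \<in> vec_in (mps_in C) \<inter> vec_ord_ge k) \<and> w = (\<Sum>i\<in>C. mps_var i *s g i)"
proof -
  have "\<forall>j. \<exists>g. (\<forall>i\<in>C. g i \<in> mps_in C \<inter> mps_ord_ge k) \<and> w $ j = (\<Sum>i\<in>C. mps_var i * g i)"
  proof
    fix j
    have "w $ j \<in> mps_in C" "w $ j \<in> mps_ord_ge (Suc k)"
      using assms by (auto simp: vec_in_def vec_ord_ge_def)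
    then obtain g where "\<And>i. i \<in> C \<Longrightarrow> g i \<in> mps_in C \<inter> mps_ord_ge k"
      "w $ j = (\<Sum>i\<in>C. mps_var i * g i)" by (rule mps_ord_ge_decomp) blast
    then show "\<exists>g. (\<forall>i\<in>C. g i \<in> mps_in C \<inter> mps_ord_ge k) \<and> w $ j = (\<Sum>i\<in>C. mps_var i * g i)"
      by blast
  qed
  then obtain g where g: "\<And>j i. i \<in> C \<Longrightarrow> g j i \<in> mps_in C \<inter> mps_ord_ge k"
    "\<And>j. w $ j = (\<Sum>i\<in>C. mps_var i * g j i)" by metis
  have "w = (\<Sum>i\<in>C. mps_var i *s (\<chi> j. g j i))" by (simp add: vec_eq_iff g(2))
  moreover have "(\<chi> j. g j i) \<in> vec_in (mps_in C) \<inter> vec_ord_ge k" if "i \<in> C" for i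
    using g(1)[OF that] by (auto simp: vec_in_def vec_ord_ge_def)
  ultimately show ?thesis by (intro exI[of _ "\<lambda>i. \<chi> j. g j i"]) blast
qed

text \<open>One vector for each step of a composition series gives an \<open>F\<close>-basis of \<open>B\<^sup>r / V\<close>, because every step is
  one-dimensional; and each step absorbs one factor of the maximal ideal.\<close>

lemma chain_length_imp_quot_point:
  fixes V :: "(('n::finite, 'f::field) mps ^ 'r) set"
  assumes V: "submodule_over (mps_in C) (*s) V" "V \<subseteq> vec_in (mps_in C)"
    and len: "chain_length (mps_submodules C V) = enat k"
  shows "quot_point C k V" "vec_in (mps_in C) \<inter> vec_ord_ge k \<subseteq> V"
proof -
  let ?X = "vec_in (mps_in C) :: (('n, 'f) mps ^ 'r) set"
  have VS: "V \<in> mps_submodules C V" "?X \<in> mps_submodules C V"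
    using V vec_in_submodule by (auto simp: mps_submodules_def)
  from maximal_chain[OF len VS(1)] obtain N where N:
    "\<And>i. i \<le> k \<Longrightarrow> N i \<in> mps_submodules C V" "\<And>i. i < k \<Longrightarrow> N i \<subset> N (Suc i)"
    "\<And>X. X \<in> mps_submodules C V \<Longrightarrow> X \<subseteq> N 0 \<Longrightarrow> X = N 0"
    "\<And>X. X \<in> mps_submodules C V \<Longrightarrow> N k \<subseteq> X \<Longrightarrow> X = N k"
    "\<And>i X. i < k \<Longrightarrow> X \<in> mps_submodules C V \<Longrightarrow> N i \<subset> X \<Longrightarrow> X \<subseteq> N (Suc i) \<Longrightarrow> X = N (Suc i)"
    by blast
  have N': "submodule_over (mps_in C) (*s) (N i)" "V \<subseteq> N i" "N i \<subseteq> ?X" if "i \<le> k" for i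
    using N(1)[OF that] by (auto simp: mps_submodules_def)
  have N0: "N 0 = V" using N(3)[OF VS(1)] N'[of 0] by simp
  have Nk: "N k = ?X" using N(4)[OF VS(2)] N'[of k] by simp
  have simple: "L = N (Suc i)"
    if "i < k" "submodule_over (mps_in C) (*s) L" "N i \<subset> L" "L \<subseteq> N (Suc i)" for i L
  proof (rule N(5)[OF that(1) _ that(3,4)])
    have "V \<subseteq> L" using N'(2)[of i] that(1,3) by auto
    moreover have "L \<subseteq> ?X" using N'(3)[of "Suc i"] that(1,4) by auto
    ultimately show "L \<in> mps_submodules C V" using that(2) by (simp add: mps_submodules_def)
  qed
  have kill: "t *s v \<in> N i"
    if "i < k" "t \<in> mps_in C" "t \<in> mps_ord_ge (Suc 0)" "v \<in> N (Suc i)" for i t v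
    by (rule simple_step_mps(1)[OF N'(1) N'(1) N(2) N'(3) simple _ _ that(4)]) (use that in auto)
  have line: "\<exists>a. w - mps_const a *s v \<in> N i"
    if "i < k" "v \<in> N (Suc i) - N i" "w \<in> N (Suc i)" for i v w
    by (rule simple_step_mps(2)[OF N'(1) N'(1) N(2) N'(3) simple that(2,3)]) (use that in auto)
  show "?X \<inter> vec_ord_ge k \<subseteq> V"
  proof -
    have "w \<in> N (k - i)" if "i \<le> k" "w \<in> ?X \<inter> vec_ord_ge i" for i w
      using that
    proof (induction i arbitrary: w)
      case 0
      then show ?case by (simp add: Nk)
    next
      case (Suc i)
      obtain g where g: "\<forall>j\<in>C. g j \<in> ?X \<inter> vec_ord_ge i" "w = (\<Sum>j\<in>C. mps_var j *s g j)"
        using vec_ord_ge_decomp[OF Suc.prems(2)] by blast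
      have i: "k - Suc i < k" "Suc (k - Suc i) = k - i" using Suc.prems(1) by auto
      have "mps_var j *s g j \<in> N (k - Suc i)" if "j \<in> C" for j
        by (rule kill[OF i(1) mps_in_var[OF that] mps_ord_ge_var])
          (use Suc.IH Suc.prems(1) g(1) that i(2) in simp)
      then show ?case unfolding g(2) by (intro submodule_over_sum[OF N'(1)]) auto
    qed
    from this[of k] show ?thesis by (auto simp: N0)
  qed
  have "\<forall>i<k. \<exists>x. x \<in> N (Suc i) - N i" using N(2) by blast
  then obtain v where v: "\<And>i. i < k \<Longrightarrow> v i \<in> N (Suc i) - N i" by metis
  have mono: "N i \<subseteq> N j" if "i \<le> j" "j \<le> k" for i j
    using that by (induction j) (auto simp: le_Suc_eq dest: N(2)[OF Suc_le_lessD])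
  have spanning: "\<exists>a. w - (\<Sum>j<i. mps_const (a j) *s v j) \<in> V" if "i \<le> k" "w \<in> N i" for i w
    using that
  proof (induction i arbitrary: w)
    case 0
    then show ?case by (simp add: N0)
  next
    case (Suc i)
    then have i: "i < k" by simp
    obtain c where c: "w - mps_const c *s v i \<in> N i" using line[OF i v[OF i] Suc.prems(2)] by blast
    obtain a where a: "w - mps_const c *s v i - (\<Sum>j<i. mps_const (a j) *s v j) \<in> V"
      using Suc.IH[OF _ c] i by auto
    have "(\<Sum>j<i. mps_const ((a(i := c)) j) *s v j) = (\<Sum>j<i. mps_const (a j) *s v j)"
      by (rule sum.cong) auto
    with a have "w - (\<Sum>j<Suc i. mps_const ((a(i := c)) j) *s v j) \<in> V" by (simp add: algebra_simps)
    then show ?case by blast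
  qed
  have indep: "a j = 0" if V0: "(\<Sum>j<k. mps_const (a j) *s v j) \<in> V" and j: "j < k" for a j
  proof (rule ccontr)
    assume "a j \<noteq> 0"
    define i where "i = Max {j. j < k \<and> a j \<noteq> 0}"
    have "i \<in> {j. j < k \<and> a j \<noteq> 0}"
      unfolding i_def using j \<open>a j \<noteq> 0\<close> by (intro Max_in) auto
    then have i: "i < k" "a i \<noteq> 0" by auto
    have max: "j \<le> i" if "j < k" "a j \<noteq> 0" for j
      unfolding i_def using that by (intro Max_ge) auto
    have Ni: "submodule_over (mps_in C) (*s) (N i)" using N'(1) i(1) by simp
    have "(\<Sum>j<k. mps_const (a j) *s v j) = (\<Sum>j<Suc i. mps_const (a j) *s v j)"
      by (rule sum.mono_neutral_right) (use i max in \<open>fastforce simp: less_Suc_eq_le\<close>)+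
    then have "mps_const (a i) *s v i = (\<Sum>j<k. mps_const (a j) *s v j) - (\<Sum>j<i. mps_const (a j) *s v j)"
      by simp
    moreover have "(\<Sum>j<i. mps_const (a j) *s v j) \<in> N i"
    proof (rule submodule_over_sum[OF Ni])
      fix j assume "j \<in> {..<i}"
      then have "v j \<in> N i" using v[of j] mono[of "Suc j" i] i(1) by auto
      then show "mps_const (a j) *s v j \<in> N i" by (rule submodule_overD(3)[OF Ni mps_in_const])
    qed
    moreover have "(\<Sum>j<k. mps_const (a j) *s v j) \<in> N i" using V0 N'(2)[of i] i(1) by auto
    ultimately have "mps_const (a i) *s v i \<in> N i" using mps_submodule_diff[OF Ni] by simp
    then have "mps_const (1 / a i) *s (mps_const (a i) *s v i) \<in> N i"
      by (rule submodule_overD(3)[OF Ni mps_in_const])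
    then have "v i \<in> N i" using i(2) by (simp add: vector_smult_assoc flip: mps_const_mult)
    then show False using v[OF i(1)] by blast
  qed
  show "quot_point C k V"
    unfolding quot_point_def
  proof (intro conjI exI[of _ v] allI impI ballI)
    show "v j \<in> ?X" if "j < k" for j using v[OF that] N'(3)[of "Suc j"] that by auto
    show "\<exists>a. w - (\<Sum>j<k. mps_const (a j) *s v j) \<in> V" if "w \<in> ?X" for w
      using spanning[of k w] that Nk by simp
  qed (use V indep in auto)
qed

text \<open>A basis of \<open>B\<^sup>r / V\<close> bounds the length of chains by \<open>m\<close>. The length \<open>k\<close> is thus finite and yields a second basis,
  with \<open>k\<close> elements, that bounds \<open>m\<close> in turn.\<close>

lemma quot_point_chain_length:
  fixes V :: "(('n::finite, 'f::field) mps ^ 'r) set"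
  assumes q: "quot_point C m V"
  shows "chain_length (mps_submodules C V) = enat m"
proof -
  let ?X = "vec_in (mps_in C) :: (('n, 'f) mps ^ 'r) set"
  from q obtain b where V: "V \<subseteq> ?X" "submodule_over (mps_in C) (*s) V"
    and b: "\<And>j. j < m \<Longrightarrow> b j \<in> ?X"
      "\<And>w. w \<in> ?X \<Longrightarrow> \<exists>a. w - (\<Sum>j<m. mps_const (a j) *s b j) \<in> V"
      "\<And>a. (\<Sum>j<m. mps_const (a j) *s b j) \<in> V \<Longrightarrow> \<forall>j<m. a j = 0"
    unfolding quot_point_def by blast
  have span: "\<exists>w'\<in>mps_vs.span (b ` {..<k}). w - w' \<in> V"
    if "\<exists>a. w - (\<Sum>j<k. mps_const (a j) *s b j) \<in> V" for w b k
  proof -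
    from that obtain a where a: "w - (\<Sum>j<k. mps_const (a j) *s b j) \<in> V" by blast
    have "(\<Sum>j<k. mps_const (a j) *s b j) \<in> mps_vs.span (b ` {..<k})"
      by (rule mps_subspace_sum_const[OF mps_vs.subspace_span]) (simp add: mps_vs.span_base)
    with a show ?thesis by blast
  qed
  have "chain_length (mps_submodules C V) \<le> enat (card (b ` {..<m}))"
    by (rule mps_chain_length_le) (simp, rule span[OF b(2)])
  also have "\<dots> \<le> enat m" using card_image_le[of "{..<m}" b] by simp
  finally have le: "chain_length (mps_submodules C V) \<le> enat m" .
  then obtain k where k: "chain_length (mps_submodules C V) = enat k" "k \<le> m"
    by (cases "chain_length (mps_submodules C V)") auto
  have "quot_point C k V" by (rule chain_length_imp_quot_point[OF V(2,1) k(1)])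
  then obtain c where c: "\<And>w. w \<in> ?X \<Longrightarrow> \<exists>a. w - (\<Sum>j<k. mps_const (a j) *s c j) \<in> V"
    unfolding quot_point_def by blast
  \<comment> \<open>the partial spans of the basis \<open>b\<close> form a chain of subspaces of length \<open>m\<close>\<close>
  define N where "N i = {x + (\<Sum>j<i. mps_const (a j) *s b j) | x a. x \<in> V}" for i
  have N_sub: "mps_vs.subspace (N i)" for i
  proof -
    define S where "S = {\<Sum>j<i. mps_const (a j) *s b j | a. True}"
    have N_eq: "N i = {x + y | x y. x \<in> V \<and> y \<in> S}"
      unfolding N_def S_def by blast
    have "mps_vs.subspace S"
      unfolding mps_vs.subspace_def S_def
    proof (intro conjI allI ballI)
      show "0 \<in> {\<Sum>j<i. mps_const (a j) *s b j | a. True}"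
        by (auto intro!: exI[of _ "\<lambda>_. 0"])
      show "x + y \<in> {\<Sum>j<i. mps_const (a j) *s b j | a. True}"
        if xy: "x \<in> {\<Sum>j<i. mps_const (a j) *s b j | a. True}"
          "y \<in> {\<Sum>j<i. mps_const (a j) *s b j | a. True}" for x y
      proof -
        obtain a a' where "x = (\<Sum>j<i. mps_const (a j) *s b j)" "y = (\<Sum>j<i. mps_const (a' j) *s b j)"
          using xy by blast
        then have "x + y = (\<Sum>j<i. mps_const (a j + a' j) *s b j)"
          by (simp add: sum.distrib[symmetric] mps_const_add vector_sadd_rdistrib)
        then show ?thesis by (intro CollectI exI[of _ "\<lambda>j. a j + a' j"]) simp
      qed
      show "mps_scale e x \<in> {\<Sum>j<i. mps_const (a j) *s b j | a. True}"
        if x: "x \<in> {\<Sum>j<i. mps_const (a j) *s b j | a. True}" for e x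
      proof -
        obtain a where "x = (\<Sum>j<i. mps_const (a j) *s b j)" using x by blast
        then have "mps_scale e x = (\<Sum>j<i. mps_const (e * a j) *s b j)"
          by (simp add: mps_vs.scale_sum_right flip: mps_scale_def)
        then show ?thesis by (intro CollectI exI[of _ "\<lambda>j. e * a j"]) simp
      qed
    qed
    then show ?thesis
      unfolding N_eq by (rule mps_vs.subspace_sums[OF mps_submodule_subspace[OF V(2)]])
  qed
  have VN: "x \<in> N i" if "x \<in> V" for x i
    unfolding N_def using that by (intro CollectI exI[of _ x] exI[of _ "\<lambda>_. 0"]) simp
  have bN: "b i \<in> N (Suc i) - N i" if i: "i < m" for i
  proof
    have "b i = 0 + (\<Sum>j<Suc i. mps_const (if j = i then 1 else 0) *s b j)"
      by simp
    then show "b i \<in> N (Suc i)" unfolding N_def using submodule_overD(1)[OF V(2)]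
      by (intro CollectI exI[of _ 0] exI[of _ "\<lambda>j. if j = i then 1 else 0"]) simp
    show "b i \<notin> N i"
    proof
      assume "b i \<in> N i"
      then obtain x a where xa: "b i = x + (\<Sum>j<i. mps_const (a j) *s b j)" "x \<in> V"
        unfolding N_def by blast
      define a' where "a' j = (if j < i then - a j else if j = i then 1 else 0)" for j
      have "(\<Sum>j<m. mps_const (a' j) *s b j) = (\<Sum>j<Suc i. mps_const (a' j) *s b j)"
        by (rule sum.mono_neutral_right) (use i in \<open>auto simp: a'_def\<close>)
      also have "\<dots> = b i - (\<Sum>j<i. mps_const (a j) *s b j)"
      proof -
        have "(\<Sum>j<i. mps_const (a' j) *s b j) = (\<Sum>j<i. - (mps_const (a j) *s b j))"
          by (rule sum.cong)
            (auto simp: a'_def mps_vs.scale_minus_left simp flip: mps_scale_def)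
        then show ?thesis by (simp add: a'_def sum_negf)
      qed
      also have "\<dots> = x" using xa(1) by simp
      finally have "(\<Sum>j<m. mps_const (a' j) *s b j) \<in> V" using xa(2) by simp
      from b(3)[OF this] i show False by (auto simp: a'_def)
    qed
  qed
  have NN: "N i \<subseteq> N (Suc i)" for i
  proof
    fix y assume "y \<in> N i"
    then obtain x a where "y = x + (\<Sum>j<i. mps_const (a j) *s b j)" "x \<in> V" unfolding N_def by blast
    then show "y \<in> N (Suc i)" unfolding N_def
      by (intro CollectI exI[of _ x] exI[of _ "\<lambda>j. if j < i then a j else 0"]) simp
  qed
  have "m \<le> card (c ` {..<k})"
  proof (rule chain_le_generators[where X = ?X and V = V and N = N and u = b])
    show "\<exists>w'\<in>mps_vs.span (c ` {..<k}). w - w' \<in> V" if "w \<in> ?X" for w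
      by (rule span[OF c[OF that]])
  qed (use N_sub VN bN b(1) NN in auto)
  also have "\<dots> \<le> k" using card_image_le[of "{..<k}" c] by simp
  finally show ?thesis using k by simp
qed

lemma quot_point_contains_power:
  assumes "quot_point C m V"
  shows "vec_in (mps_in C) \<inter> vec_ord_ge m \<subseteq> V"
proof (rule chain_length_imp_quot_point(2)[OF _ _ quot_point_chain_length[OF assms]])
  show "submodule_over (mps_in C) (*s) V" "V \<subseteq> vec_in (mps_in C)"
    using assms by (auto simp: quot_point_def)
qed

section \<open>The polynomial ring is Noetherian\<close>

lemma nat_nondecreasing_subsequence:
  fixes s :: "nat \<Rightarrow> nat"
  obtains g :: "nat \<Rightarrow> nat" where "strict_mono g" "\<And>m n. m \<le> n \<Longrightarrow> s (g m) \<le> s (g n)"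
proof -
  obtain h :: "nat \<Rightarrow> nat" where h: "strict_mono h" "monoseq (\<lambda>n. s (h n))"
    using seq_monosub[of s] by blast
  show ?thesis
  proof (cases "\<forall>m. \<forall>n\<ge>m. s (h m) \<le> s (h n)")
    case True
    then show ?thesis using that[OF h(1)] by blast
  next
    case False
    then have dec: "\<forall>m. \<forall>n\<ge>m. s (h n) \<le> s (h m)" using h(2) unfolding monoseq_def by blast
    obtain N where N: "\<And>n. s (h N) \<le> s (h n)"
      using ex_has_least_nat[of "\<lambda>_. True" 0 "\<lambda>n. s (h n)"] by blast
    have "strict_mono (\<lambda>n. h (n + N))" using h(1) by (simp add: strict_mono_def)
    moreover have "s (h (m + N)) \<le> s (h (n + N))" for m n
    proof -
      have "s (h (m + N)) \<le> s (h N)" using dec by simp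
      also have "\<dots> \<le> s (h (n + N))" by (rule N)
      finally show ?thesis .
    qed
    ultimately show ?thesis using that by blast
  qed
qed

lemma dickson:
  fixes a :: "nat \<Rightarrow> 'n::finite multiindex"
  obtains i j where "i < j" "\<And>x. lookup (a i) x \<le> lookup (a j) x"
proof -
  have "\<exists>f :: nat \<Rightarrow> nat. strict_mono f \<and>
      (\<forall>x\<in>A. \<forall>m n. m \<le> n \<longrightarrow> lookup (a (f m)) x \<le> lookup (a (f n)) x)" for A :: "'n set"
    using finite[of A]
  proof induction
    case empty
    show ?case by (rule exI[of _ id]) (simp add: strict_mono_def)
  next
    case (insert x A)
    then obtain f :: "nat \<Rightarrow> nat" where f: "strict_mono f"
      "\<forall>x\<in>A. \<forall>m n. m \<le> n \<longrightarrow> lookup (a (f m)) x \<le> lookup (a (f n)) x" by blast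
    obtain g :: "nat \<Rightarrow> nat" where g: "strict_mono g"
      "\<And>m n. m \<le> n \<Longrightarrow> lookup (a (f (g m))) x \<le> lookup (a (f (g n))) x"
      using nat_nondecreasing_subsequence[of "\<lambda>n. lookup (a (f n)) x"] by blast
    have "strict_mono (f \<circ> g)" using f(1) g(1) by (simp add: strict_mono_def)
    moreover have "lookup (a ((f \<circ> g) m)) y \<le> lookup (a ((f \<circ> g) n)) y"
      if "y \<in> insert x A" "m \<le> n" for y m n
    proof (cases "y = x")
      case True
      then show ?thesis using g(2)[OF that(2)] by simp
    next
      case False
      have "g m \<le> g n" using g(1) that(2) by (simp add: strict_mono_less_eq)
      then show ?thesis using f(2) that(1) False by simp
    qed
    ultimately show ?case by blast
  qed
  from this[of UNIV] obtain f :: "nat \<Rightarrow> nat" where f: "strict_mono f"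
    "\<And>x m n. m \<le> n \<Longrightarrow> lookup (a (f m)) x \<le> lookup (a (f n)) x" by blast
  show ?thesis
    by (rule that[of "f 0" "f 1"]) (use f in \<open>auto simp: strict_mono_def\<close>)
qed

text \<open>The lexicographic monomial order for an arbitrary enumeration of the variables.\<close>

definition mless :: "'n::finite multiindex \<Rightarrow> 'n multiindex \<Rightarrow> bool" where
  "mless \<alpha> \<beta> \<longleftrightarrow> (\<exists>i. lookup \<alpha> i < lookup \<beta> i \<and>
    (\<forall>j. to_nat j < to_nat i \<longrightarrow> lookup \<alpha> j = lookup \<beta> j))"

lemma mless_total:
  assumes "\<alpha> \<noteq> \<beta>"
  shows "mless \<alpha> \<beta> \<or> mless \<beta> \<alpha>"
proof -
  obtain i where "lookup \<alpha> i \<noteq> lookup \<beta> i" using assms by (meson poly_mapping_eqI)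
  then obtain i where i: "lookup \<alpha> i \<noteq> lookup \<beta> i"
    "\<And>j. lookup \<alpha> j \<noteq> lookup \<beta> j \<Longrightarrow> to_nat i \<le> to_nat j"
    using ex_has_least_nat[of "\<lambda>i. lookup \<alpha> i \<noteq> lookup \<beta> i" i to_nat] by blast
  then have "\<And>j. to_nat j < to_nat i \<Longrightarrow> lookup \<alpha> j = lookup \<beta> j" by fastforce
  then show ?thesis using i(1) unfolding mless_def by (metis linorder_neqE_nat)
qed

lemma mless_trans:
  assumes "mless \<alpha> \<beta>" "mless \<beta> \<gamma>"
  shows "mless \<alpha> \<gamma>"
proof -
  obtain i j where i: "lookup \<alpha> i < lookup \<beta> i" "\<And>k. to_nat k < to_nat i \<Longrightarrow> lookup \<alpha> k = lookup \<beta> k"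
    and j: "lookup \<beta> j < lookup \<gamma> j" "\<And>k. to_nat k < to_nat j \<Longrightarrow> lookup \<beta> k = lookup \<gamma> k"
    using assms unfolding mless_def by blast
  consider "to_nat i < to_nat j" | "to_nat j < to_nat i" | "i = j"
    by (metis inj_to_nat injD linorder_neqE_nat)
  then show ?thesis
  proof cases
    case 1
    then show ?thesis unfolding mless_def using i j by (intro exI[of _ i]) auto
  next
    case 2
    then show ?thesis unfolding mless_def using i j by (intro exI[of _ j]) auto
  next
    case 3
    then show ?thesis unfolding mless_def using i j by (intro exI[of _ i]) auto
  qed
qed

lemma mless_add: "mless \<alpha> \<beta> \<Longrightarrow> mless (\<gamma> + \<alpha>) (\<gamma> + \<beta>)"
  unfolding mless_def by (simp add: lookup_add)

lemma not_mless_if_le: "(\<And>x. lookup \<alpha> x \<le> lookup \<beta> x) \<Longrightarrow> \<not> mless \<beta> \<alpha>"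
  unfolding mless_def by (meson not_le)

text \<open>Along a descending sequence no monomial divides a later one, contrary to Dickson's lemma.\<close>

lemma wf_mless: "wf {(\<alpha>, \<beta> :: 'n::finite multiindex). mless \<alpha> \<beta>}"
  unfolding wf_iff_no_infinite_down_chain
proof (rule notI, clarsimp)
  fix a :: "nat \<Rightarrow> 'n multiindex" assume a: "\<forall>i. mless (a (Suc i)) (a i)"
  have desc: "mless (a j) (a i)" if "i < j" for i j
    using that
  proof (induction j)
    case (Suc j)
    then show ?case using a mless_trans[of "a (Suc j)" "a j" "a i"] by (cases "i = j") auto
  qed simp
  obtain i j where "i < j" "\<And>x. lookup (a i) x \<le> lookup (a j) x" using dickson[of a] by blast
  then show False using desc not_mless_if_le by blast
qed

definition is_leading :: "('n::finite, 'a::zero) mpol \<Rightarrow> 'n multiindex \<Rightarrow> bool" where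
  "is_leading f \<alpha> \<longleftrightarrow> \<alpha> \<in> keys f \<and> (\<forall>\<beta>\<in>keys f. \<beta> \<noteq> \<alpha> \<longrightarrow> mless \<beta> \<alpha>)"

lemma ex_leading:
  assumes "f \<noteq> 0"
  shows "\<exists>\<alpha>. is_leading f \<alpha>"
proof -
  have "\<exists>\<alpha>\<in>A. \<forall>\<beta>\<in>A. \<beta> \<noteq> \<alpha> \<longrightarrow> mless \<beta> \<alpha>" if "finite A" "A \<noteq> {}" for A :: "'a multiindex set"
    using that
  proof (induction rule: finite_ne_induct)
    case (insert x A)
    then obtain \<alpha> where al: "\<alpha> \<in> A" "\<forall>\<beta>\<in>A. \<beta> \<noteq> \<alpha> \<longrightarrow> mless \<beta> \<alpha>" by blast
    from insert.hyps al(1) have "x \<noteq> \<alpha>" by blast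
    then consider "mless x \<alpha>" | "mless \<alpha> x" using mless_total by blast
    then show ?case
    proof cases
      case 1
      then show ?thesis using al by (intro bexI[of _ \<alpha>]) auto
    next
      case 2
      then have "mless \<beta> x" if "\<beta> \<in> A" for \<beta>
        using al(2) that mless_trans by (cases "\<beta> = \<alpha>") blast+
      then show ?thesis by (intro bexI[of _ x]) auto
    qed
  qed auto
  from this[of "keys f"] show ?thesis using assms by (auto simp: is_leading_def)
qed

lemma monomial_mult_eq:
  fixes g :: "('n::finite, 'a::comm_ring_1) mpol"
  shows "Poly_Mapping.single \<gamma> c * g = (\<Sum>\<beta>\<in>keys g. Poly_Mapping.single (\<gamma> + \<beta>) (c * lookup g \<beta>))"
  by (subst mpol_sum_monomials[of g]) (simp add: sum_distrib_left mult_single)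

lemma lookup_monomial_mult:
  fixes g :: "('n::finite, 'a::comm_ring_1) mpol"
  shows "lookup (Poly_Mapping.single \<gamma> c * g) (\<gamma> + \<beta>) = c * lookup g \<beta>"
  unfolding monomial_mult_eq by (auto simp: lookup_sum lookup_single when_def in_keys_iff)

lemma keys_monomial_mult:
  fixes g :: "('n::finite, 'a::comm_ring_1) mpol"
  assumes "\<delta> \<in> keys (Poly_Mapping.single \<gamma> c * g)"
  shows "\<exists>\<beta>\<in>keys g. \<delta> = \<gamma> + \<beta>"
proof (rule ccontr)
  assume "\<not> (\<exists>\<beta>\<in>keys g. \<delta> = \<gamma> + \<beta>)"
  then have "lookup (Poly_Mapping.single \<gamma> c * g) \<delta> = 0"
    unfolding monomial_mult_eq lookup_sum by (intro sum.neutral) (auto simp: lookup_single when_def)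
  with assms show False by (simp add: in_keys_iff)
qed

text \<open>Hilbert's basis theorem as an ascending chain condition. In each step of a strictly ascending
  chain choose a new element \<open>g n\<close> whose leading monomial is minimal. By Dickson's lemma some leading
  monomial divides a later one, and one reduction step yields a smaller leading monomial.\<close>

lemma noetherian:
  fixes I :: "nat \<Rightarrow> ('n::finite, 'k::field) mpol set"
  assumes ideal: "\<And>n. submodule_over UNIV (*) (I n)" and strict: "\<And>n. I n \<subset> I (Suc n)"
  shows False
proof -
  define L where "L n = {\<alpha>. \<exists>g \<in> I (Suc n) - I n. is_leading g \<alpha>}" for n
  have LI: "\<alpha> \<in> L n" if "g \<in> I (Suc n) - I n" "is_leading g \<alpha>" for g \<alpha> n
    unfolding L_def using that by blast
  have "\<forall>n. \<exists>\<alpha>. \<alpha> \<in> L n \<and> (\<forall>\<beta>. mless \<beta> \<alpha> \<longrightarrow> \<beta> \<notin> L n)"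
  proof
    fix n
    obtain g where g: "g \<in> I (Suc n) - I n" using strict[of n] by blast
    then have "g \<noteq> 0" using submodule_overD(1)[OF ideal[of n]] by auto
    then obtain \<alpha> where "is_leading g \<alpha>" using ex_leading by blast
    with g have "\<alpha> \<in> L n" by (rule LI)
    with wf_mless obtain \<alpha> where "\<alpha> \<in> L n" "\<And>\<beta>. (\<beta>, \<alpha>) \<in> {(\<alpha>, \<beta>). mless \<alpha> \<beta>} \<Longrightarrow> \<beta> \<notin> L n"
      by (rule wfE_min) blast
    then show "\<exists>\<alpha>. \<alpha> \<in> L n \<and> (\<forall>\<beta>. mless \<beta> \<alpha> \<longrightarrow> \<beta> \<notin> L n)" by blast
  qed
  from choice[OF this] obtain a where a: "\<And>n. a n \<in> L n" "\<And>n \<beta>. mless \<beta> (a n) \<Longrightarrow> \<beta> \<notin> L n"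
    by blast
  have "\<forall>n. \<exists>g. g \<in> I (Suc n) - I n \<and> is_leading g (a n)" using a(1) unfolding L_def by blast
  from choice[OF this] obtain g where g: "\<And>n. g n \<in> I (Suc n) - I n" "\<And>n. is_leading (g n) (a n)"
    by blast
  obtain i j where ij: "i < j" "\<And>x. lookup (a i) x \<le> lookup (a j) x" using dickson[of a] by blast
  have "I (Suc i) \<subseteq> I j"
    by (rule lift_Suc_mono_le[of I]) (use strict ij(1) in \<open>auto simp: Suc_le_eq\<close>)
  then have gi: "g i \<in> I j" using g(1)[of i] by blast
  define \<gamma> where "\<gamma> = a j - a i"
  have aj: "a j = \<gamma> + a i"
    unfolding \<gamma>_def by (rule poly_mapping_eqI) (use ij(2) in \<open>simp add: lookup_add lookup_minus\<close>)
  define c where "c = lookup (g j) (a j) / lookup (g i) (a i)"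
  define h where "h = Poly_Mapping.single \<gamma> c * g i"
  have h: "- h \<in> I j" "h \<in> I j"
    using submodule_overD(3)[OF ideal _ gi, of "Poly_Mapping.single \<gamma> c"]
      submodule_overD(3)[OF ideal _ gi, of "- Poly_Mapping.single \<gamma> c"]
    by (simp_all add: h_def)
  have "g j + - h \<in> I (Suc j)"
    using g(1)[of j] h strict[of j] by (intro submodule_overD(2)[OF ideal]) auto
  moreover have "g j + - h \<notin> I j"
  proof
    assume "g j + - h \<in> I j"
    from submodule_overD(2)[OF ideal this h(2)] show False using g(1)[of j] by simp
  qed
  ultimately have new: "g j + - h \<in> I (Suc j) - I j" by blast
  then have "g j + - h \<noteq> 0" using submodule_overD(1)[OF ideal[of j]] by auto
  then obtain \<beta> where b: "is_leading (g j + - h) \<beta>" using ex_leading by blast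
  then have bk: "\<beta> \<in> keys (g j + - h)" by (simp add: is_leading_def)
  have "lookup (g i) (a i) \<noteq> 0" using g(2)[of i] by (simp add: is_leading_def in_keys_iff)
  then have "c * lookup (g i) (a i) = lookup (g j) (a j)" by (simp add: c_def)
  moreover have "lookup h (a j) = c * lookup (g i) (a i)"
    unfolding h_def aj by (rule lookup_monomial_mult)
  ultimately have "lookup (g j + - h) (a j) = 0" by (simp add: lookup_minus)
  then have "\<beta> \<noteq> a j" using bk by (auto simp: in_keys_iff)
  from bk have "lookup (g j) \<beta> \<noteq> 0 \<or> lookup h \<beta> \<noteq> 0" by (auto simp: in_keys_iff lookup_minus)
  then have "\<beta> \<in> keys (g j) \<or> \<beta> \<in> keys h" by (simp add: in_keys_iff)
  then have "mless \<beta> (a j)"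
  proof
    assume "\<beta> \<in> keys (g j)"
    then show ?thesis using g(2)[of j] \<open>\<beta> \<noteq> a j\<close> by (simp add: is_leading_def)
  next
    assume "\<beta> \<in> keys h"
    then obtain \<delta> where d: "\<delta> \<in> keys (g i)" "\<beta> = \<gamma> + \<delta>" using keys_monomial_mult h_def by blast
    with \<open>\<beta> \<noteq> a j\<close> aj have "\<delta> \<noteq> a i" by auto
    with d(1) g(2)[of i] have "mless \<delta> (a i)" by (simp add: is_leading_def)
    then show ?thesis unfolding d(2) aj by (rule mless_add)
  qed
  then have "\<beta> \<notin> L j" by (rule a(2))
  with LI[OF new b] show False by blast
qed

lemma ex_maximal_ideal_in_family:
  fixes F :: "('n::finite, 'k::field) mpol set set"
  assumes "\<And>I. I \<in> F \<Longrightarrow> submodule_over UNIV (*) I" "I0 \<in> F"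
  shows "\<exists>I\<in>F. \<forall>J\<in>F. I \<subseteq> J \<longrightarrow> J = I"
proof (rule ccontr)
  assume no: "\<not> (\<exists>I\<in>F. \<forall>J\<in>F. I \<subseteq> J \<longrightarrow> J = I)"
  then have "\<forall>I\<in>F. \<exists>J. J \<in> F \<and> I \<subset> J" by blast
  from bchoice[OF this] obtain nx where nx: "\<forall>I\<in>F. nx I \<in> F \<and> I \<subset> nx I" by blast
  have in_F: "(nx ^^ n) I0 \<in> F" for n
    by (induction n) (use assms(2) nx in auto)
  show False
  proof (rule noetherian[of "\<lambda>n. (nx ^^ n) I0"])
    show "submodule_over UNIV (*) ((nx ^^ n) I0)" for n by (rule assms(1)[OF in_F])
    show "(nx ^^ n) I0 \<subset> (nx ^^ Suc n) I0" for n using nx in_F[of n] by simp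
  qed
qed

section \<open>Primary submodules\<close>

text \<open>An element killed modulo \<open>U\<close> by some \<open>s \<notin> P\<close> would, by the ascending chain condition on
  annihilators, have a multiple whose annihilator is an associated prime containing \<open>s\<close>.\<close>

lemma primary_imp_saturated:
  fixes smul :: "('n::finite, 'k::field) mpol \<Rightarrow> 'm::ab_group_add \<Rightarrow> 'm"
  assumes M: "module smul" and U: "primary_submodule P smul U"
  shows "saturated P smul U"
proof -
  interpret module smul by (rule M)
  have sub: "subspace U" and ass: "ass_quotient smul U = {P}"
    using U by (auto simp: primary_submodule_def)
  have "x \<in> U" if s: "s \<notin> P" and sx: "smul s x \<in> U" for s x
  proof (rule ccontr)
    assume x: "x \<notin> U"
    define F where "F = {{a. smul a (smul b x) \<in> U} | b. smul b x \<notin> U}"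
    have ideal: "submodule_over UNIV (*) I" if I: "I \<in> F" for I
    proof -
      obtain b where b: "I = {a. smul a (smul b x) \<in> U}" using I unfolding F_def by blast
      have "smul (c * a) (smul b x) \<in> U" if "smul a (smul b x) \<in> U" for a c
        using subspace_scale[OF sub that, of c] by (simp add: mult.assoc)
      then show ?thesis unfolding b
        using subspace_0[OF sub] subspace_add[OF sub]
        by (auto simp: submodule_over_def scale_left_distrib simp del: scale_scale)
    qed
    have "smul 1 x \<notin> U" using x by simp
    then have "{a. smul a (smul 1 x) \<in> U} \<in> F" unfolding F_def by blast
    from ex_maximal_ideal_in_family[of F, OF ideal this]
    obtain Q where Q: "Q \<in> F" "\<And>J. J \<in> F \<Longrightarrow> Q \<subseteq> J \<Longrightarrow> J = Q" by blast
    then obtain b where b: "Q = {a. smul a (smul b x) \<in> U}" "smul b x \<notin> U" unfolding F_def by blast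
    have "prime_ideal Q"
      unfolding prime_ideal_def
    proof (intro conjI allI impI)
      show "module.subspace (*) Q"
        using ideal[OF Q(1)] by (auto simp: module.subspace_def[OF module_mult] submodule_over_def)
      have "1 \<notin> Q" using b by simp
      then show "Q \<noteq> UNIV" by blast
      fix c d assume cd: "c * d \<in> Q"
      show "c \<in> Q \<or> d \<in> Q"
      proof (cases "d \<in> Q")
        case False
        define J where "J = {a. smul a (smul (d * b) x) \<in> U}"
        have "smul (d * b) x \<notin> U" using False b(1) by simp
        then have "J \<in> F" unfolding F_def J_def by blast
        moreover have "Q \<subseteq> J"
        proof
          fix a assume "a \<in> Q"
          then have "smul d (smul a (smul b x)) \<in> U" using b(1) subspace_scale[OF sub] by blast
          then show "a \<in> J" by (simp add: J_def ac_simps)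
        qed
        ultimately have "J = Q" by (rule Q(2))
        moreover have "c \<in> J" using cd by (simp add: J_def b(1) mult.assoc)
        ultimately show ?thesis by blast
      qed simp
    qed
    then have "Q \<in> ass_quotient smul U" unfolding ass_quotient_def b(1) by blast
    then have "Q = P" using ass by blast
    moreover have "s \<in> Q"
    proof -
      have "smul b (smul s x) \<in> U" using sx by (rule subspace_scale[OF sub])
      then show ?thesis by (simp add: b(1) mult.commute)
    qed
    ultimately show False using s by blast
  qed
  moreover have "submodule_over UNIV smul U"
    using sub by (auto simp: subspace_def submodule_over_def)
  ultimately show ?thesis unfolding saturated_def by blast
qed

lemma power_in_ideal_power: "p \<in> P \<Longrightarrow> p ^ m \<in> ideal_power P m"
  by (induction m) (auto intro!: hull_inc)

text \<open>With \<open>k\<close> minimal such that \<open>P\<^sup>k M \<subseteq> U\<close>, any element of \<open>P\<^bsup>k - 1\<^esup> M\<close> outside \<open>U\<close> has annihilator exactly \<open>P\<close>. Any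
  associated prime contains a power of each element of \<open>P\<close>, and is contained in \<open>P\<close> by saturation.\<close>

lemma saturated_imp_primary:
  assumes P: "prime_ideal P" and M: "module smul" and U: "saturated P smul U" "U \<noteq> UNIV"
    and pow: "\<And>g w. g \<in> ideal_power P m \<Longrightarrow> smul g w \<in> U"
  shows "primary_submodule P smul U"
proof -
  interpret module smul by (rule M)
  note u = saturatedD[OF U(1)]
  let ?K = "\<lambda>k. \<forall>g\<in>ideal_power P k. \<forall>w. smul g w \<in> U"
  define k where "k = (LEAST k. ?K k)"
  have "?K m" using pow by blast
  then have k: "?K k" unfolding k_def by (rule LeastI)
  have "\<not> ?K 0"
  proof
    assume "?K 0"
    then have "smul 1 w \<in> U" for w by (metis UNIV_I ideal_power.simps(1))
    then show False using U(2) by auto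
  qed
  with k have "k \<noteq> 0" by metis
  then obtain k' where k': "k = Suc k'" by (cases k) auto
  have "\<not> ?K k'" unfolding k_def using not_less_Least[of k' ?K] k' k_def by simp
  then obtain q w where q: "q \<in> ideal_power P k'" "smul q w \<notin> U" by blast
  have "P = {a. smul a (smul q w) \<in> U}"
  proof (intro set_eqI iffI CollectI)
    fix a assume "a \<in> P"
    then have "a * q \<in> ideal_power P k" unfolding k' using q(1) by (rule ideal_power_Suc)
    then have "smul (a * q) w \<in> U" using k by blast
    then show "smul a (smul q w) \<in> U" by simp
  next
    fix a assume "a \<in> {a. smul a (smul q w) \<in> U}"
    then show "a \<in> P" using u(4)[of a] q(2) by blast
  qed
  with P have "P \<in> ass_quotient smul U" unfolding ass_quotient_def by blast
  moreover have "Q = P" if ass: "Q \<in> ass_quotient smul U" for Q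
  proof -
    obtain x where Q: "prime_ideal Q" "Q = {a. smul a x \<in> U}" using ass unfolding ass_quotient_def by blast
    have "1 \<notin> Q" by (rule prime_idealD(4)[OF Q(1)])
    then have x: "x \<notin> U" by (simp add: Q(2))
    have "P \<subseteq> Q"
    proof
      fix p assume "p \<in> P"
      then have "p ^ m \<in> Q" using pow power_in_ideal_power Q(2) by blast
      then show "p \<in> Q" using prime_ideal_power[OF Q(1)] by blast
    qed
    moreover have "Q \<subseteq> P" using u(4) x Q(2) by blast
    ultimately show ?thesis by blast
  qed
  ultimately have "ass_quotient smul U = {P}" by blast
  moreover have "subspace U" using u(1-3) by (simp add: subspace_def)
  ultimately show ?thesis by (simp add: primary_submodule_def)
qed

section \<open>Submodules of the localization\<close>

text \<open>Clearing denominators identifies submodules of \<open>M\<^sub>P\<close> with saturated submodules of \<open>M\<close>, in both directions strictly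
  monotonically; hence chains have the same lengths.\<close>

lemma multiplicity_eq_chain_length:
  assumes P: "prime_ideal P" and M: "module smul" and U: "saturated P smul U"
  shows "multiplicity_over P smul U = chain_length {N. saturated P smul N \<and> U \<subseteq> N}"
proof -
  interpret module smul by (rule M)
  let ?q = "loc_frac P smul"
  let ?S = "{N. local_submodule P smul N \<and> localization P smul U \<subseteq> N}"
  let ?T = "{N. saturated P smul N \<and> U \<subseteq> N}"
  let ?f = "\<lambda>N. {x. ?q x 1 \<in> N}"
  have one: "1 \<notin> P" by (rule prime_idealD(4)[OF P])
  have loc: "N \<subseteq> localization P smul UNIV" "?q 0 1 \<in> N"
    "\<And>x y s t. s \<notin> P \<Longrightarrow> t \<notin> P \<Longrightarrow> ?q x s \<in> N \<Longrightarrow> ?q y t \<in> N \<Longrightarrow>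
      ?q (smul t x + smul s y) (s * t) \<in> N"
    "\<And>a x s t. s \<notin> P \<Longrightarrow> t \<notin> P \<Longrightarrow> ?q x t \<in> N \<Longrightarrow> ?q (smul a x) (s * t) \<in> N"
    if "local_submodule P smul N" for N
    using that unfolding local_submodule_def by blast+
  have cancel: "?q (smul s x) s = ?q x 1" if "s \<notin> P" for s x
    by (rule loc_frac_eqI[OF P M that one one]) simp
  have num: "?q x s \<in> N \<longleftrightarrow> ?q x 1 \<in> N" if N: "local_submodule P smul N" and s: "s \<notin> P" for N x s
  proof
    assume "?q x s \<in> N"
    from loc(4)[OF N one s this, of s] show "?q x 1 \<in> N" by (simp add: cancel[OF s])
  next
    assume "?q x 1 \<in> N"
    from loc(4)[OF N s one this, of 1] show "?q x s \<in> N" by simp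
  qed
  have numN: "?q x s \<in> localization P smul N \<longleftrightarrow> x \<in> N"
    if N: "saturated P smul N" and s: "s \<notin> P" for N x s
  proof
    assume "?q x s \<in> localization P smul N"
    then obtain y t where y: "?q x s = ?q y t" "y \<in> N" "t \<notin> P" unfolding localization_def by blast
    from loc_frac_eqD[OF P M y(1,3)] obtain u where u: "u \<notin> P" "smul u (smul t x - smul s y) = 0" by blast
    then have "smul (u * t) x = smul (u * s) y" by (simp add: scale_right_diff_distrib)
    then have "smul (u * t) x \<in> N" using saturatedD(3)[OF N y(2)] by simp
    moreover have "u * t \<notin> P" using u y prime_idealD(5)[OF P] by blast
    ultimately show "x \<in> N" using saturatedD(4)[OF N] by blast
  next
    assume "x \<in> N"
    then show "?q x s \<in> localization P smul N" unfolding localization_def using s by blast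
  qed
  show ?thesis
    unfolding multiplicity_over_def
  proof (rule antisym)
    show "chain_length ?S \<le> chain_length ?T"
    proof (rule chain_length_le[of _ ?f])
      fix N assume "N \<in> ?S"
      then have N: "local_submodule P smul N" "localization P smul U \<subseteq> N" by auto
      have "saturated P smul (?f N)"
        unfolding saturated_def submodule_over_def
      proof (intro conjI ballI allI impI CollectI)
        show "?q 0 1 \<in> N" by (rule loc(2)[OF N(1)])
        show "?q (x + y) 1 \<in> N" if "x \<in> ?f N" "y \<in> ?f N" for x y
          using loc(3)[OF N(1) one one, of x y] that by simp
        show "?q (smul a x) 1 \<in> N" if "x \<in> ?f N" for a x
          using loc(4)[OF N(1) one one, of x a] that by simp
        show "?q x 1 \<in> N" if "s \<notin> P" "smul s x \<in> ?f N" for s x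
        proof -
          have "?q (smul s x) s \<in> N" using num[OF N(1) that(1)] that(2) by simp
          then show ?thesis by (simp add: cancel[OF that(1)])
        qed
      qed
      moreover have "U \<subseteq> ?f N" using numN[OF U one] N(2) by blast
      ultimately show "?f N \<in> ?T" by blast
    next
      fix N N' assume NN: "N \<in> ?S" "N' \<in> ?S" "N \<subset> N'"
      then have L: "local_submodule P smul N" "local_submodule P smul N'" by auto
      obtain z where z: "z \<in> N'" "z \<notin> N" using NN(3) by blast
      then obtain x s where xs: "z = ?q x s" "s \<notin> P"
        using loc(1)[OF L(2)] unfolding localization_def by blast
      then have "x \<in> ?f N'" "x \<notin> ?f N" using num[OF L(1) xs(2)] num[OF L(2) xs(2)] z by auto
      moreover have "?f N \<subseteq> ?f N'" using NN(3) by blast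
      ultimately show "?f N \<subset> ?f N'" by blast
    qed
    show "chain_length ?T \<le> chain_length ?S"
    proof (rule chain_length_le[of _ "localization P smul"])
      fix N assume "N \<in> ?T"
      then have N: "saturated P smul N" "U \<subseteq> N" by auto
      note n = saturatedD[OF N(1)]
      have "local_submodule P smul (localization P smul N)"
        unfolding local_submodule_def
      proof (intro conjI allI impI; (elim conjE)?)
        show "localization P smul N \<subseteq> localization P smul UNIV" unfolding localization_def by blast
        show "?q 0 1 \<in> localization P smul N" using numN[OF N(1) one] n(1) by blast
        fix x y s t assume s: "s \<notin> P" and t: "t \<notin> P"
        have st: "s * t \<notin> P" by (rule prime_idealD(5)[OF P s t])
        show "?q (smul t x + smul s y) (s * t) \<in> localization P smul N"
          if "?q x s \<in> localization P smul N" "?q y t \<in> localization P smul N"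
          using that n(2,3) unfolding numN[OF N(1) s] numN[OF N(1) t] numN[OF N(1) st] by blast
        show "?q (smul a x) (s * t) \<in> localization P smul N"
          if "?q x t \<in> localization P smul N" for a
          using that n(3) unfolding numN[OF N(1) t] numN[OF N(1) st] by blast
      qed
      moreover have "localization P smul U \<subseteq> localization P smul N"
        using N(2) unfolding localization_def by blast
      ultimately show "localization P smul N \<in> ?S" by blast
    next
      fix N N' assume NN: "N \<in> ?T" "N' \<in> ?T" "N \<subset> N'"
      then have L: "saturated P smul N" "saturated P smul N'" by auto
      obtain x where "x \<in> N'" "x \<notin> N" using NN(3) by blast
      then have "?q x 1 \<in> localization P smul N'" "?q x 1 \<notin> localization P smul N"
        using numN[OF L(1) one] numN[OF L(2) one] by auto
      moreover have "localization P smul N \<subseteq> localization P smul N'"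
        using NN(3) unfolding localization_def by blast
      ultimately show "localization P smul N \<subset> localization P smul N'" by blast
    qed
  qed
qed

lemma saturated_vimage:
  assumes hom: "module_hom smul smul' \<pi>" and N: "saturated P smul' N"
  shows "saturated P smul (\<pi> -` N)"
proof -
  interpret module_hom smul smul' \<pi> by (rule hom)
  note n = saturatedD[OF N]
  show ?thesis
    unfolding saturated_def submodule_over_def
  proof (intro conjI ballI allI impI vimageI2)
    show "\<pi> 0 \<in> N" using n(1) by (simp add: zero)
    show "\<pi> (x + y) \<in> N" if "x \<in> \<pi> -` N" "y \<in> \<pi> -` N" for x y using that n(2) by (simp add: add)
    show "\<pi> (smul a x) \<in> N" if "x \<in> \<pi> -` N" for a x using that n(3) by (simp add: scale)
    show "\<pi> x \<in> N" if "s \<notin> P" "smul s x \<in> \<pi> -` N" for s x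
      using that n(4)[OF that(1), of "\<pi> x"] by (simp add: scale)
  qed
qed

lemma vimage_image_eq_if_kernel:
  assumes hom: "module_hom smul smul' \<pi>" and N: "submodule_over UNIV smul N" "{v. \<pi> v = 0} \<subseteq> N"
  shows "\<pi> -` (\<pi> ` N) = N"
proof
  interpret module_hom smul smul' \<pi> by (rule hom)
  show "\<pi> -` (\<pi> ` N) \<subseteq> N"
  proof
    fix x assume "x \<in> \<pi> -` (\<pi> ` N)"
    then obtain y where y: "\<pi> x = \<pi> y" "y \<in> N" by auto
    then have "x - y \<in> N" using N(2) by (auto simp: diff)
    from submodule_overD(2)[OF N(1) this y(2)] show "x \<in> N" by simp
  qed
qed auto

lemma saturated_image:
  assumes hom: "module_hom smul smul' \<pi>" and surj: "surj \<pi>"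
    and N: "saturated P smul N" "{v. \<pi> v = 0} \<subseteq> N"
  shows "saturated P smul' (\<pi> ` N)"
proof -
  interpret module_hom smul smul' \<pi> by (rule hom)
  note n = saturatedD[OF N(1)]
  note vi = vimage_image_eq_if_kernel[OF hom n(5) N(2)]
  show ?thesis
    unfolding saturated_def submodule_over_def
  proof (intro conjI ballI allI impI)
    show "0 \<in> \<pi> ` N" using n(1) zero by (metis imageI)
    show "x + y \<in> \<pi> ` N" if "x \<in> \<pi> ` N" "y \<in> \<pi> ` N" for x y
      using that n(2) by (auto simp flip: add)
    show "smul' a x \<in> \<pi> ` N" if "x \<in> \<pi> ` N" for a x
      using that n(3) by (auto simp flip: scale)
    show "x \<in> \<pi> ` N" if s: "s \<notin> P" "smul' s x \<in> \<pi> ` N" for s x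
    proof -
      obtain w where w: "x = \<pi> w" using surj by (metis surjD)
      have "smul s w \<in> \<pi> -` (\<pi> ` N)" using s(2) by (simp add: w scale)
      then have "w \<in> N" using vi n(4)[OF s(1)] by blast
      then show ?thesis by (simp add: w)
    qed
  qed
qed

text \<open>The correspondence between submodules of the quotient and submodules of the free module that contain the
  kernel.\<close>

lemma chain_length_vimage:
  assumes hom: "module_hom smul smul' \<pi>" and surj: "surj \<pi>" and U: "saturated P smul' U"
  shows "chain_length {N. saturated P smul' N \<and> U \<subseteq> N} =
    chain_length {N. saturated P smul N \<and> \<pi> -` U \<subseteq> N}" (is "chain_length ?S = chain_length ?T")
proof (rule antisym)
  interpret module_hom smul smul' \<pi> by (rule hom)
  have ker: "{v. \<pi> v = 0} \<subseteq> N" if "\<pi> -` U \<subseteq> N" for N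
    using that saturatedD(1)[OF U] by auto
  show "chain_length ?S \<le> chain_length ?T"
  proof (rule chain_length_le[of _ "vimage \<pi>"])
    show "\<pi> -` N \<in> ?T" if "N \<in> ?S" for N using that saturated_vimage[OF hom] by blast
    show "\<pi> -` N \<subset> \<pi> -` N'" if NN: "N \<subset> N'" for N N'
    proof -
      obtain x where x: "x \<in> N'" "x \<notin> N" using NN by blast
      obtain w where "x = \<pi> w" using surj by (metis surjD)
      then show ?thesis using NN x by blast
    qed
  qed
  show "chain_length ?T \<le> chain_length ?S"
  proof (rule chain_length_le[of _ "image \<pi>"])
    show "\<pi> ` N \<in> ?S" if N: "N \<in> ?T" for N
    proof -
      have "saturated P smul' (\<pi> ` N)" using N ker by (intro saturated_image[OF hom surj]) auto
      moreover have "U \<subseteq> \<pi> ` N"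
      proof
        fix x assume "x \<in> U"
        moreover obtain w where "x = \<pi> w" using surj by (metis surjD)
        ultimately show "x \<in> \<pi> ` N" using N by blast
      qed
      ultimately show ?thesis by blast
    qed
    show "\<pi> ` N \<subset> \<pi> ` N'" if N: "N \<in> ?T" "N' \<in> ?T" "N \<subset> N'" for N N'
    proof -
      have "\<pi> -` (\<pi> ` N) = N" "\<pi> -` (\<pi> ` N') = N'"
        using N ker saturatedD(5) by (auto intro!: vimage_image_eq_if_kernel[OF hom])
      then have "\<pi> ` N \<noteq> \<pi> ` N'" using N(3) by (metis less_irrefl)
      then show ?thesis using N(3) by blast
    qed
  qed
qed

section \<open>The action of power series on polynomials\<close>

interpretation mpol_vs: vector_space
  "mpol_vec_scale :: 'f::field \<Rightarrow> ('n, 'f) mpol ^ 'r \<Rightarrow> ('n, 'f) mpol ^ 'r"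
  by (rule vector_space_mpol_vec_scale)

interpretation wn_vs: vector_space
  "wn_scale :: 'f::field \<Rightarrow> ('n, 'f, 'r::finite) weyl_noether \<Rightarrow> ('n, 'f, 'r) weyl_noether"
  by (rule vector_space_wn_scale)

interpretation mpol_functional: vector_space_pair
  "mpol_vec_scale :: 'f::field \<Rightarrow> ('n, 'f) mpol ^ 'r \<Rightarrow> ('n, 'f) mpol ^ 'r" "(*) :: 'f \<Rightarrow> 'f \<Rightarrow> 'f"
  by unfold_locales (auto simp: algebra_simps)

interpretation mpol_wn: vector_space_pair
  "mpol_vec_scale :: 'f::field \<Rightarrow> ('n, 'f) mpol ^ 'r::finite \<Rightarrow> ('n, 'f) mpol ^ 'r"
  "wn_scale :: 'f \<Rightarrow> ('n, 'f, 'r) weyl_noether \<Rightarrow> ('n, 'f, 'r) weyl_noether"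
  by unfold_locales

lemma lookup_const_mult [simp]:
  fixes e :: "('n::finite, 'f::comm_ring_1) mpol"
  shows "lookup (mpol_const a * e) \<beta> = a * lookup e \<beta>"
  using lookup_monomial_mult[of 0 a e \<beta>] by (simp add: mpol_const_def)

lemma mderiv_const_mult:
  fixes e :: "('n::finite, 'f::comm_ring_1) mpol"
  shows "mderiv \<alpha> (mpol_const a * e) = mpol_const a * mderiv \<alpha> e"
  by (rule poly_mapping_eqI) (simp add: lookup_mderiv mult.left_commute)

lemma mpol_const_zero [simp]: "mpol_const 0 = 0"
  by (simp add: mpol_const_def)

lemma mps_act_superset:
  assumes "finite A" "{\<alpha>. mderiv \<alpha> e \<noteq> 0} \<subseteq> A"
  shows "mps_act b e = (\<Sum>\<alpha>\<in>A. mpol_const (mps_coeff b \<alpha>) * mderiv \<alpha> e)"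
  unfolding mps_act_def by (rule sum.mono_neutral_left) (use assms in auto)

lemma mps_act_add_left: "mps_act (b + c) e = mps_act b e + mps_act c e"
  by (simp add: mps_act_def mpol_const_add distrib_right sum.distrib)

lemma mps_act_zero_left [simp]: "mps_act 0 e = 0"
  by (simp add: mps_act_def)

lemma mps_act_zero_right [simp]: "mps_act b 0 = 0"
  by (simp add: mps_act_def)

lemma mps_act_add_right: "mps_act b (e + e') = mps_act b e + mps_act b e'"
proof -
  let ?A = "{\<alpha>. mderiv \<alpha> e \<noteq> 0} \<union> {\<alpha>. mderiv \<alpha> e' \<noteq> 0} \<union> {\<alpha>. mderiv \<alpha> (e + e') \<noteq> 0}"
  have "mps_act b f = (\<Sum>\<alpha>\<in>?A. mpol_const (mps_coeff b \<alpha>) * mderiv \<alpha> f)"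
    if "{\<alpha>. mderiv \<alpha> f \<noteq> 0} \<subseteq> ?A" for f
    by (rule mps_act_superset[OF _ that]) simp
  from this[of e] this[of e'] this[of "e + e'"] show ?thesis
    by (simp add: Un_upper1 le_supI1 mderiv_add distrib_left sum.distrib subset_iff)
qed

lemma mps_act_sum_right: "mps_act b (sum f A) = (\<Sum>x\<in>A. mps_act b (f x))"
  by (induction A rule: infinite_finite_induct) (auto simp: mps_act_add_right)

lemma mps_act_const_left: "mps_act (mps_const a * b) e = mpol_const a * mps_act b e"
  by (simp add: mps_act_def sum_distrib_left mpol_const_mult mult.assoc)

lemma mps_act_const_right:
  "mps_act b (mpol_const a * e) = mpol_const a * mps_act b e"
proof -
  let ?A = "{\<alpha>. mderiv \<alpha> e \<noteq> 0} \<union> {\<alpha>. mderiv \<alpha> (mpol_const a * e) \<noteq> 0}"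
  have "mps_act b f = (\<Sum>\<alpha>\<in>?A. mpol_const (mps_coeff b \<alpha>) * mderiv \<alpha> f)"
    if "{\<alpha>. mderiv \<alpha> f \<noteq> 0} \<subseteq> ?A" for f
    by (rule mps_act_superset[OF _ that]) simp
  from this[of e] this[of "mpol_const a * e"] show ?thesis
    by (simp add: subset_iff mderiv_const_mult sum_distrib_left mult.left_commute)
qed

lemma mps_act_monom:
  fixes e :: "('n::finite, 'f::comm_ring_1) mpol"
  shows "mps_act (mps_monom \<beta>) e = mderiv \<beta> e"
proof -
  let ?A = "insert \<beta> {\<alpha>. mderiv \<alpha> e \<noteq> 0}"
  have "mps_act (mps_monom \<beta>) e =
      (\<Sum>\<alpha>\<in>?A. mpol_const (mps_coeff (mps_monom \<beta>) \<alpha>) * mderiv \<alpha> e)"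
    by (rule mps_act_superset) auto
  also have "\<dots> = (\<Sum>\<alpha>\<in>?A. if \<alpha> = \<beta> then mderiv \<alpha> e else 0)"
    by (rule sum.cong) (auto simp: mps_monom_def mpol_const_1)
  finally show ?thesis by simp
qed

lemma mps_act_const:
  fixes e :: "('a::finite, 'b::comm_ring_1) mpol"
  shows "mps_act (mps_const a) e = mpol_const a * e"
proof -
  have "mps_monom 0 = (1 :: ('a, 'b) mps)"
    by (rule mps_eqI) (simp add: mps_monom_def mps_coeff_one)
  then show ?thesis using mps_act_const_left[of a 1 e] mps_act_monom[of 0 e] by simp
qed

lemma mps_act_mult: "mps_act (c * b) e = mps_act c (mps_act b e)"
proof -
  let ?A = "{\<alpha>. mderiv \<alpha> e \<noteq> 0}"
  have fin: "finite ?A" by simp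
  have B: "\<exists>B. finite B \<and> (\<forall>\<gamma>\<in>?A. \<forall>\<beta>. mderiv \<beta> (mderiv \<gamma> e) \<noteq> 0 \<longrightarrow> \<beta> \<in> B)"
    by (rule exI[of _ "\<Union>\<gamma>\<in>?A. {\<beta>. mderiv \<beta> (mderiv \<gamma> e) \<noteq> 0}"]) auto
  let ?t = "\<lambda>\<beta> \<gamma>. mpol_const (mps_coeff c \<beta> * mps_coeff b \<gamma>) * mderiv (\<beta> + \<gamma>) e"
  have "mps_act (c * b) e = (\<Sum>\<alpha>\<in>?A. \<Sum>x\<in>splits \<alpha>. ?t (fst x) (snd x))"
    unfolding mps_act_def mps_coeff_mult
  proof (rule sum.cong)
    fix \<alpha>
    have c: "mpol_const (sum f A) = (\<Sum>x\<in>A. mpol_const (f x))" for f :: "'c \<Rightarrow> 'b" and A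
      by (simp add: mpol_const_def single_sum)
    show "mpol_const (\<Sum>(\<beta>, \<gamma>)\<in>splits \<alpha>. mps_coeff c \<beta> * mps_coeff b \<gamma>) * mderiv \<alpha> e =
        (\<Sum>x\<in>splits \<alpha>. ?t (fst x) (snd x))"
      unfolding c sum_distrib_right case_prod_unfold
      by (rule sum.cong) (auto simp: splits_def)
  qed simp
  also have "\<dots> = (\<Sum>(\<alpha>, x)\<in>Sigma ?A splits. ?t (fst x) (snd x))"
    by (rule sum.Sigma) (use fin in auto)
  also have "\<dots> = (\<Sum>(\<gamma>, \<beta>)\<in>Sigma ?A (\<lambda>\<gamma>. {\<beta>. mderiv \<beta> (mderiv \<gamma> e) \<noteq> 0}). ?t \<beta> \<gamma>)"
  proof (rule sum.reindex_bij_witness[of _ "\<lambda>(\<gamma>, \<beta>). (\<beta> + \<gamma>, (\<beta>, \<gamma>))" "\<lambda>(\<alpha>, (\<beta>, \<gamma>)). (\<gamma>, \<beta>)"])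
    fix y assume "y \<in> Sigma ?A splits"
    then obtain \<beta> \<gamma> where y: "y = (\<beta> + \<gamma>, (\<beta>, \<gamma>))" "mderiv (\<beta> + \<gamma>) e \<noteq> 0"
      by (auto simp: splits_def)
    then have "mderiv \<gamma> e \<noteq> 0" by (metis mderiv_mderiv mderiv_zero)
    with y show "(case y of (\<alpha>, \<beta>, \<gamma>) \<Rightarrow> (\<gamma>, \<beta>)) \<in>
        Sigma ?A (\<lambda>\<gamma>. {\<beta>. mderiv \<beta> (mderiv \<gamma> e) \<noteq> 0})"
      by (simp add: mderiv_mderiv)
  qed (auto simp: splits_def mderiv_mderiv)
  also have "\<dots> = (\<Sum>\<gamma>\<in>?A. \<Sum>\<beta> | mderiv \<beta> (mderiv \<gamma> e) \<noteq> 0. ?t \<beta> \<gamma>)"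
    by (rule sum.Sigma[symmetric]) (use fin in auto)
  also have "\<dots> = (\<Sum>\<gamma>\<in>?A. mpol_const (mps_coeff b \<gamma>) * mps_act c (mderiv \<gamma> e))"
    unfolding mps_act_def sum_distrib_left mpol_const_mult mderiv_mderiv
    by (simp add: mult.assoc mult.left_commute)
  also have "\<dots> = mps_act c (mps_act b e)"
    by (simp add: mps_act_def[of b e] mps_act_sum_right mps_act_const_right)
  finally show ?thesis .
qed

text \<open>The action on monomials: \<open>y\<^sup>\<beta>\<close> sends \<open>z\<^sup>\<alpha>\<close> to \<open>\<alpha>! / (\<alpha> - \<beta>)! z\<^bsup>\<alpha> - \<beta>\<^esup>\<close>, so that the pairs in \<open>splits \<alpha>\<close> enumerate the terms.\<close>

lemma mps_act_expand:
  fixes e :: "('n::finite, 'f::comm_ring_1) mpol"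
  shows "mps_act b e = (\<Sum>\<alpha>\<in>keys e. \<Sum>x\<in>splits \<alpha>.
    Poly_Mapping.single (snd x) (mps_coeff b (fst x) * of_nat (mff \<alpha> (fst x)) * lookup e \<alpha>))"
proof -
  have s: "mps_act b (Poly_Mapping.single \<alpha> a) = (\<Sum>x\<in>splits \<alpha>.
      Poly_Mapping.single (snd x) (mps_coeff b (fst x) * of_nat (mff \<alpha> (fst x)) * a))"
    for \<alpha> :: "'n multiindex" and a :: 'f
  proof -
    let ?e = "Poly_Mapping.single \<alpha> a"
    have "{\<beta>. mderiv \<beta> ?e \<noteq> 0} \<subseteq> fst ` splits \<alpha>"
    proof
      fix \<beta> assume "\<beta> \<in> {\<beta>. mderiv \<beta> ?e \<noteq> 0}"
      then have "mff \<alpha> \<beta> \<noteq> 0" by (auto simp: mderiv_single intro!: gr0I)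
      then have "(\<beta>, \<alpha> - \<beta>) \<in> splits \<alpha>"
        by (auto simp: splits_def lookup_add lookup_minus mff_le intro!: poly_mapping_eqI)
      then show "\<beta> \<in> fst ` splits \<alpha>" by force
    qed
    then have "mps_act b ?e = (\<Sum>\<beta>\<in>fst ` splits \<alpha>. mpol_const (mps_coeff b \<beta>) * mderiv \<beta> ?e)"
      by (intro mps_act_superset) auto
    also have "\<dots> = (\<Sum>x\<in>splits \<alpha>. mpol_const (mps_coeff b (fst x)) * mderiv (fst x) ?e)"
      by (subst sum.reindex) (auto simp: splits_def inj_on_def)
    also have "\<dots> = (\<Sum>x\<in>splits \<alpha>.
      Poly_Mapping.single (snd x) (mps_coeff b (fst x) * of_nat (mff \<alpha> (fst x)) * a))"
      by (rule sum.cong) (auto simp: splits_def mderiv_single mpol_const_def mult_single mult.assoc)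
    finally show ?thesis .
  qed
  have "mps_act b e = (\<Sum>\<alpha>\<in>keys e. mps_act b (Poly_Mapping.single \<alpha> (lookup e \<alpha>)))"
    by (subst mpol_sum_monomials[of e]) (rule mps_act_sum_right)
  then show ?thesis unfolding s .
qed

lemma lookup_mps_act_0:
  fixes e :: "('n::finite, 'f::comm_ring_1) mpol"
  shows "lookup (mps_act b e) 0 = (\<Sum>\<alpha>\<in>keys e. of_nat (mfact \<alpha>) * mps_coeff b \<alpha> * lookup e \<alpha>)"
proof -
  have m: "mff \<alpha> \<alpha> = mfact \<alpha>" for \<alpha> :: "'n multiindex"
    using mff_add_mfact[of \<alpha> 0] by simp
  have "lookup (mps_act b e) 0 = (\<Sum>\<alpha>\<in>keys e. \<Sum>x\<in>splits \<alpha>. if x = (\<alpha>, 0) then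
      of_nat (mfact \<alpha>) * mps_coeff b \<alpha> * lookup e \<alpha> else 0)"
    unfolding mps_act_expand lookup_sum
    by (intro sum.cong refl) (auto simp: lookup_single when_def splits_def m ac_simps)
  also have "\<dots> = (\<Sum>\<alpha>\<in>keys e. of_nat (mfact \<alpha>) * mps_coeff b \<alpha> * lookup e \<alpha>)"
  proof (rule sum.cong)
    fix \<alpha> :: "'n multiindex"
    have "(\<alpha>, 0) \<in> splits \<alpha>" by (simp add: splits_def)
    then show "(\<Sum>x\<in>splits \<alpha>. if x = (\<alpha>, 0) then
        of_nat (mfact \<alpha>) * mps_coeff b \<alpha> * lookup e \<alpha> else 0) =
      of_nat (mfact \<alpha>) * mps_coeff b \<alpha> * lookup e \<alpha>" by simp
  qed simp
  finally show ?thesis .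
qed

lemma mps_act_in:
  assumes "e \<in> mpol_in C"
  shows "mps_act b e \<in> mpol_in C"
  unfolding mpol_in_def
proof clarify
  fix \<beta> i assume b: "\<beta> \<in> keys (mps_act b e)" "i \<in> keys \<beta>"
  then have "(\<Sum>\<alpha> | mderiv \<alpha> e \<noteq> 0. lookup (mpol_const (mps_coeff b \<alpha>) * mderiv \<alpha> e) \<beta>) \<noteq> 0"
    unfolding mps_act_def in_keys_iff lookup_sum by simp
  then obtain \<alpha> where "lookup (mpol_const (mps_coeff b \<alpha>) * mderiv \<alpha> e) \<beta> \<noteq> 0"
    by (rule sum.not_neutral_contains_not_neutral)
  then have "\<beta> \<in> keys (mderiv \<alpha> e)" by (auto simp: in_keys_iff)
  then show "i \<in> C" using mpol_in_mderiv[OF assms, of \<alpha>] b(2) unfolding mpol_in_def by blast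
qed

section \<open>Macaulay duality\<close>

definition vec_act :: "('n::finite, 'f::field) mps ^ 'r::finite \<Rightarrow> ('n, 'f) mpol ^ 'r \<Rightarrow> ('n, 'f) mpol"
  where "vec_act v w = (\<Sum>j\<in>UNIV. mps_act (v $ j) (w $ j))"

text \<open>The constant term of \<open>v \<cdot> w\<close>. It is a perfect pairing between \<open>B\<^sup>r\<close> and \<open>E\<^sup>r\<close>: every functional on \<open>E\<^sup>r\<close> is given by a
  power series vector, and every functional on \<open>B\<^sup>r\<close> that vanishes to high order is given by a polynomial vector.\<close>

definition pairing :: "('n::finite, 'f::field) mps ^ 'r::finite \<Rightarrow> ('n, 'f) mpol ^ 'r \<Rightarrow> 'f" where
  "pairing v w = lookup (vec_act v w) 0"

definition mps_act_vec :: "('n::finite, 'f::field) mps \<Rightarrow> ('n, 'f) mpol ^ 'r \<Rightarrow> ('n, 'f) mpol ^ 'r" where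
  "mps_act_vec b w = (\<chi> j. mps_act b (w $ j))"

text \<open>The inverse of \<open>perp\<close> on the level of inverse systems.\<close>

definition mps_perp :: "'n set \<Rightarrow> (('n::finite, 'f::field) mpol ^ 'r::finite) set \<Rightarrow>
    (('n, 'f) mps ^ 'r) set" where
  "mps_perp C W = {v \<in> vec_in (mps_in C). \<forall>w\<in>W. pairing v w = 0}"

lemma vec_act_mult: "vec_act (b *s v) w = mps_act b (vec_act v w)"
  by (simp add: vec_act_def mps_act_sum_right mps_act_mult)

lemma vec_act_act: "vec_act (b *s v) w = vec_act v (mps_act_vec b w)"
  by (simp add: vec_act_def mps_act_vec_def flip: mps_act_mult) (simp add: mult.commute)

lemma pairing_act: "pairing (b *s v) w = pairing v (mps_act_vec b w)"
  by (simp add: pairing_def vec_act_act)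

lemma pairing_add_left: "pairing (v + v') w = pairing v w + pairing v' w"
  and pairing_scale_left: "pairing (mps_const a *s v) w = a * pairing v w"
  and pairing_add_right: "pairing v (w + w') = pairing v w + pairing v w'"
  and pairing_scale_right: "pairing v (mpol_vec_scale a w) = a * pairing v w"
  and pairing_zero_left [simp]: "pairing 0 w = 0"
  and pairing_zero_right [simp]: "pairing v 0 = 0"
  by (simp_all add: pairing_def vec_act_def mps_act_add_left mps_act_add_right mps_act_const_left
      mps_act_const_right mpol_vec_scale_def lookup_add lookup_sum sum.distrib sum_distrib_left)

lemma pairing_diff_left: "pairing (v - v') w = pairing v w - pairing v' w"
  using pairing_add_left[of "v - v'" v' w] by simp

lemma pairing_diff_right: "pairing v (w - w') = pairing v w - pairing v w'"
  using pairing_add_right[of v "w - w'" w'] by simp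

lemma pairing_sum_left: "pairing (sum f A) w = (\<Sum>x\<in>A. pairing (f x) w)"
  by (induction A rule: infinite_finite_induct) (auto simp: pairing_add_left)

lemma pairing_sum_right: "pairing v (sum f A) = (\<Sum>x\<in>A. pairing v (f x))"
  by (induction A rule: infinite_finite_induct) (auto simp: pairing_add_right)

lemma pairing_formula:
  "pairing v w = (\<Sum>j\<in>UNIV. \<Sum>\<alpha>\<in>keys (w $ j). of_nat (mfact \<alpha>) * mps_coeff (v $ j) \<alpha> * lookup (w $ j) \<alpha>)"
  by (simp add: pairing_def vec_act_def lookup_sum lookup_mps_act_0)

lemma pairing_null_subspace: "mpol_vs.subspace {w. pairing v w = 0}"
  by (auto simp: mpol_vs.subspace_def pairing_add_right pairing_scale_right)

lemma mpol_vec_in_subspace: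
  "mpol_vs.subspace (vec_in (mpol_in C) :: (('n::finite, 'f::field) mpol ^ 'r) set)"
proof -
  have "f + g \<in> mpol_in C" if "f \<in> mpol_in C" "g \<in> mpol_in C" for f g :: "('n, 'f) mpol"
    using that Poly_Mapping.keys_add[of f g] unfolding mpol_in_def by blast
  moreover have "mpol_const a * f \<in> mpol_in C" if "f \<in> mpol_in C" for a and f :: "('n, 'f) mpol"
  proof -
    have "keys (mpol_const a * f) \<subseteq> keys f" by (auto simp: in_keys_iff)
    then show ?thesis using that unfolding mpol_in_def by blast
  qed
  moreover have "(0 :: ('n, 'f) mpol) \<in> mpol_in C" by (simp add: mpol_in_def)
  ultimately show ?thesis
    by (simp add: mpol_vs.subspace_def vec_in_def mpol_vec_scale_def)
qed

text \<open>A polynomial has only finitely many nonzero derivatives, so a power series acts on a given vector as a finite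
  combination of derivatives.\<close>

lemma closed_under_mps_act:
  fixes W :: "(('n::finite, 'f::field) mpol ^ 'r::finite) set"
  assumes W: "mpol_vs.subspace W" "closed_under_diff C W" and b: "b \<in> mps_in C" and w: "w \<in> W"
  shows "mps_act_vec b w \<in> W"
proof -
  have d: "(\<chi> j. mderiv \<alpha> (w $ j)) \<in> W" if "keys \<alpha> \<subseteq> C" for \<alpha>
    using that
  proof (induction "mdeg \<alpha>" arbitrary: \<alpha>)
    case 0
    then show ?case using w by simp
  next
    case (Suc k)
    then have "\<alpha> \<noteq> 0" by auto
    then obtain i \<beta> where i: "i \<in> keys \<alpha>" "\<alpha> = Poly_Mapping.single i 1 + \<beta>"
      by (rule multiindex_nonzeroE)
    have "(\<chi> j. mderiv \<beta> (w $ j)) \<in> W"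
      using Suc by (auto simp: i(2) keys_plus_nat)
    then have "(\<chi> j. mderiv (Poly_Mapping.single i 1) ((\<chi> j. mderiv \<beta> (w $ j)) $ j)) \<in> W"
      using W(2) i(1) Suc.prems unfolding closed_under_diff_def by blast
    then show ?case unfolding i(2) mderiv_mderiv by simp
  qed
  let ?A = "\<Union>j. {\<alpha>. mderiv \<alpha> (w $ j) \<noteq> 0}"
  have "mps_act_vec b w = (\<Sum>\<alpha>\<in>?A. mpol_vec_scale (mps_coeff b \<alpha>) (\<chi> j. mderiv \<alpha> (w $ j)))"
    by (simp add: vec_eq_iff mps_act_vec_def mpol_vec_scale_def)
      (auto intro!: mps_act_superset)
  also have "\<dots> \<in> W"
  proof (rule mpol_vs.subspace_sum[OF W(1)])
    fix \<alpha>
    show "mpol_vec_scale (mps_coeff b \<alpha>) (\<chi> j. mderiv \<alpha> (w $ j)) \<in> W"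
    proof (cases "keys \<alpha> \<subseteq> C")
      case True
      then show ?thesis using d by (intro mpol_vs.subspace_scale[OF W(1)])
    next
      case False
      then have "mps_coeff b \<alpha> = 0" using b by (auto simp: mps_in_coeff)
      then show ?thesis using mpol_vs.subspace_0[OF W(1)] by simp
    qed
  qed
  finally show ?thesis .
qed

context residue_map
begin

text \<open>The coefficient of \<open>v \<cdot> w\<close> at \<open>z\<^sup>\<beta>\<close> is, up to \<open>\<beta>!\<close>, the pairing of \<open>y\<^sup>\<beta> v\<close> with \<open>w\<close>, and \<open>V\<close> contains \<open>y\<^sup>\<beta> v\<close> together with
  \<open>v\<close>. The duality thus reduces to linear algebra over \<open>F\<close>.\<close>

lemma perp_eq_pairing:
  fixes V :: "(('n, 'f) mps ^ 'r::finite) set"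
  assumes V: "submodule_over (mps_in C) (*s) V"
  shows "perp C V = {w \<in> vec_in (mpol_in C). \<forall>v\<in>V. pairing v w = 0}"
proof
  show "perp C V \<subseteq> {w \<in> vec_in (mpol_in C). \<forall>v\<in>V. pairing v w = 0}"
    by (auto simp: perp_def pairing_def vec_act_def)
  show "{w \<in> vec_in (mpol_in C). \<forall>v\<in>V. pairing v w = 0} \<subseteq> perp C V"
  proof clarify
    fix w assume w: "w \<in> vec_in (mpol_in C)" "\<forall>v\<in>V. pairing v w = 0"
    have "vec_act v w = 0" if v: "v \<in> V" for v
    proof (rule poly_mapping_eqI)
      fix \<beta>
      have in_C: "mps_act (v $ j) (w $ j) \<in> mpol_in C" for j
        using w(1) by (intro mps_act_in) (simp add: vec_in_def)
      show "lookup (vec_act v w) \<beta> = lookup 0 \<beta>"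
      proof (cases "keys \<beta> \<subseteq> C")
        case True
        have "of_nat (mfact \<beta>) * lookup (vec_act v w) \<beta> = lookup (mderiv \<beta> (vec_act v w)) 0"
          using mff_add_mfact[of \<beta> 0] by (simp add: lookup_mderiv)
        also have "\<dots> = pairing (mps_monom \<beta> *s v) w"
          by (simp add: pairing_def vec_act_mult mps_act_monom)
        also have "\<dots> = 0"
          using w(2) submodule_overD(3)[OF V mps_in_monom[OF True] v] by blast
        finally show ?thesis by simp
      next
        case False
        have "lookup (mps_act (v $ j) (w $ j)) \<beta> = 0" for j
          using False in_C[of j] unfolding mpol_in_def by (auto simp: in_keys_iff)
        then show ?thesis by (simp add: vec_act_def lookup_sum)
      qed
    qed
    then show "w \<in> perp C V" using w(1) by (simp add: perp_def vec_act_def)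
  qed
qed

lemma pairing_nondegenerate:
  fixes w :: "('n, 'f) mpol ^ 'r::finite"
  assumes w: "w \<in> vec_in (mpol_in C)" and 0: "\<And>v. v \<in> vec_in (mps_in C) \<Longrightarrow> pairing v w = 0"
  shows "w = 0"
proof -
  have "lookup (w $ i) \<alpha> = 0" for i \<alpha>
  proof (cases "\<alpha> \<in> keys (w $ i)")
    case True
    then have "keys \<alpha> \<subseteq> C" using w by (auto simp: vec_in_def mpol_in_def)
    let ?v = "axis i (mps_monom \<alpha>) :: ('n, 'f) mps ^ 'r"
    have "?v \<in> vec_in (mps_in C)" using mps_in_monom[OF \<open>keys \<alpha> \<subseteq> C\<close>] by (auto simp: vec_in_def axis_def)
    then have "pairing ?v w = 0" by (rule 0)
    moreover have "vec_act ?v w = (\<Sum>j\<in>UNIV. if j = i then mderiv \<alpha> (w $ i) else 0)"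
      unfolding vec_act_def by (rule sum.cong) (auto simp: axis_def mps_act_monom)
    ultimately show ?thesis
      using mff_add_mfact[of \<alpha> 0] by (simp add: pairing_def lookup_mderiv)
  qed (simp add: in_keys_iff)
  then show ?thesis by (simp add: vec_eq_iff poly_mapping_eq_iff fun_eq_iff)
qed

text \<open>The existence of such a pair is the common consequence of the descriptions of a point of the Quot scheme and
  of an inverse system; everything about the duality follows from it (see \<open>dual_basesD\<close>).\<close>

definition dual_bases ::
  "nat \<Rightarrow> (('n, 'f) mps ^ 'r::finite) set \<Rightarrow> (nat \<Rightarrow> ('n, 'f) mps ^ 'r) \<Rightarrow> (nat \<Rightarrow> ('n, 'f) mpol ^ 'r) \<Rightarrow> bool"
  where "dual_bases m V b e \<longleftrightarrow>
    (\<forall>j<m. b j \<in> vec_in (mps_in C) \<and> e j \<in> vec_in (mpol_in C)) \<and>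
    (\<forall>i<m. \<forall>j<m. pairing (b i) (e j) = (if i = j then 1 else 0)) \<and>
    (\<forall>v\<in>V. \<forall>j<m. pairing v (e j) = 0) \<and>
    (\<forall>v\<in>vec_in (mps_in C). v - (\<Sum>j<m. mps_const (pairing v (e j)) *s b j) \<in> V)"

text \<open>Modulo \<open>V\<close> every \<open>v\<close> is determined by its pairings with the \<open>e j\<close>. Hence subtracting from \<open>w \<in> perp C V\<close> its
  component in the span of the \<open>e j\<close> leaves a vector that pairs to zero with all of \<open>B\<^sup>r\<close>.\<close>

lemma dual_basesD:
  fixes V :: "(('n, 'f) mps ^ 'r::finite) set"
  assumes V: "submodule_over (mps_in C) (*s) V" "V \<subseteq> vec_in (mps_in C)" and d: "dual_bases m V b e"
  shows "quot_point C m V" "perp C V = mpol_vs.span (e ` {..<m})" "mpol_vs.dim (perp C V) = m"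
    "mps_perp C (perp C V) = V"
proof -
  from d have b: "\<And>j. j < m \<Longrightarrow> b j \<in> vec_in (mps_in C)" and e: "\<And>j. j < m \<Longrightarrow> e j \<in> vec_in (mpol_in C)"
    and be: "\<And>i j. i < m \<Longrightarrow> j < m \<Longrightarrow> pairing (b i) (e j) = (if i = j then 1 else 0)"
    and Ve: "\<And>v j. v \<in> V \<Longrightarrow> j < m \<Longrightarrow> pairing v (e j) = 0"
    and exp: "\<And>v. v \<in> vec_in (mps_in C) \<Longrightarrow> v - (\<Sum>j<m. mps_const (pairing v (e j)) *s b j) \<in> V"
    unfolding dual_bases_def by blast+
  have indep: "a i = 0" if "(\<Sum>j<m. mps_const (a j) *s b j) \<in> V" "i < m" for a i
  proof -
    have "0 = pairing (\<Sum>j<m. mps_const (a j) *s b j) (e i)" using Ve that by simp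
    also have "\<dots> = (\<Sum>j<m. if j = i then a j else 0)"
      unfolding pairing_sum_left pairing_scale_left
      by (rule sum.cong) (use be that in auto)
    finally show ?thesis using that by simp
  qed
  show "quot_point C m V"
    unfolding quot_point_def
  proof (intro conjI exI[of _ b] allI impI ballI)
    show "\<exists>a. w - (\<Sum>j<m. mps_const (a j) *s b j) \<in> V" if "w \<in> vec_in (mps_in C)" for w
      by (rule exI[of _ "\<lambda>j. pairing w (e j)"]) (rule exp[OF that])
  qed (fact V b indep)+
  have perp: "perp C V = {w \<in> vec_in (mpol_in C). \<forall>v\<in>V. pairing v w = 0}"
    by (rule perp_eq_pairing[OF V(1)])
  have e_perp: "e j \<in> perp C V" if "j < m" for j using e Ve that by (simp add: perp)
  have sub: "mpol_vs.subspace (perp C V)"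
    unfolding perp using mpol_vec_in_subspace[of C]
    by (auto simp: mpol_vs.subspace_def pairing_add_right pairing_scale_right)
  show span: "perp C V = mpol_vs.span (e ` {..<m})"
  proof
    show "mpol_vs.span (e ` {..<m}) \<subseteq> perp C V"
      by (rule mpol_vs.span_minimal[OF _ sub]) (use e_perp in auto)
    show "perp C V \<subseteq> mpol_vs.span (e ` {..<m})"
    proof
      fix w assume w: "w \<in> perp C V"
      define w' where "w' = (\<Sum>i<m. mpol_vec_scale (pairing (b i) w) (e i))"
      have "w' \<in> perp C V" unfolding w'_def
        by (intro mpol_vs.subspace_sum[OF sub] mpol_vs.subspace_scale[OF sub] e_perp) auto
      with w have "w - w' \<in> vec_in (mpol_in C)"
        using mpol_vs.subspace_diff[OF sub] perp by blast
      moreover have "pairing v (w - w') = 0" if "v \<in> vec_in (mps_in C)" for v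
      proof -
        have "pairing v (w - w') = pairing (v - (\<Sum>j<m. mps_const (pairing v (e j)) *s b j)) w"
          unfolding w'_def
          by (simp add: pairing_diff_left pairing_diff_right pairing_sum_left pairing_sum_right
              pairing_scale_left pairing_scale_right mult.commute)
        also have "\<dots> = 0" using w exp[OF that] by (simp add: perp)
        finally show ?thesis .
      qed
      ultimately have "w - w' = 0" by (rule pairing_nondegenerate)
      then have "w = w'" by simp
      moreover have "w' \<in> mpol_vs.span (e ` {..<m})" unfolding w'_def
        by (intro mpol_vs.span_sum mpol_vs.span_scale mpol_vs.span_base) auto
      ultimately show "w \<in> mpol_vs.span (e ` {..<m})" by simp
    qed
  qed
  have inj: "inj_on e {..<m}"
  proof (rule inj_onI)
    fix i j assume ij: "i \<in> {..<m}" "j \<in> {..<m}" "e i = e j"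
    then have "pairing (b i) (e i) = pairing (b i) (e j)" by simp
    then show "i = j" using ij be[of i i] be[of i j] by (simp split: if_splits)
  qed
  have "\<not> mpol_vs.dependent (e ` {..<m})"
  proof (rule mpol_vs.independent_if_scalars_zero)
    fix f x assume 0: "(\<Sum>x\<in>e ` {..<m}. mpol_vec_scale (f x) x) = 0" and "x \<in> e ` {..<m}"
    then obtain i where i: "x = e i" "i < m" by auto
    have "0 = pairing (b i) (\<Sum>x\<in>e ` {..<m}. mpol_vec_scale (f x) x)" by (simp add: 0)
    also have "\<dots> = pairing (b i) (\<Sum>j<m. mpol_vec_scale (f (e j)) (e j))"
      by (subst sum.reindex[OF inj]) simp
    also have "\<dots> = (\<Sum>j<m. if j = i then f (e j) else 0)"
      unfolding pairing_sum_right pairing_scale_right by (rule sum.cong) (use be i in auto)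
    finally show "f x = 0" using i by simp
  qed simp
  then show "mpol_vs.dim (perp C V) = m"
    unfolding span mpol_vs.dim_span by (simp add: mpol_vs.dim_eq_card_independent card_image[OF inj])
  show "mps_perp C (perp C V) = V"
  proof
    show "V \<subseteq> mps_perp C (perp C V)" using V(2) by (auto simp: mps_perp_def perp)
    show "mps_perp C (perp C V) \<subseteq> V"
    proof
      fix v assume v: "v \<in> mps_perp C (perp C V)"
      then have "(\<Sum>j<m. mps_const (pairing v (e j)) *s b j) = 0"
        using e_perp by (simp add: mps_perp_def)
      then show "v \<in> V" using exp[of v] v by (simp add: mps_perp_def)
    qed
  qed
qed

text \<open>The coordinate functionals of \<open>B\<^sup>r / V\<close> vanish on vectors of order \<open>m\<close>, hence are pairings with polynomial
  vectors of degree less than \<open>m\<close>.\<close>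

lemma dual_bases_of_quot_point:
  fixes V :: "(('n, 'f) mps ^ 'r::finite) set"
  assumes q: "quot_point C m V"
  obtains b e where "dual_bases m V b e"
proof -
  let ?X = "vec_in (mps_in C) :: (('n, 'f) mps ^ 'r) set"
  from q obtain b where V: "V \<subseteq> ?X" "submodule_over (mps_in C) (*s) V"
    and b: "\<And>j. j < m \<Longrightarrow> b j \<in> ?X"
      "\<And>w. w \<in> ?X \<Longrightarrow> \<exists>a. w - (\<Sum>j<m. mps_const (a j) *s b j) \<in> V"
      "\<And>a. (\<Sum>j<m. mps_const (a j) *s b j) \<in> V \<Longrightarrow> \<forall>j<m. a j = 0"
    unfolding quot_point_def by blast
  define co where "co v = (SOME a. v - (\<Sum>j<m. mps_const (a j) *s b j) \<in> V)" for v
  have co: "v - (\<Sum>j<m. mps_const (co v j) *s b j) \<in> V" if "v \<in> ?X" for v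
    unfolding co_def by (rule someI_ex[OF b(2)[OF that]])
  have co_eq: "co v j = a j"
    if v: "v \<in> ?X" and a: "v - (\<Sum>j<m. mps_const (a j) *s b j) \<in> V" and j: "j < m" for v a j
  proof -
    have "(\<Sum>j<m. mps_const (co v j - a j) *s b j) =
        (v - (\<Sum>j<m. mps_const (a j) *s b j)) - (v - (\<Sum>j<m. mps_const (co v j) *s b j))"
      by (simp add: mps_const_diff vector_ssub_ldistrib sum_subtractf vec_eq_iff algebra_simps)
    also have "\<dots> \<in> V" by (rule mps_submodule_diff[OF V(2) a co[OF v]])
    finally show ?thesis using b(3) j by force
  qed
  let ?D = "{\<alpha> :: 'n multiindex. mdeg \<alpha> < m \<and> keys \<alpha> \<subseteq> C}"
  have finD: "finite ?D" using finite_mdeg_less[of m] by (rule rev_finite_subset) auto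
  let ?x = "\<lambda>\<alpha> i. axis i (mps_monom \<alpha>) :: ('n, 'f) mps ^ 'r"
  have x_in: "?x \<alpha> i \<in> ?X" if "\<alpha> \<in> ?D" for \<alpha> i
    using that mps_in_monom[of \<alpha> C] by (auto simp: vec_in_def axis_def)
  \<comment> \<open>the coordinates vanish on vectors of order \<open>m\<close>, hence are given by polynomials\<close>
  define e where "e j = (\<chi> i. \<Sum>\<alpha>\<in>?D. Poly_Mapping.single \<alpha> (co (?x \<alpha> i) j / of_nat (mfact \<alpha>)))" for j
  have lookup_e: "lookup (e j $ i) \<alpha> = (if \<alpha> \<in> ?D then co (?x \<alpha> i) j / of_nat (mfact \<alpha>) else 0)" for i j \<alpha>
    using finD by (auto simp: e_def lookup_sum lookup_single when_def)
  have keys_e: "keys (e j $ i) \<subseteq> ?D" for i j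
  proof
    fix \<alpha> assume "\<alpha> \<in> keys (e j $ i)"
    then have "lookup (e j $ i) \<alpha> \<noteq> 0" by (simp only: in_keys_iff not_False_eq_True)
    then show "\<alpha> \<in> ?D" by (rule contrapos_np) (simp only: lookup_e if_False)
  qed
  have pair: "pairing v (e j) = co v j" if v: "v \<in> ?X" and j: "j < m" for v j
  proof -
    have "pairing v (e j) = (\<Sum>i\<in>UNIV. \<Sum>\<alpha>\<in>?D. mps_coeff (v $ i) \<alpha> * co (?x \<alpha> i) j)"
      unfolding pairing_formula
    proof (rule sum.cong)
      fix i
      have "(\<Sum>\<alpha>\<in>keys (e j $ i). of_nat (mfact \<alpha>) * mps_coeff (v $ i) \<alpha> * lookup (e j $ i) \<alpha>) =
        (\<Sum>\<alpha>\<in>?D. of_nat (mfact \<alpha>) * mps_coeff (v $ i) \<alpha> * lookup (e j $ i) \<alpha>)"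
        by (rule sum.mono_neutral_left[OF finD keys_e]) (simp add: in_keys_iff)
      also have "\<dots> = (\<Sum>\<alpha>\<in>?D. mps_coeff (v $ i) \<alpha> * co (?x \<alpha> i) j)"
        by (rule sum.cong) (auto simp: lookup_e)
      finally show "(\<Sum>\<alpha>\<in>keys (e j $ i). of_nat (mfact \<alpha>) * mps_coeff (v $ i) \<alpha> * lookup (e j $ i) \<alpha>) =
        (\<Sum>\<alpha>\<in>?D. mps_coeff (v $ i) \<alpha> * co (?x \<alpha> i) j)" .
    qed simp
    also have "\<dots> = co v j"
    proof (rule co_eq[OF v _ j, symmetric])
      define v' where "v' = (\<Sum>i\<in>UNIV. \<Sum>\<alpha>\<in>?D. mps_const (mps_coeff (v $ i) \<alpha>) *s ?x \<alpha> i)"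
      have t: "mps_coeff ((mps_const c *s ?x \<alpha> i) $ k) \<beta> = (if i = k \<and> \<alpha> = \<beta> then c else 0)" for c \<alpha> i k \<beta>
        by (cases "i = k") (auto simp: axis_def mps_monom_def)
      have c: "mps_coeff (v' $ k) \<beta> = (if \<beta> \<in> ?D then mps_coeff (v $ k) \<beta> else 0)" for k \<beta>
      proof -
        have "mps_coeff (v' $ k) \<beta> =
            (\<Sum>i\<in>UNIV. if i = k then (\<Sum>\<alpha>\<in>?D. if \<alpha> = \<beta> then mps_coeff (v $ i) \<alpha> else 0) else 0)"
          unfolding v'_def sum_component mps_coeff_sum t by (rule sum.cong) (auto intro!: sum.neutral)
        then show ?thesis using finD by simp
      qed
      have "v - v' \<in> ?X \<inter> vec_ord_ge m"
        using v by (auto simp: vec_in_def vec_ord_ge_def mps_in_coeff mps_ord_ge_def c)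
      then have 1: "v - v' \<in> V" using quot_point_contains_power[OF q] by blast
      have 2: "(\<Sum>i\<in>UNIV. \<Sum>\<alpha>\<in>?D. mps_const (mps_coeff (v $ i) \<alpha>) *s
          (?x \<alpha> i - (\<Sum>j<m. mps_const (co (?x \<alpha> i) j) *s b j))) \<in> V" (is "?s \<in> V")
        by (intro submodule_over_sum[OF V(2)] submodule_overD(3)[OF V(2) mps_in_const] co x_in)
      have "?s = v' - (\<Sum>i\<in>UNIV. \<Sum>\<alpha>\<in>?D. \<Sum>j<m.
          mps_const (mps_coeff (v $ i) \<alpha> * co (?x \<alpha> i) j) *s b j)"
        by (simp add: v'_def vector_ssub_ldistrib sum_subtractf mps_vs.scale_sum_right
            flip: mps_scale_def)
      also have "(\<Sum>i\<in>UNIV. \<Sum>\<alpha>\<in>?D. \<Sum>j<m. mps_const (mps_coeff (v $ i) \<alpha> * co (?x \<alpha> i) j) *s b j) =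
          (\<Sum>i\<in>UNIV. \<Sum>j<m. \<Sum>\<alpha>\<in>?D. mps_const (mps_coeff (v $ i) \<alpha> * co (?x \<alpha> i) j) *s b j)"
        by (intro sum.cong refl sum.swap)
      also have "\<dots> = (\<Sum>j<m. \<Sum>i\<in>UNIV. \<Sum>\<alpha>\<in>?D. mps_const (mps_coeff (v $ i) \<alpha> * co (?x \<alpha> i) j) *s b j)"
        by (rule sum.swap)
      also have "\<dots> = (\<Sum>j<m. mps_const (\<Sum>i\<in>UNIV. \<Sum>\<alpha>\<in>?D. mps_coeff (v $ i) \<alpha> * co (?x \<alpha> i) j) *s b j)"
        by (simp add: mps_vs.scale_sum_left flip: mps_scale_def)
      finally show "v - (\<Sum>j<m. mps_const (\<Sum>i\<in>UNIV. \<Sum>\<alpha>\<in>?D. mps_coeff (v $ i) \<alpha> * co (?x \<alpha> i) j) *s b j) \<in> V"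
        using submodule_overD(2)[OF V(2) 1 2] by simp
    qed
    finally show ?thesis .
  qed
  have "dual_bases m V b e"
    unfolding dual_bases_def
  proof (intro conjI allI impI ballI)
    show "e j \<in> vec_in (mpol_in C)" if "j < m" for j
      using keys_e[of j] unfolding vec_in_def mpol_in_def by blast
    show "pairing (b i) (e j) = (if i = j then 1 else 0)" if "i < m" "j < m" for i j
    proof -
      have "(\<Sum>k<m. mps_const (if i = k then 1 else 0) *s b k) = (\<Sum>k<m. if k = i then b k else 0)"
        by (rule sum.cong) auto
      then have "b i - (\<Sum>k<m. mps_const (if i = k then 1 else 0) *s b k) \<in> V"
        using that submodule_overD(1)[OF V(2)] by simp
      from co_eq[OF b(1)[OF that(1)] this that(2)] show ?thesis
        using pair[OF b(1)[OF that(1)] that(2)] by simp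
    qed
    show "pairing v (e j) = 0" if "v \<in> V" "j < m" for v j
    proof -
      have "v - (\<Sum>k<m. mps_const ((\<lambda>_. 0) k) *s b k) \<in> V" using that by simp
      from co_eq[OF _ this that(2)] show ?thesis using pair[of v j] that V(1) by auto
    qed
    show "v - (\<Sum>j<m. mps_const (pairing v (e j)) *s b j) \<in> V" if "v \<in> ?X" for v
    proof -
      have "(\<Sum>j<m. mps_const (pairing v (e j)) *s b j) = (\<Sum>j<m. mps_const (co v j) *s b j)"
        by (rule sum.cong) (use pair that in auto)
      then show ?thesis using co[OF that] by simp
    qed
  qed (use b in auto)
  then show ?thesis using that by blast
qed

lemma mps_perp_submodule:
  fixes W :: "(('n, 'f) mpol ^ 'r::finite) set"
  assumes W: "mpol_vs.subspace W" "closed_under_diff C W"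
  shows "submodule_over (mps_in C) (*s) (mps_perp C W)"
  using closed_under_mps_act[OF W] submodule_overD[OF vec_in_submodule, where C1 = C]
  by (auto simp: submodule_over_def mps_perp_def pairing_add_left pairing_act)

text \<open>The dual basis of \<open>W\<close> extends to functionals on \<open>E\<^sup>r\<close>, and these are pairings with power series vectors. The
  assumption \<open>m \<ge> 1\<close> excludes subspaces of infinite dimension, for which \<open>dim\<close> is \<open>0\<close> by convention.\<close>

lemma dual_bases_of_inverse_system:
  fixes W :: "(('n, 'f) mpol ^ 'r::finite) set"
  assumes W: "W \<subseteq> vec_in (mpol_in C)" "mpol_vs.subspace W" "mpol_vs.dim W = m" "m \<ge> 1"
  obtains b e where "dual_bases m (mps_perp C W) b e" "W = mpol_vs.span (e ` {..<m})"
proof -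
  obtain B where B: "B \<subseteq> W" "\<not> mpol_vs.dependent B" "W \<subseteq> mpol_vs.span B" "card B = m"
    using mpol_vs.basis_exists[of W] W(3) by metis
  have "finite B" using B(4) W(4) by (metis card.infinite not_one_le_zero)
  then obtain e where e: "bij_betw e {..<m} B"
    using ex_bij_betw_nat_finite[of B] B(4) by (metis atLeast0LessThan)
  then have eB: "e ` {..<m} = B" "inj_on e {..<m}" by (auto simp: bij_betw_def)
  have "\<exists>l. module_hom mpol_vec_scale (*) l \<and> (\<forall>x\<in>B. l x = (if x = e j then 1 else 0))" for j
    using mpol_functional.linear_independent_extend[OF B(2), of "\<lambda>x. if x = e j then 1 else 0"]
    by (auto simp: linear_iff_module_hom)
  then obtain l where l: "\<And>j. module_hom mpol_vec_scale (*) (l j)"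
    "\<And>j x. x \<in> B \<Longrightarrow> l j x = (if x = e j then 1 else 0)" by metis
  let ?z = "\<lambda>\<alpha> i. axis i (Poly_Mapping.single \<alpha> 1) :: ('n, 'f) mpol ^ 'r"
  define b where "b j = (\<chi> i. Abs_mps (\<lambda>\<alpha>. if keys \<alpha> \<subseteq> C then l j (?z \<alpha> i) / of_nat (mfact \<alpha>) else 0))" for j
  have pair: "pairing (b j) w = l j w" if w: "w \<in> vec_in (mpol_in C)" for j w
  proof -
    interpret lj: module_hom mpol_vec_scale "(*)" "l j" by (rule l(1))
    have "w = (\<Sum>i\<in>UNIV. \<Sum>\<alpha>\<in>keys (w $ i). mpol_vec_scale (lookup (w $ i) \<alpha>) (?z \<alpha> i))"
    proof -
      have "(\<Sum>i\<in>UNIV. \<Sum>\<alpha>\<in>keys (w $ i). mpol_vec_scale (lookup (w $ i) \<alpha>) (?z \<alpha> i)) $ k = w $ k" for k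
      proof -
        have "(\<Sum>i\<in>UNIV. \<Sum>\<alpha>\<in>keys (w $ i). mpol_vec_scale (lookup (w $ i) \<alpha>) (?z \<alpha> i)) $ k =
            (\<Sum>i\<in>UNIV. if i = k then (\<Sum>\<alpha>\<in>keys (w $ i). Poly_Mapping.single \<alpha> (lookup (w $ i) \<alpha>)) else 0)"
          unfolding sum_component
          by (rule sum.cong)
            (auto simp: mpol_vec_scale_def axis_def mpol_const_def mult_single intro!: sum.neutral)
        then show ?thesis by (simp flip: mpol_sum_monomials)
      qed
      then show ?thesis by (simp add: vec_eq_iff)
    qed
    then have "l j w = l j (\<Sum>i\<in>UNIV. \<Sum>\<alpha>\<in>keys (w $ i). mpol_vec_scale (lookup (w $ i) \<alpha>) (?z \<alpha> i))"
      by (rule arg_cong)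
    also have "\<dots> = (\<Sum>i\<in>UNIV. \<Sum>\<alpha>\<in>keys (w $ i). lookup (w $ i) \<alpha> * l j (?z \<alpha> i))"
      by (simp add: lj.sum lj.scale)
    also have "\<dots> = pairing (b j) w"
      unfolding pairing_formula
    proof (intro sum.cong refl)
      fix i \<alpha> assume "\<alpha> \<in> keys (w $ i)"
      then have "keys \<alpha> \<subseteq> C" using w by (auto simp: vec_in_def mpol_in_def)
      then show "lookup (w $ i) \<alpha> * l j (?z \<alpha> i) =
          of_nat (mfact \<alpha>) * mps_coeff (b j $ i) \<alpha> * lookup (w $ i) \<alpha>" by (simp add: b_def)
    qed
    finally show ?thesis by simp
  qed
  have eW: "e j \<in> W" "e j \<in> B" if "j < m" for j using eB(1) B(1) that by auto
  have be: "pairing (b i) (e j) = (if i = j then 1 else 0)" if "i < m" "j < m" for i j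
  proof -
    have "e j = e i \<longleftrightarrow> i = j" using eB(2) that by (auto dest: inj_onD)
    moreover have "pairing (b i) (e j) = l i (e j)" using eW[OF that(2)] W(1) by (intro pair) blast
    ultimately show ?thesis using l(2)[OF eW(2)[OF that(2)], of i] by simp
  qed
  have b_in: "b j \<in> vec_in (mps_in C)" for j by (simp add: b_def vec_in_def mps_in_coeff)
  have span: "W = mpol_vs.span (e ` {..<m})"
    unfolding eB(1) using B(3) mpol_vs.span_minimal[OF B(1) W(2)] by blast
  have "dual_bases m (mps_perp C W) b e"
    unfolding dual_bases_def
  proof (intro conjI allI impI ballI)
    fix v :: "('n, 'f) mps ^ 'r" assume v: "v \<in> vec_in (mps_in C)"
    let ?v = "v - (\<Sum>j<m. mps_const (pairing v (e j)) *s b j)"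
    have "?v \<in> vec_in (mps_in C)"
      by (intro mps_submodule_diff[OF vec_in_submodule v] submodule_over_sum[OF vec_in_submodule]
          vec_in_scale mps_in_const b_in)
    moreover have "e ` {..<m} \<subseteq> {w. pairing ?v w = 0}"
    proof clarify
      fix i assume i: "i < m"
      have "(\<Sum>j<m. pairing v (e j) * pairing (b j) (e i)) = (\<Sum>j<m. if j = i then pairing v (e j) else 0)"
        by (rule sum.cong) (use be i in auto)
      then show "pairing ?v (e i) = 0"
        using i by (simp add: pairing_diff_left pairing_sum_left pairing_scale_left)
    qed
    then have "W \<subseteq> {w. pairing ?v w = 0}"
      unfolding span by (rule mpol_vs.span_minimal[OF _ pairing_null_subspace])
    ultimately show "?v \<in> mps_perp C W" unfolding mps_perp_def by blast
  qed (use b_in eW W(1) be in \<open>auto simp: mps_perp_def\<close>)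
  then show ?thesis using span that by blast
qed

text \<open>Differentiation is adjoint to multiplication by \<open>y\<^sub>i\<close>.\<close>

lemma perp_closed_under_diff:
  fixes V :: "(('n, 'f) mps ^ 'r::finite) set"
  assumes V: "submodule_over (mps_in C) (*s) V"
  shows "closed_under_diff C (perp C V)"
  unfolding closed_under_diff_def
proof (intro ballI)
  fix i w assume i: "i \<in> C" and w: "w \<in> perp C V"
  let ?d = "\<chi> j. mderiv (Poly_Mapping.single i 1) (w $ j)"
  have d: "?d = mps_act_vec (mps_var i) w"
    by (simp add: mps_act_vec_def mps_var_monom mps_act_monom)
  have "pairing v ?d = 0" if "v \<in> V" for v
    using w submodule_overD(3)[OF V mps_in_var[OF i] that]
    unfolding d pairing_act[symmetric] perp_eq_pairing[OF V] by blast
  moreover have "?d \<in> vec_in (mpol_in C)"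
    using w by (auto simp: perp_eq_pairing[OF V] vec_in_def intro: mpol_in_mderiv)
  ultimately show "?d \<in> perp C V" unfolding perp_eq_pairing[OF V] by blast
qed

end

section \<open>The Weyl-Noether module\<close>

lemma lookup_Omega: "lookup (Omega w) \<alpha> $ j = lookup (w $ j) \<alpha>"
proof -
  have "lookup (Omega w) \<alpha> $ j =
      (\<Sum>i\<in>UNIV. \<Sum>\<beta>\<in>keys (w $ i). if \<beta> = \<alpha> then axis i (lookup (w $ i) \<beta>) $ j else 0)"
    unfolding Omega_def lookup_sum sum_component
    by (intro sum.cong refl) (auto simp: lookup_single when_def)
  also have "\<dots> = (\<Sum>i\<in>UNIV. if i = j then lookup (w $ i) \<alpha> else 0)"
    by (rule sum.cong) (auto simp: axis_def in_keys_iff)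
  finally show ?thesis by simp
qed

lemma Omega_eqI: "(\<And>\<alpha> j. lookup (w $ j) \<alpha> = lookup \<epsilon> \<alpha> $ j) \<Longrightarrow> Omega w = \<epsilon>"
  by (rule poly_mapping_eqI) (simp add: vec_eq_iff lookup_Omega)

lemma inj_Omega: "inj Omega"
proof (rule injI)
  fix v w :: "('a, 'b::field) mpol ^ 'c::finite" assume "Omega v = Omega w"
  then have "lookup (v $ j) \<alpha> = lookup (w $ j) \<alpha>" for j \<alpha> by (metis lookup_Omega)
  then show "v = w" by (simp add: vec_eq_iff poly_mapping_eq_iff fun_eq_iff)
qed

lemma Omega_hom: "module_hom mpol_vec_scale wn_scale
  (Omega :: ('n::finite, 'f::field) mpol ^ 'r::finite \<Rightarrow> _)"
proof
  show "Omega (v + w) = Omega v + Omega w" for v w :: "('n, 'f) mpol ^ 'r"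
    by (rule Omega_eqI) (simp add: lookup_add lookup_Omega)
  show "Omega (mpol_vec_scale a w) = wn_scale a (Omega w)" for a and w :: "('n, 'f) mpol ^ 'r"
    by (rule Omega_eqI) (simp add: lookup_wn_scale lookup_Omega mpol_vec_scale_def)
qed

lemma Omega_linear: "Vector_Spaces.linear mpol_vec_scale wn_scale
  (Omega :: ('n::finite, 'f::field) mpol ^ 'r::finite \<Rightarrow> _)"
  using Omega_hom by (simp add: linear_iff_module_hom)

lemma keys_Omega: "\<alpha> \<in> keys (Omega w) \<longleftrightarrow> (\<exists>j. \<alpha> \<in> keys (w $ j))"
  by (simp add: in_keys_iff vec_eq_iff lookup_Omega)

lemma Omega_in_iff: "Omega w \<in> weyl_noether C \<longleftrightarrow> w \<in> vec_in (mpol_in C)"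
  unfolding weyl_noether_def vec_in_def mpol_in_def mem_Collect_eq Ball_def keys_Omega by blast

lemma surj_Omega:
  "surj (Omega :: ('n, 'f::field) mpol ^ 'r::finite \<Rightarrow> ('n, 'f, 'r) weyl_noether)"
proof (rule surjI)
  fix \<epsilon> :: "('n, 'f, 'r) weyl_noether"
  have "lookup (Poly_Mapping.map (\<lambda>v. v $ j) \<epsilon>) \<alpha> = lookup \<epsilon> \<alpha> $ j" for j \<alpha>
    by (simp add: map.rep_eq when_def)
  then show "Omega (\<chi> j. Poly_Mapping.map (\<lambda>v. v $ j) \<epsilon>) = \<epsilon>"
    by (intro Omega_eqI) simp
qed

lemma dim_Omega_image:
  fixes W :: "(('n::finite, 'f::field) mpol ^ 'r::finite) set"
  shows "wn_vs.dim (Omega ` W) = mpol_vs.dim W"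
proof -
  obtain B where B: "B \<subseteq> W" "\<not> mpol_vs.dependent B" "W \<subseteq> mpol_vs.span B" "card B = mpol_vs.dim W"
    using mpol_vs.basis_exists[of W] by metis
  have inj: "inj_on Omega S" for S :: "(('n, 'f) mpol ^ 'r) set"
    using inj_Omega by (rule inj_on_subset) simp
  show ?thesis
  proof (rule wn_vs.dim_unique)
    show "Omega ` B \<subseteq> Omega ` W" using B(1) by blast
    show "Omega ` W \<subseteq> wn_vs.span (Omega ` B)"
      using B(3) mpol_wn.linear_span_image[OF Omega_linear, of B] by blast
    show "\<not> wn_vs.dependent (Omega ` B)"
      by (rule mpol_wn.linear_independent_injective_image[OF Omega_linear B(2) inj])
    show "card (Omega ` B) = mpol_vs.dim W" using card_image[OF inj[of B]] B(4) by simp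
  qed
qed

lemma subspace_Omega_image:
  fixes W :: "(('n::finite, 'f::field) mpol ^ 'r::finite) set"
  shows "mpol_vs.subspace W \<longleftrightarrow> wn_vs.subspace (Omega ` W)"
proof
  assume "mpol_vs.subspace W"
  then show "wn_vs.subspace (Omega ` W)"
    by (rule mpol_wn.linear_subspace_image[OF Omega_linear])
next
  assume "wn_vs.subspace (Omega ` W)"
  then have "mpol_vs.subspace (Omega -` (Omega ` W))"
    by (rule mpol_wn.linear_subspace_vimage[OF Omega_linear])
  then show "mpol_vs.subspace W" by (simp add: inj_vimage_image_eq[OF inj_Omega])
qed

context residue_map
begin

text \<open>Both sides are Leibniz expansions: the coefficient \<open>binom \<alpha> \<beta> \<cdot> \<partial>\<^sup>\<beta> f\<close> of the right action is \<open>mff \<alpha> \<beta>\<close>, which comes from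
  differentiating \<open>z\<^sup>\<alpha>\<close>, times the Taylor coefficient \<open>\<partial>\<^sup>\<beta> f / \<beta>!\<close>.\<close>

lemma right_mult_Omega:
  fixes w :: "('n, 'f) mpol ^ 'r::finite"
  assumes w: "w \<in> vec_in (mpol_in C)"
  shows "wn_right_mult \<rho> (Omega w) f = Omega (mps_act_vec (eta C \<rho> f) w)"
proof (rule Omega_eqI[symmetric])
  fix \<delta> :: "'n multiindex" and j :: 'r
  let ?g = "\<lambda>\<alpha>. weyl_mult (Poly_Mapping.single \<alpha> (1 :: ('n, 'k) mpol)) (Poly_Mapping.single 0 f)"
  let ?T = "\<lambda>\<alpha> x. if snd x = \<delta> then of_nat (mbinom \<alpha> (fst x)) * \<rho> (mderiv (fst x) f) else 0"
  have g: "\<rho> (lookup (?g \<alpha>) \<delta>) = (\<Sum>x\<in>splits \<alpha>. ?T \<alpha> x)" for \<alpha>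
  proof -
    have "?g \<alpha> = (\<Sum>x\<in>splits \<alpha>. Poly_Mapping.single (snd x) (of_nat (mbinom \<alpha> (fst x)) * mderiv (fst x) f))"
      by (cases "f = 0") (simp_all add: weyl_mult_def case_prod_unfold)
    then show ?thesis
      by (auto simp: lookup_sum rho_sum lookup_single when_def rho_mult intro!: sum.cong)
  qed
  have L: "lookup (wn_right_mult \<rho> (Omega w) f) \<delta> $ j =
      (\<Sum>\<alpha>\<in>keys (Omega w). (\<Sum>x\<in>splits \<alpha>. ?T \<alpha> x) * lookup (w $ j) \<alpha>)"
  proof -
    have "lookup (\<Sum>\<beta>\<in>keys (?g \<alpha>). Poly_Mapping.single \<beta> (\<rho> (lookup (?g \<alpha>) \<beta>) *s lookup (Omega w) \<alpha>)) \<delta> =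
        \<rho> (lookup (?g \<alpha>) \<delta>) *s lookup (Omega w) \<alpha>" for \<alpha>
    proof -
      have "lookup (\<Sum>\<beta>\<in>keys (?g \<alpha>). Poly_Mapping.single \<beta> (\<rho> (lookup (?g \<alpha>) \<beta>) *s lookup (Omega w) \<alpha>)) \<delta> =
          (\<Sum>\<beta>\<in>keys (?g \<alpha>). if \<beta> = \<delta> then \<rho> (lookup (?g \<alpha>) \<beta>) *s lookup (Omega w) \<alpha> else 0)"
        unfolding lookup_sum by (intro sum.cong refl) (auto simp: lookup_single when_def)
      then show ?thesis by (simp add: in_keys_iff)
    qed
    then show ?thesis
      unfolding wn_right_mult_def Let_def lookup_sum
      by (simp add: lookup_sum[symmetric] g lookup_Omega)
  qed
  have "lookup (mps_act_vec (eta C \<rho> f) w $ j) \<delta> =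
      (\<Sum>\<alpha>\<in>keys (w $ j). (\<Sum>x\<in>splits \<alpha>. ?T \<alpha> x) * lookup (w $ j) \<alpha>)"
    unfolding mps_act_vec_def vec_lambda_beta mps_act_expand lookup_sum
  proof (rule sum.cong)
    fix \<alpha> assume "\<alpha> \<in> keys (w $ j)"
    then have C: "keys \<alpha> \<subseteq> C" using w by (auto simp: vec_in_def mpol_in_def)
    show "(\<Sum>x\<in>splits \<alpha>. lookup (Poly_Mapping.single (snd x)
        (mps_coeff (eta C \<rho> f) (fst x) * of_nat (mff \<alpha> (fst x)) * lookup (w $ j) \<alpha>)) \<delta>) =
      (\<Sum>x\<in>splits \<alpha>. ?T \<alpha> x) * lookup (w $ j) \<alpha>"
      unfolding sum_distrib_right
    proof (rule sum.cong)
      fix x assume "x \<in> splits \<alpha>"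
      then have k: "keys (fst x) \<subseteq> C" using C by (auto simp: splits_def keys_plus_nat)
      have "mbinom \<alpha> (fst x) * mfact (fst x) = mff \<alpha> (fst x)"
        by (simp add: mbinom_def mfact_def mff_def prod.distrib)
      then have "(of_nat (mff \<alpha> (fst x)) :: 'f) = of_nat (mbinom \<alpha> (fst x)) * of_nat (mfact (fst x))"
        by (metis of_nat_mult)
      then show "lookup (Poly_Mapping.single (snd x)
          (mps_coeff (eta C \<rho> f) (fst x) * of_nat (mff \<alpha> (fst x)) * lookup (w $ j) \<alpha>)) \<delta> =
        ?T \<alpha> x * lookup (w $ j) \<alpha>"
        using k by (simp add: lookup_single when_def eta_coeff)
    qed simp
  qed simp
  also have "\<dots> = (\<Sum>\<alpha>\<in>keys (Omega w). (\<Sum>x\<in>splits \<alpha>. ?T \<alpha> x) * lookup (w $ j) \<alpha>)"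
    by (rule sum.mono_neutral_left) (auto simp: keys_Omega, simp add: in_keys_iff)
  finally show "lookup (mps_act_vec (eta C \<rho> f) w $ j) \<delta> = lookup (wn_right_mult \<rho> (Omega w) f) \<delta> $ j"
    unfolding L .
qed

text \<open>By \<open>right_mult_Omega\<close> right multiplications are actions of power series, for which closure under differentiation
  suffices. Conversely \<open>\<eta>(x\<^sub>i) = y\<^sub>i + \<rho>(x\<^sub>i)\<close>, so right multiplication by \<open>x\<^sub>i\<close> is \<open>\<partial>\<^sub>i\<close> plus multiplication by a scalar.\<close>

lemma closed_under_diff_iff_bimodule:
  fixes W :: "(('n, 'f) mpol ^ 'r::finite) set"
  assumes W: "mpol_vs.subspace W" "W \<subseteq> vec_in (mpol_in C)"
  shows "closed_under_diff C W \<longleftrightarrow> wn_bimodule \<rho> (Omega ` W)"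
proof
  assume cl: "closed_under_diff C W"
  have "wn_scale (\<rho> f) (Omega w) \<in> Omega ` W" if "w \<in> W" for f w
    using wn_vs.subspace_scale that W(1) subspace_Omega_image by blast
  moreover have "wn_right_mult \<rho> (Omega w) f \<in> Omega ` W" if w: "w \<in> W" for f w
  proof -
    have "w \<in> vec_in (mpol_in C)" using w W(2) by blast
    then have "wn_right_mult \<rho> (Omega w) f = Omega (mps_act_vec (eta C \<rho> f) w)"
      by (rule right_mult_Omega)
    moreover have "mps_act_vec (eta C \<rho> f) w \<in> W"
      by (rule closed_under_mps_act[OF W(1) cl eta_in w])
    ultimately show ?thesis by simp
  qed
  ultimately show "wn_bimodule \<rho> (Omega ` W)" unfolding wn_bimodule_def by blast
next
  assume bi: "wn_bimodule \<rho> (Omega ` W)"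
  show "closed_under_diff C W"
    unfolding closed_under_diff_def
  proof (intro ballI)
    fix i w assume i: "i \<in> C" and w: "w \<in> W"
    let ?d = "\<chi> j. mderiv (Poly_Mapping.single i 1) (w $ j)"
    have "w \<in> vec_in (mpol_in C)" using w W(2) by blast
    from right_mult_Omega[OF this] bi w
    have "Omega (mps_act_vec (eta C \<rho> (mpol_var i)) w) \<in> Omega ` W"
      unfolding wn_bimodule_def by (metis imageI)
    then have "mps_act_vec (eta C \<rho> (mpol_var i)) w \<in> W"
      by (simp only: inj_image_mem_iff[OF inj_Omega])
    moreover have "mps_act_vec (eta C \<rho> (mpol_var i)) w = ?d + mpol_vec_scale (\<rho> (mpol_var i)) w"
      using i by (simp add: vec_eq_iff mps_act_vec_def eta_var mps_act_add_left mps_act_const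
          mps_var_monom mps_act_monom mpol_vec_scale_def)
    ultimately have "?d + mpol_vec_scale (\<rho> (mpol_var i)) w \<in> W" by simp
    from mpol_vs.subspace_diff[OF W(1) this mpol_vs.subspace_scale[OF W(1) w, of "\<rho> (mpol_var i)"]]
    show "?d \<in> W" by simp
  qed
qed

section \<open>Noetherian operators\<close>

lemma ex_lift:
  fixes \<epsilon> :: "('n, 'f, 'r::finite) weyl_noether"
  assumes "\<epsilon> \<in> weyl_noether C"
  shows "\<exists>d. is_lift P C \<rho> \<epsilon> d"
proof -
  obtain a s where as: "s \<notin> P"
    "\<And>x. x \<in> keys \<epsilon> \<times> (UNIV :: 'r set) \<Longrightarrow> \<rho> (a x) = \<rho> s * lookup \<epsilon> (fst x) $ snd x"
  proof (rule common_denominator[OF prime,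
        of "keys \<epsilon> \<times> (UNIV :: 'r set)" "\<lambda>x a s. \<rho> a = \<rho> s * lookup \<epsilon> (fst x) $ snd x"])
    show "\<exists>a s. s \<notin> P \<and> \<rho> a = \<rho> s * lookup \<epsilon> (fst x) $ snd x" for x
    proof -
      obtain a s where "s \<notin> P" "lookup \<epsilon> (fst x) $ snd x = \<rho> a / \<rho> s" using rho_frac by blast
      moreover from this have "\<rho> s \<noteq> 0" by (simp add: rho_zero_iff)
      ultimately show ?thesis by (intro exI[of _ a] exI[of _ s]) simp
    qed
  qed (auto simp: rho_mult)
  define d where "d = (\<chi> j. \<Sum>\<alpha>\<in>keys \<epsilon>. Poly_Mapping.single \<alpha> (a (\<alpha>, j)))"
  have d: "lookup (d $ j) \<alpha> = (if \<alpha> \<in> keys \<epsilon> then a (\<alpha>, j) else 0)" for j \<alpha>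
    by (auto simp: d_def lookup_sum lookup_single when_def)
  have "keys (d $ j) \<subseteq> keys \<epsilon>" for j
  proof
    fix \<alpha> assume "\<alpha> \<in> keys (d $ j)"
    then have "lookup (d $ j) \<alpha> \<noteq> 0" by (simp only: in_keys_iff not_False_eq_True)
    then show "\<alpha> \<in> keys \<epsilon>" by (rule contrapos_np) (simp only: d if_False)
  qed
  then have "d \<in> vec_in (rel_weyl C)"
    using assms unfolding weyl_noether_def vec_in_def rel_weyl_def by blast
  moreover have "\<rho> (lookup (d $ j) \<alpha>) = \<rho> s * lookup \<epsilon> \<alpha> $ j" for j \<alpha>
    using as(2)[of "(\<alpha>, j)"] by (cases "\<alpha> \<in> keys \<epsilon>") (simp_all add: d, simp add: in_keys_iff)
  ultimately show ?thesis unfolding is_lift_def using as(1) by blast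
qed

text \<open>The class of \<open>\<delta>(w)\<close> in \<open>F\<close> is a nonzero multiple of the pairing of \<open>\<gamma>(w)\<close> with the inverse system vector, since
  \<open>\<alpha>!\<close> times the coefficient of \<open>\<eta>(f)\<close> at \<open>\<alpha>\<close> is the class of \<open>\<partial>\<^sup>\<alpha> f\<close>.\<close>

lemma lift_annihilates_iff:
  fixes w :: "('n, 'k) mpol ^ 'r::finite"
  assumes d: "is_lift P C \<rho> (Omega e) d" and e: "e \<in> vec_in (mpol_in C)"
  shows "weyl_vec_act d w \<in> P \<longleftrightarrow> pairing (gamma C \<rho> w) e = 0"
proof -
  obtain h where h: "h \<notin> P" "\<And>\<alpha> j. \<rho> (lookup (d $ j) \<alpha>) = \<rho> h * lookup (e $ j) \<alpha>"
    using d unfolding is_lift_def lookup_Omega by blast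
  have "\<rho> (weyl_vec_act d w) = (\<Sum>j\<in>UNIV. \<Sum>\<alpha>\<in>keys (d $ j). \<rho> h * (lookup (e $ j) \<alpha> * \<rho> (mderiv \<alpha> (w $ j))))"
    by (simp add: weyl_vec_act_def weyl_act_def rho_sum rho_mult h(2) mult.assoc)
  also have "\<dots> = (\<Sum>j\<in>UNIV. \<Sum>\<alpha>\<in>keys (e $ j). \<rho> h * (lookup (e $ j) \<alpha> * \<rho> (mderiv \<alpha> (w $ j))))"
  proof (rule sum.cong)
    fix j
    have "keys (e $ j) \<subseteq> keys (d $ j)"
    proof
      fix \<alpha> assume "\<alpha> \<in> keys (e $ j)"
      then have "\<rho> (lookup (d $ j) \<alpha>) \<noteq> 0" using h by (simp add: in_keys_iff rho_zero_iff[of h])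
      then show "\<alpha> \<in> keys (d $ j)" by (auto simp: in_keys_iff)
    qed
    then show "(\<Sum>\<alpha>\<in>keys (d $ j). \<rho> h * (lookup (e $ j) \<alpha> * \<rho> (mderiv \<alpha> (w $ j)))) =
      (\<Sum>\<alpha>\<in>keys (e $ j). \<rho> h * (lookup (e $ j) \<alpha> * \<rho> (mderiv \<alpha> (w $ j))))"
      by (intro sum.mono_neutral_right) (auto simp: in_keys_iff)
  qed simp
  also have "\<dots> = \<rho> h * pairing (gamma C \<rho> w) e"
    unfolding pairing_formula sum_distrib_left
  proof (intro sum.cong refl)
    fix j \<alpha> assume "\<alpha> \<in> keys (e $ j)"
    then have "keys \<alpha> \<subseteq> C" using e by (auto simp: vec_in_def mpol_in_def)
    then show "\<rho> h * (lookup (e $ j) \<alpha> * \<rho> (mderiv \<alpha> (w $ j))) =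
      \<rho> h * (of_nat (mfact \<alpha>) * mps_coeff (gamma C \<rho> w $ j) \<alpha> * lookup (e $ j) \<alpha>)"
      by (simp add: gamma_def eta_coeff mult.commute)
  qed
  finally show ?thesis using h(1) by (simp flip: rho_zero_iff)
qed

text \<open>By duality \<open>\<gamma>(w) \<in> V\<close> iff \<open>\<gamma>(w)\<close> pairs to zero with a spanning set of \<open>perp C V\<close>, and a lifted operator computes one
  such pairing.\<close>

lemma noetherian_operators:
  fixes V :: "(('n, 'f) mps ^ 'r::finite) set"
  assumes V: "submodule_over (mps_in C) (*s) V" "V \<subseteq> vec_in (mps_in C)" "mps_perp C (perp C V) = V"
    and span: "wn_vs.span (\<epsilon> ` I) = Omega ` perp C V"
    and lift: "\<And>i. i \<in> I \<Longrightarrow> is_lift P C \<rho> (\<epsilon> i) (\<delta> i)"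
  shows "gamma C \<rho> -` V = {w. \<forall>i\<in>I. weyl_vec_act (\<delta> i) w \<in> P}"
proof -
  have "\<epsilon> ` I \<subseteq> Omega ` perp C V"
    unfolding span[symmetric] by (rule wn_vs.span_superset)
  then have "\<forall>i\<in>I. \<exists>x. x \<in> perp C V \<and> \<epsilon> i = Omega x" by blast
  from bchoice[OF this]
  obtain e where e: "\<And>i. i \<in> I \<Longrightarrow> e i \<in> perp C V" "\<And>i. i \<in> I \<Longrightarrow> \<epsilon> i = Omega (e i)"
    by blast
  have perp_in: "perp C V \<subseteq> vec_in (mpol_in C)" by (auto simp: perp_def)
  have "gamma C \<rho> w \<in> V \<longleftrightarrow> (\<forall>i\<in>I. weyl_vec_act (\<delta> i) w \<in> P)" for w
  proof -
    have "gamma C \<rho> w \<in> V \<longleftrightarrow> gamma C \<rho> w \<in> mps_perp C (perp C V)" by (simp add: V(3))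
    also have "\<dots> \<longleftrightarrow> (\<forall>e\<in>perp C V. pairing (gamma C \<rho> w) e = 0)" by (simp add: mps_perp_def)
    also have "\<dots> \<longleftrightarrow> (\<forall>i\<in>I. pairing (gamma C \<rho> w) (e i) = 0)"
    proof
      assume 0: "\<forall>i\<in>I. pairing (gamma C \<rho> w) (e i) = 0"
      let ?N = "Omega ` {x. pairing (gamma C \<rho> w) x = 0}"
      have "\<epsilon> ` I \<subseteq> ?N" using e(2) 0 by auto
      moreover have "wn_vs.subspace ?N"
        using pairing_null_subspace subspace_Omega_image by blast
      ultimately have "Omega ` perp C V \<subseteq> ?N" unfolding span[symmetric] by (rule wn_vs.span_minimal)
      then have "perp C V \<subseteq> {x. pairing (gamma C \<rho> w) x = 0}"
        by (simp only: inj_image_subset_iff[OF inj_Omega])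
      then show "\<forall>e\<in>perp C V. pairing (gamma C \<rho> w) e = 0" by blast
    qed (use e(1) in blast)
    also have "\<dots> \<longleftrightarrow> (\<forall>i\<in>I. weyl_vec_act (\<delta> i) w \<in> P)"
    proof (rule ball_cong[OF refl])
      fix i assume i: "i \<in> I"
      have "is_lift P C \<rho> (Omega (e i)) (\<delta> i)" using lift[OF i] e(2)[OF i] by simp
      moreover have "e i \<in> vec_in (mpol_in C)" using e(1)[OF i] perp_in by blast
      ultimately show "pairing (gamma C \<rho> w) (e i) = 0 \<longleftrightarrow> weyl_vec_act (\<delta> i) w \<in> P"
        using lift_annihilates_iff by blast
    qed
    finally show ?thesis .
  qed
  then show ?thesis by auto
qed

section \<open>Primary submodules and points of the Quot scheme\<close>

text \<open>Extension and contraction are mutually inverse monotone maps between the two lattices of submodules.\<close>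

lemma chain_length_extend:
  fixes N :: "(('n, 'k) mpol ^ 'r::finite) set"
  assumes N: "saturated P (*s) N" and pow: "\<And>g w. g \<in> ideal_power P m \<Longrightarrow> g *s w \<in> N"
  shows "chain_length {L. saturated P (*s) L \<and> N \<subseteq> L} =
    chain_length (mps_submodules C (extend_mod_power C \<rho> m N))" (is "chain_length ?S = chain_length ?T")
proof (rule antisym)
  let ?E = "\<lambda>L :: (('n, 'k) mpol ^ 'r) set. extend_mod_power C \<rho> m L"
  have ce: "gamma C \<rho> -` ?E L = L" if "L \<in> ?S" for L
    using that pow by (intro contraction_extend) auto
  show "chain_length ?S \<le> chain_length ?T"
  proof (rule chain_length_le[of _ ?E])
    show "?E L \<in> ?T" if "L \<in> ?S" for L
      unfolding mps_submodules_def
      by (intro CollectI conjI extend_submodule extend_mono extend_subset) (use that in blast)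
    show "?E L \<subset> ?E L'" if L: "L \<in> ?S" "L' \<in> ?S" "L \<subset> L'" for L L'
    proof -
      have "?E L \<noteq> ?E L'" using ce[OF L(1)] ce[OF L(2)] L(3) by (metis less_irrefl)
      moreover have "?E L \<subseteq> ?E L'" using L(3) by (intro extend_mono) blast
      ultimately show ?thesis by blast
    qed
  qed
  have ec: "?E (gamma C \<rho> -` V) = V" if "V \<in> ?T" for V
    using that extend_contains_ord[of m N]
    by (intro extend_contraction) (auto simp: mps_submodules_def)
  show "chain_length ?T \<le> chain_length ?S"
  proof (rule chain_length_le[of _ "vimage (gamma C \<rho>)"])
    show "gamma C \<rho> -` V \<in> ?S" if "V \<in> ?T" for V
      using that contraction_saturated extend_contains_gamma[of N m] by (fastforce simp: mps_submodules_def)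
    show "gamma C \<rho> -` V \<subset> gamma C \<rho> -` V'" if V: "V \<in> ?T" "V' \<in> ?T" "V \<subset> V'" for V V'
    proof -
      have "gamma C \<rho> -` V \<noteq> gamma C \<rho> -` V'" using ec[OF V(1)] ec[OF V(2)] V(3) by (metis less_irrefl)
      then show ?thesis using V(3) by blast
    qed
  qed
qed

text \<open>The finite length of \<open>R\<^sup>r / N\<close> at \<open>P\<close> yields \<open>P\<^sup>m R\<^sup>r \<subseteq> N\<close>, which is what \<open>chain_length_extend\<close> needs; the length is then
  read off as a dimension.\<close>

lemma quot_point_extend:
  fixes N :: "(('n, 'k) mpol ^ 'r::finite) set"
  assumes N: "saturated P (*s) N" and len: "chain_length {L. saturated P (*s) L \<and> N \<subseteq> L} = enat m"
  shows "quot_point C m (extend_mod_power C \<rho> m N)" "gamma C \<rho> -` extend_mod_power C \<rho> m N = N"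
proof -
  have pow: "g *s w \<in> N" if "g \<in> ideal_power P m" for g w
    by (rule finite_length_power[OF prime module_vec N len that])
  show "gamma C \<rho> -` extend_mod_power C \<rho> m N = N" by (rule contraction_extend[OF N pow])
  have "chain_length (mps_submodules C (extend_mod_power C \<rho> m N)) = enat m"
    using chain_length_extend[OF N pow] len by simp
  then show "quot_point C m (extend_mod_power C \<rho> m N)"
    by (rule chain_length_imp_quot_point(1)[OF extend_submodule extend_subset])
qed

lemma eta_ideal_power: "g \<in> ideal_power P m \<Longrightarrow> eta C \<rho> g \<in> mps_ord_ge m"
proof (induction m arbitrary: g)
  case (Suc m)
  have "ideal_power P (Suc m) \<subseteq> {g. eta C \<rho> g \<in> mps_ord_ge (Suc m)}"
    unfolding ideal_power.simps
  proof (rule hull_minimal, clarify)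
    fix p q assume "p \<in> P" "q \<in> ideal_power P m"
    then show "eta C \<rho> (p * q) \<in> mps_ord_ge (Suc m)"
      using mps_ord_ge_mult[of "eta C \<rho> p" "Suc 0" "eta C \<rho> q" m] Suc.IH
      by (simp add: eta_mult mps_ord_ge_1 rho_zero_iff)
  next
    show "submodule_over UNIV (*) {g. eta C \<rho> g \<in> mps_ord_ge (Suc m)}"
      by (auto simp: submodule_over_def eta_add eta_mult mps_ord_ge_add mps_ord_ge_mult_left)
  qed
  then show ?case using Suc.prems by blast
qed simp

lemma contraction_quot_point:
  fixes V :: "(('n, 'f) mps ^ 'r::finite) set"
  assumes q: "quot_point C m V"
  shows "extend_mod_power C \<rho> m (gamma C \<rho> -` V) = V" "saturated P (*s) (gamma C \<rho> -` V)"
    "g \<in> ideal_power P m \<Longrightarrow> g *s w \<in> gamma C \<rho> -` V"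
    "chain_length {L. saturated P (*s) L \<and> gamma C \<rho> -` V \<subseteq> L} = enat m"
proof -
  have V: "submodule_over (mps_in C) (*s) V" "V \<subseteq> vec_in (mps_in C)"
    using q by (auto simp: quot_point_def)
  note ord = quot_point_contains_power[OF q]
  show e: "extend_mod_power C \<rho> m (gamma C \<rho> -` V) = V" by (rule extend_contraction[OF V ord])
  show s: "saturated P (*s) (gamma C \<rho> -` V)" by (rule contraction_saturated[OF V(1)])
  show pow: "g *s w \<in> gamma C \<rho> -` V" if "g \<in> ideal_power P m" for g w
  proof -
    have "gamma C \<rho> (g *s w) \<in> vec_ord_ge m"
      unfolding gamma_scale by (rule vec_ord_ge_scale_left[OF eta_ideal_power[OF that]])
    then show ?thesis using ord gamma_in by blast
  qed
  show "chain_length {L. saturated P (*s) L \<and> gamma C \<rho> -` V \<subseteq> L} = enat m"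
    using chain_length_extend[OF s pow] quot_point_chain_length[OF q] by (simp add: e)
qed

end

theorem corollary3p3:
  fixes P :: "('n::finite, 'k::field_char_0) mpol set"
    and C :: "'n set"
    and \<psi> :: "(('n, 'k) mpol \<times> ('n, 'k) mpol) set \<Rightarrow> 'f::field"
    and smult :: "('n, 'k) mpol \<Rightarrow> 'm::ab_group_add \<Rightarrow> 'm"
    and \<pi> :: "('n, 'k) mpol ^ 'r::finite \<Rightarrow> 'm"
    and K :: "(('n, 'k) mpol ^ 'r) set"
    and m :: nat
  assumes "prime_ideal P"
    and "codimension P = enat (card C)"
    and "basis_modulo P (- C)"
    and "is_residue_field P \<psi>"
    and "module smult"
    and "module_hom (*s) smult \<pi>"
    and "surj \<pi>"
    and "K = {v. \<pi> v = 0}"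
    and "m \<ge> 1"
  defines "\<rho> \<equiv> residue_class P \<psi>"
  defines "V' \<equiv> extend_mod_power C \<rho> m K"
  defines "W' \<equiv> perp C V'"
  defines "E' \<equiv> Omega ` W'"
  defines "lift \<equiv> \<lambda>U. \<pi> -` U"
  defines "to_V \<equiv> \<lambda>U. extend_mod_power C \<rho> m (lift U)"
  defines "primary_submodules \<equiv>
    {U. primary_submodule P smult U \<and> multiplicity_over P smult U = enat m}"
  defines "quot_points \<equiv> {V. quot_point C m V \<and> V' \<subseteq> V}"
  defines "inverse_systems \<equiv>
    {W. W \<subseteq> vec_in (mpol_in C) \<and> module.subspace mpol_vec_scale W \<and>
      vector_space.dim mpol_vec_scale W = m \<and> closed_under_diff C W \<and> W \<subseteq> W'}"
  defines "bimodules \<equiv>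
    {\<E>. \<E> \<subseteq> weyl_noether C \<and> module.subspace wn_scale \<E> \<and>
      vector_space.dim wn_scale \<E> = m \<and> wn_bimodule \<rho> \<E> \<and> \<E> \<subseteq> E'}"
  shows "bij_betw to_V primary_submodules quot_points \<and>
    bij_betw (perp C) quot_points inverse_systems \<and>
    bij_betw (image Omega) inverse_systems bimodules \<and>
    (\<forall>U\<in>primary_submodules. \<forall>\<epsilon>. is_basis_of wn_scale m \<epsilon> (Omega ` perp C (to_V U)) \<longrightarrow>
      (\<forall>i\<in>{1..m}. \<exists>d. is_lift P C \<rho> (\<epsilon> i) d) \<and>
      (\<forall>\<delta>. (\<forall>i\<in>{1..m}. is_lift P C \<rho> (\<epsilon> i) (\<delta> i)) \<longrightarrow>
        lift U = {w. \<forall>i\<in>{1..m}. weyl_vec_act (\<delta> i) w \<in> P}))"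
proof -
  interpret residue_map P C \<rho>
    unfolding \<rho>_def by (rule residue_map_residue_class) fact+
  note prime = \<open>prime_ideal P\<close> and M = \<open>module smult\<close> and hom = \<open>module_hom (*s) smult \<pi>\<close>
    and surj = \<open>surj \<pi>\<close> and K = \<open>K = {v. \<pi> v = 0}\<close> and m = \<open>m \<ge> 1\<close>
  interpret \<pi>: module_hom "(*s)" smult \<pi> by (rule hom)
  have im: "\<pi> ` (\<pi> -` U) = U" for U using surj by (simp add: surj_image_vimage_eq)

  have prim: "saturated P smult U" "saturated P (*s) (lift U)"
    "chain_length {L. saturated P (*s) L \<and> lift U \<subseteq> L} = enat m"
    if "U \<in> primary_submodules" for U
  proof -
    have U: "primary_submodule P smult U" "multiplicity_over P smult U = enat m"
      using that by (auto simp: primary_submodules_def)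
    show s: "saturated P smult U" by (rule primary_imp_saturated[OF M U(1)])
    show "saturated P (*s) (lift U)" unfolding lift_def by (rule saturated_vimage[OF hom s])
    show "chain_length {L. saturated P (*s) L \<and> lift U \<subseteq> L} = enat m"
      using U(2) unfolding multiplicity_eq_chain_length[OF prime M s] lift_def
        chain_length_vimage[OF hom surj s] .
  qed
  note ext = quot_point_extend[OF prim(2,3)]
  have toV: "to_V U \<in> quot_points" "\<pi> ` (gamma C \<rho> -` to_V U) = U" if "U \<in> primary_submodules" for U
  proof -
    have "K \<subseteq> lift U" using saturatedD(1)[OF prim(1)[OF that]] by (auto simp: K lift_def)
    then show "to_V U \<in> quot_points"
      using ext(1)[OF that that] by (simp add: quot_points_def to_V_def V'_def extend_mono)
    show "\<pi> ` (gamma C \<rho> -` to_V U) = U"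
      unfolding to_V_def ext(2)[OF that that] unfolding lift_def by (rule im)
  qed
  have fromV: "\<pi> ` (gamma C \<rho> -` V) \<in> primary_submodules" "to_V (\<pi> ` (gamma C \<rho> -` V)) = V"
    if "V \<in> quot_points" for V
  proof -
    have q: "quot_point C m V" and V': "V' \<subseteq> V" using that by (auto simp: quot_points_def)
    note c = contraction_quot_point[OF q]
    let ?N = "gamma C \<rho> -` V" and ?U = "\<pi> ` (gamma C \<rho> -` V)"
    have ker: "{v. \<pi> v = 0} \<subseteq> ?N"
      using V' extend_contains_gamma[of K m] unfolding V'_def K by blast
    have vi: "\<pi> -` ?U = ?N" by (rule vimage_image_eq_if_kernel[OF hom saturatedD(5)[OF c(2)] ker])
    have s: "saturated P smult ?U" by (rule saturated_image[OF hom surj c(2) ker])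
    have len: "multiplicity_over P smult ?U = enat m"
      unfolding multiplicity_eq_chain_length[OF prime M s] chain_length_vimage[OF hom surj s] vi
      by (rule c(4))
    have pow: "smult g x \<in> ?U" if g: "g \<in> ideal_power P m" for g x
    proof -
      obtain w where "x = \<pi> w" using surj by (metis surjD)
      then have "smult g x = \<pi> (g *s w)" by (simp add: \<pi>.scale)
      then show ?thesis using c(3)[OF g, of w] by blast
    qed
    \<comment> \<open>otherwise \<open>M / U\<close> would have length \<open>0\<close> instead of \<open>m\<close>\<close>
    have "?U \<noteq> UNIV"
    proof
      assume U: "?U = UNIV"
      have N: "?N = UNIV" using vi unfolding U by simp
      then have "{L. saturated P (*s) L \<and> ?N \<subseteq> L} \<subseteq> {UNIV}" by auto
      then have "chain_length {L. saturated P (*s) L \<and> ?N \<subseteq> L} \<le>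
          chain_length {UNIV :: (('n, 'k) mpol ^ 'r) set}"
        by (intro chain_length_le[of _ "\<lambda>x. x"]) auto
      also have "\<dots> \<le> enat 0"
        unfolding chain_length_def
      proof (rule Sup_least, clarify)
        fix k and N :: "nat \<Rightarrow> (('n, 'k) mpol ^ 'r) set"
        assume N: "\<forall>i\<le>k. N i \<in> {UNIV}" "\<forall>i<k. N i \<subset> N (Suc i)"
        have "k = 0"
        proof (rule ccontr)
          assume "k \<noteq> 0"
          then have "N 0 \<subset> N (Suc 0)" "N 0 = UNIV" using N by auto
          then show False by blast
        qed
        then show "enat k \<le> enat 0" by simp
      qed
      finally show False using c(4) m by simp
    qed
    then have "primary_submodule P smult ?U" by (rule saturated_imp_primary[OF prime M s _ pow])
    then show "?U \<in> primary_submodules" using len by (simp add: primary_submodules_def)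
    show "to_V ?U = V" by (simp add: to_V_def lift_def vi c(1))
  qed
  have bij1: "bij_betw to_V primary_submodules quot_points"
    by (rule bij_betw_byWitness[where f' = "\<lambda>V. \<pi> ` (gamma C \<rho> -` V)"]) (use toV fromV in auto)

  have quotD: "submodule_over (mps_in C) (*s) V" "V \<subseteq> vec_in (mps_in C)" "V' \<subseteq> V" "quot_point C m V"
    if "V \<in> quot_points" for V
    using that by (auto simp: quot_points_def quot_point_def)
  have dual: "perp C V \<in> inverse_systems" "mps_perp C (perp C V) = V" if V: "V \<in> quot_points" for V
  proof -
    obtain b e where "dual_bases m V b e" using dual_bases_of_quot_point[OF quotD(4)[OF V]] .
    note d = dual_basesD[OF quotD(1,2)[OF V] this]
    show "mps_perp C (perp C V) = V" by (rule d(4))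
    have "perp C V \<subseteq> vec_in (mpol_in C)" by (auto simp: perp_def)
    moreover have "mpol_vs.subspace (perp C V)" unfolding d(2) by (rule mpol_vs.subspace_span)
    moreover have "perp C V \<subseteq> W'" using quotD(3)[OF V] unfolding W'_def perp_def by blast
    ultimately show "perp C V \<in> inverse_systems"
      using d(3) perp_closed_under_diff[OF quotD(1)[OF V]] by (simp add: inverse_systems_def)
  qed
  have V'sub: "submodule_over (mps_in C) (*s) V'" "V' \<subseteq> vec_in (mps_in C)"
    unfolding V'_def by (rule extend_submodule, rule extend_subset)
  have dual': "mps_perp C W \<in> quot_points" "perp C (mps_perp C W) = W" if "W \<in> inverse_systems" for W
  proof -
    have W: "W \<subseteq> vec_in (mpol_in C)" "mpol_vs.subspace W" "mpol_vs.dim W = m" "closed_under_diff C W"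
      "W \<subseteq> W'"
      using that by (auto simp: inverse_systems_def)
    obtain b e where be: "dual_bases m (mps_perp C W) b e" "W = mpol_vs.span (e ` {..<m})"
      using dual_bases_of_inverse_system[OF W(1-3) m] .
    have sub: "submodule_over (mps_in C) (*s) (mps_perp C W)" by (rule mps_perp_submodule[OF W(2,4)])
    have sub': "mps_perp C W \<subseteq> vec_in (mps_in C)" by (auto simp: mps_perp_def)
    note d = dual_basesD[OF sub sub' be(1)]
    show "perp C (mps_perp C W) = W" using d(2) be(2) by simp
    have "V' \<subseteq> mps_perp C W"
      using W(5) V'sub(2) unfolding W'_def perp_eq_pairing[OF V'sub(1)] mps_perp_def by blast
    then show "mps_perp C W \<in> quot_points" using d(1) by (simp add: quot_points_def)
  qed
  have bij2: "bij_betw (perp C) quot_points inverse_systems"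
    by (rule bij_betw_byWitness[where f' = "mps_perp C"]) (use dual dual' in auto)

  have W'_in: "W' \<subseteq> vec_in (mpol_in C)" by (auto simp: W'_def perp_def)
  have iff: "W \<in> inverse_systems \<longleftrightarrow> Omega ` W \<in> bimodules" for W
  proof -
    have 1: "Omega ` W \<subseteq> weyl_noether C \<longleftrightarrow> W \<subseteq> vec_in (mpol_in C)"
      using Omega_in_iff by blast
    have 2: "Omega ` W \<subseteq> E' \<longleftrightarrow> W \<subseteq> W'"
      unfolding E'_def by (rule inj_image_subset_iff[OF inj_Omega])
    show ?thesis
      unfolding inverse_systems_def bimodules_def mem_Collect_eq 1 2 dim_Omega_image
        subspace_Omega_image[symmetric]
      using closed_under_diff_iff_bimodule by blast
  qed
  have "image Omega ` inverse_systems = bimodules"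
  proof
    show "image Omega ` inverse_systems \<subseteq> bimodules" using iff by blast
    show "bimodules \<subseteq> image Omega ` inverse_systems"
    proof
      fix \<E> assume E: "\<E> \<in> bimodules"
      have "\<E> = Omega ` (Omega -` \<E>)" by (simp only: surj_image_vimage_eq[OF surj_Omega])
      then show "\<E> \<in> image Omega ` inverse_systems" using E iff[of "Omega -` \<E>"] by (metis imageI)
    qed
  qed
  moreover have "inj_on (image Omega) inverse_systems"
    by (rule inj_onI) (simp only: inj_image_eq_iff[OF inj_Omega])
  ultimately have bij3: "bij_betw (image Omega) inverse_systems bimodules"
    by (simp add: bij_betw_def)

  have ops: "(\<forall>i\<in>{1..m}. \<exists>d. is_lift P C \<rho> (\<epsilon> i) d) \<and>
      (\<forall>\<delta>. (\<forall>i\<in>{1..m}. is_lift P C \<rho> (\<epsilon> i) (\<delta> i)) \<longrightarrow>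
        lift U = {w. \<forall>i\<in>{1..m}. weyl_vec_act (\<delta> i) w \<in> P})"
    if U: "U \<in> primary_submodules" and b: "is_basis_of wn_scale m \<epsilon> (Omega ` perp C (to_V U))" for U \<epsilon>
  proof (intro conjI ballI allI impI)
    note V = toV(1)[OF U]
    have span: "wn_vs.span (\<epsilon> ` {1..m}) = Omega ` perp C (to_V U)"
      using b by (simp add: is_basis_of_def)
    show "\<exists>d. is_lift P C \<rho> (\<epsilon> i) d" if "i \<in> {1..m}" for i
    proof (rule ex_lift)
      have "\<epsilon> i \<in> Omega ` perp C (to_V U)"
        unfolding span[symmetric] using that by (intro wn_vs.span_base imageI)
      then obtain e where "e \<in> perp C (to_V U)" "\<epsilon> i = Omega e" by blast
      then show "\<epsilon> i \<in> weyl_noether C" by (simp add: Omega_in_iff perp_def)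
    qed
    fix \<delta> assume "\<forall>i\<in>{1..m}. is_lift P C \<rho> (\<epsilon> i) (\<delta> i)"
    then have "gamma C \<rho> -` to_V U = {w. \<forall>i\<in>{1..m}. weyl_vec_act (\<delta> i) w \<in> P}"
      by (intro noetherian_operators[OF quotD(1,2)[OF V] dual(2)[OF V] span]) auto
    then show "lift U = {w. \<forall>i\<in>{1..m}. weyl_vec_act (\<delta> i) w \<in> P}"
      using ext(2)[OF U U] by (simp add: to_V_def)
  qed
  show ?thesis using bij1 bij2 bij3 ops by blast
qed

end
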